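(* Let $(\mathscr S,\Sigma,\mu)$ be an equicontinuous spectral measure triple with values in $\mathscr L(\mathscr F)$, where $\mathscr F$ is a separable, sequentially complete, locally sequentially weakly compact, locally convex linear topological space. Let $f:\mathscr S\to\mathbb C$ be bounded and $\Sigma$-measurable, let $U=\int_{\mathscr S} f\,d\mu\in\mathscr L(\mathscr F)$, and let $E=\mu\circ f^{-1}$. Assume that $U$ has dominating point spectrum and that the point spectrum of $U$ is concentrated on isolated circles. Let $\lambda\ne 0$ be an eigenvalue of $U$, put $\Omega:=\{\mu\in\sigma_p(U) : |\mu|>|\lambda|\}$, and write $P_\nu:=E(\{\nu\})$ for an eigenvalue $\nu$. Then $$P_\lambda=\lim_{n\to\infty}A_n\Big(\lambda^{-1}U\big(I-\sum_{\mu\in\Omega}P_\mu\big)\Big)=\lim_{n\to\infty} n^{-1}\sum_{k=1}^{n-1}\lambda^{-k}U^{k}\Big(I-\sum_{\mu\in\Omega}P_\mu\Big),$$ where the limits exist in the strong operator topology. Furthermore, if $\Omega$ is a finite set, then for $\psi\in\mathscr F$ the element $P_\lambda\psi$ can be obtained via a finite recursion, by computing $P_\mu\psi$ for each $\mu\in\Omega$ with the same limit formula (with $\mu$ in the role of $\lambda$) and subtracting it from $\psi$.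
   Context: A locally convex linear topological space $\mathscr F$ is a complex vector space with the locally convex topology (the "strong topology") generated by a separating family of seminorms. $\mathscr L(\mathscr F)$ is the set of continuous linear operators on $\mathscr F$; $\mathscr F^*$ is the topological dual. $\mathscr F$ is locally sequentially weakly compact if every bounded sequence has a subsequence converging weakly to an element of $\mathscr F$. $T_n\to T$ in the strong operator topology means $p(T_n\psi-T\psi)\to0$ for every $\psi\in\mathscr F$ and every continuous seminorm $p$. Spectral measure triple: $\mathscr S$ is a set, $\Sigma$ a $\sigma$-algebra of subsets of $\mathscr S$, and $\mu:\Sigma\to\mathscr L(\mathscr F)$ is countably additive in the weak operator topology with $\mu(\mathscr S)=I$ and $\mu(A_1\cap A_2)=\mu(A_1)\mu(A_2)$. It is equicontinuous if $\{\mu(A):A\in\Sigma\}$ is an equicontinuous family, i.e. for every continuous seminorm $p$ there is a continuous seminorm $p'$ with $p(\mu(A)\psi)\le p'(\psi)$ for all $A\in\Sigma$ and $\psi\in\mathscr F$. Under equicontinuity and sequential completeness, $\int_{\mathscr S} g\,d\mu\in\mathscr L(\mathscr F)$ is defined for bounded $\Sigma$-measurable $g:\mathscr S\to\mathbb C$ (extending the obvious definition on simple functions) and is multiplicative. With $E:=\mu\circ f^{-1}$ (on Borel subsets of $\mathbb C$), $U=\int_{\mathbb C} z\,E(dz)$. The resolvent set $\rho(U)$ is the set of $\xi\in\mathbb C$ such that the image of $\xi I-U$ is dense and $(\xi I-U)^{-1}$ exists and is continuous; $\sigma(U)=\mathbb C\setminus\rho(U)$; $\sigma_p(U)$ is the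 set of $\lambda\in\sigma(U)$ for which $\lambda I-U$ has no inverse. Peripheral spectrum: for $B\subset\mathbb C$, the peripheral spectrum of $\sigma(U)\cap B$ is $\{\lambda\in\sigma(U)\cap B : |\lambda|=\sup_{\xi\in\sigma(U)\cap B}|\xi|\}$. Dominating point spectrum: with $\mathbb D_r$ the open disc of radius $r$ about $0$ and $\sigma(U;\mathbb D_r):=\mathbb D_r\cap\sigma(U)$, $U$ has dominating point spectrum if there is $R>0$ such that $\sigma(U)\setminus\mathbb D_R\neq\emptyset$ and for every $r>R$: (i) if $\sigma(U;\mathbb D_r)\cap\sigma_p(U)\ne\emptyset$, then the peripheral spectrum of $\sigma(U;\mathbb D_r)$ is not empty; and (ii) $\sigma(U)\setminus\mathbb D_r$ consists only of eigenvalues. Point spectrum concentrated on isolated circles: every point of $\{r\in\mathbb R : \exists s\in\mathscr S,\ |f(s)|=r,\ (f(s)I-U)^{-1}\text{ does not exist}\}$ is an isolated point; equivalently, $\{|\lambda|:\lambda\in\sigma_p(U)\}$ is a discrete set. Averaging operators: $A_n(T):=n^{-1}\sum_{k=0}^{n-1}T^k$.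
   Formalization: The formal theorem also assumes |λ| ≥ R for some radius R witnessing dominating point spectrum; without this the claim is false (multiplication by x on L²[0,1] plus eigenvalues 2 and 1/2, with λ = 1/2). *)

theory Defs
  imports "HOL-Analysis.Analysis"
begin

section \<open>Locally convex spaces\<close>

text \<open>The distribution has no class of complex topological vector spaces. The whole type \<open>'a\<close>,
  with a scalar multiplication \<open>smul\<close>, is the complex vector space; \<open>T\<close> is its strong topology.\<close>

definition seminorm :: "(complex \<Rightarrow> 'a::ab_group_add \<Rightarrow> 'a) \<Rightarrow> ('a \<Rightarrow> real) \<Rightarrow> bool" where
  "seminorm smul p \<longleftrightarrow>
     (\<forall>x y. p (x + y) \<le> p x + p y) \<and> (\<forall>c x. p (smul c x) = cmod c * p x)"

text \<open>\<open>UNIV\<close> is added to the subbasis only so that an empty family on the zero space is harmless.\<close>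

definition seminorm_topology :: "('a::ab_group_add \<Rightarrow> real) set \<Rightarrow> 'a topology" where
  "seminorm_topology SN =
     topology_generated_by (insert UNIV {{y. p (y - x) < e} | p x e. p \<in> SN \<and> 0 < e})"

definition locally_convex_space ::
  "(complex \<Rightarrow> 'a::ab_group_add \<Rightarrow> 'a) \<Rightarrow> 'a topology \<Rightarrow> bool" where
  "locally_convex_space smul T \<longleftrightarrow>
     vector_space smul \<and>
     (\<exists>SN. (\<forall>p\<in>SN. seminorm smul p) \<and> (\<forall>x. x \<noteq> 0 \<longrightarrow> (\<exists>p\<in>SN. p x \<noteq> 0)) \<and>
           T = seminorm_topology SN)"

definition continuous_seminorms ::
  "(complex \<Rightarrow> 'a::ab_group_add \<Rightarrow> 'a) \<Rightarrow> 'a topology \<Rightarrow> ('a \<Rightarrow> real) set" where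
  "continuous_seminorms smul T = {p. seminorm smul p \<and> continuous_map T euclideanreal p}"

definition continuous_operators ::
  "(complex \<Rightarrow> 'a::ab_group_add \<Rightarrow> 'a) \<Rightarrow> 'a topology \<Rightarrow> ('a \<Rightarrow> 'a) set" where
  "continuous_operators smul T = {A. Vector_Spaces.linear smul smul A \<and> continuous_map T T A}"

definition topological_dual ::
  "(complex \<Rightarrow> 'a::ab_group_add \<Rightarrow> 'a) \<Rightarrow> 'a topology \<Rightarrow> ('a \<Rightarrow> complex) set" where
  "topological_dual smul T =
     {\<phi>. Vector_Spaces.linear smul (*) \<phi> \<and> continuous_map T euclidean \<phi>}"

definition sequentially_complete ::
  "(complex \<Rightarrow> 'a::ab_group_add \<Rightarrow> 'a) \<Rightarrow> 'a topology \<Rightarrow> bool" where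
  "sequentially_complete smul T \<longleftrightarrow>
     (\<forall>x :: nat \<Rightarrow> 'a.
        (\<forall>p\<in>continuous_seminorms smul T. \<forall>e>0. \<exists>N. \<forall>m\<ge>N. \<forall>n\<ge>N. p (x m - x n) < e)
        \<longrightarrow> (\<exists>l. limitin T x l sequentially))"

definition weakly_converges ::
  "(complex \<Rightarrow> 'a::ab_group_add \<Rightarrow> 'a) \<Rightarrow> 'a topology \<Rightarrow> (nat \<Rightarrow> 'a) \<Rightarrow> 'a \<Rightarrow> bool" where
  "weakly_converges smul T x l \<longleftrightarrow>
     (\<forall>\<phi>\<in>topological_dual smul T. (\<lambda>n. \<phi> (x n)) \<longlonglongrightarrow> \<phi> l)"

definition locally_sequentially_weakly_compact ::
  "(complex \<Rightarrow> 'a::ab_group_add \<Rightarrow> 'a) \<Rightarrow> 'a topology \<Rightarrow> bool" where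
  "locally_sequentially_weakly_compact smul T \<longleftrightarrow>
     (\<forall>x :: nat \<Rightarrow> 'a.
        (\<forall>p\<in>continuous_seminorms smul T. bdd_above (range (\<lambda>n. p (x n))))
        \<longrightarrow> (\<exists>r l. strict_mono r \<and> weakly_converges smul T (x \<circ> r) l))"

definition sot_tendsto ::
  "(complex \<Rightarrow> 'a::ab_group_add \<Rightarrow> 'a) \<Rightarrow> 'a topology \<Rightarrow>
    ('i \<Rightarrow> 'a \<Rightarrow> 'a) \<Rightarrow> ('a \<Rightarrow> 'a) \<Rightarrow> 'i filter \<Rightarrow> bool" where
  "sot_tendsto smul T A B F \<longleftrightarrow>
     (\<forall>\<psi>. \<forall>p\<in>continuous_seminorms smul T. ((\<lambda>i. p (A i \<psi> - B \<psi>)) \<longlongrightarrow> 0) F)"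

text \<open>Unordered sums of operators: the net of finite partial sums converges in the strong
  operator topology. The sum \<open>Q\<close> is unique because the seminorms separate points.\<close>

definition sot_has_sum ::
  "(complex \<Rightarrow> 'a::ab_group_add \<Rightarrow> 'a) \<Rightarrow> 'a topology \<Rightarrow>
    ('i \<Rightarrow> 'a \<Rightarrow> 'a) \<Rightarrow> 'i set \<Rightarrow> ('a \<Rightarrow> 'a) \<Rightarrow> bool" where
  "sot_has_sum smul T A I Q \<longleftrightarrow>
     sot_tendsto smul T (\<lambda>F \<psi>. \<Sum>i\<in>F. A i \<psi>) Q (finite_subsets_at_top I)"


section \<open>Spectral measures\<close>

text \<open>Only \<open>space M\<close> and \<open>sets M\<close> are used of \<open>M\<close>, as the set and its sigma-algebra.\<close>

definition spectral_measure ::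
  "(complex \<Rightarrow> 'a::ab_group_add \<Rightarrow> 'a) \<Rightarrow> 'a topology \<Rightarrow> 's measure \<Rightarrow>
    ('s set \<Rightarrow> 'a \<Rightarrow> 'a) \<Rightarrow> bool" where
  "spectral_measure smul T M mu \<longleftrightarrow>
     (\<forall>A\<in>sets M. mu A \<in> continuous_operators smul T) \<and>
     (\<forall>A :: nat \<Rightarrow> 's set. range A \<subseteq> sets M \<longrightarrow> disjoint_family A \<longrightarrow>
        (\<forall>\<psi>. \<forall>\<phi>\<in>topological_dual smul T.
           (\<lambda>i. \<phi> (mu (A i) \<psi>)) sums \<phi> (mu (\<Union>i. A i) \<psi>))) \<and>
     mu (space M) = id \<and>
     (\<forall>A\<in>sets M. \<forall>B\<in>sets M. mu (A \<inter> B) = mu A \<circ> mu B)"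

definition equicontinuous_spectral_measure ::
  "(complex \<Rightarrow> 'a::ab_group_add \<Rightarrow> 'a) \<Rightarrow> 'a topology \<Rightarrow> 's measure \<Rightarrow>
    ('s set \<Rightarrow> 'a \<Rightarrow> 'a) \<Rightarrow> bool" where
  "equicontinuous_spectral_measure smul T M mu \<longleftrightarrow>
     spectral_measure smul T M mu \<and>
     (\<forall>p\<in>continuous_seminorms smul T. \<exists>p'\<in>continuous_seminorms smul T.
        \<forall>A\<in>sets M. \<forall>\<psi>. p (mu A \<psi>) \<le> p' \<psi>)"

definition simple_spectral_integral ::
  "(complex \<Rightarrow> 'a::ab_group_add \<Rightarrow> 'a) \<Rightarrow> 's measure \<Rightarrow> ('s set \<Rightarrow> 'a \<Rightarrow> 'a) \<Rightarrow>
    ('s \<Rightarrow> complex) \<Rightarrow> 'a \<Rightarrow> 'a" where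
  "simple_spectral_integral smul M mu g \<psi> =
     (\<Sum>c\<in>g ` space M. smul c (mu (g -` {c} \<inter> space M) \<psi>))"

text \<open>Extension to bounded measurable \<open>g\<close> by uniform approximation. Under equicontinuity and
  sequential completeness the limit exists and does not depend on the approximating sequence.\<close>

definition spectral_integral ::
  "(complex \<Rightarrow> 'a::ab_group_add \<Rightarrow> 'a) \<Rightarrow> 'a topology \<Rightarrow> 's measure \<Rightarrow>
    ('s set \<Rightarrow> 'a \<Rightarrow> 'a) \<Rightarrow> ('s \<Rightarrow> complex) \<Rightarrow> 'a \<Rightarrow> 'a" where
  "spectral_integral smul T M mu g \<psi> =
     (THE v. \<forall>s. (\<forall>n. simple_function M (s n)) \<longrightarrow> uniform_limit (space M) s g sequentially \<longrightarrow>
        limitin T (\<lambda>n. simple_spectral_integral smul M mu (s n) \<psi>) v sequentially)"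

definition spectral_pushforward ::
  "'s measure \<Rightarrow> ('s set \<Rightarrow> 'a \<Rightarrow> 'a) \<Rightarrow> ('s \<Rightarrow> complex) \<Rightarrow> complex set \<Rightarrow> 'a \<Rightarrow> 'a" where
  "spectral_pushforward M mu f B = mu (f -` B \<inter> space M)"


section \<open>Spectra\<close>

definition pencil ::
  "(complex \<Rightarrow> 'a::ab_group_add \<Rightarrow> 'a) \<Rightarrow> ('a \<Rightarrow> 'a) \<Rightarrow> complex \<Rightarrow> 'a \<Rightarrow> 'a" where
  "pencil smul U \<xi> \<psi> = smul \<xi> \<psi> - U \<psi>"

text \<open>The inverse of \<open>\<xi>I - U\<close> is defined on the range only, so its existence is injectivity
  and its continuity refers to the subspace topology of the range.\<close>

definition resolvent_set ::
  "(complex \<Rightarrow> 'a::ab_group_add \<Rightarrow> 'a) \<Rightarrow> 'a topology \<Rightarrow> ('a \<Rightarrow> 'a) \<Rightarrow> complex set" where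
  "resolvent_set smul T U =
     {\<xi>. T closure_of range (pencil smul U \<xi>) = UNIV \<and> inj (pencil smul U \<xi>) \<and>
         continuous_map (subtopology T (range (pencil smul U \<xi>))) T (inv (pencil smul U \<xi>))}"

definition spectrum ::
  "(complex \<Rightarrow> 'a::ab_group_add \<Rightarrow> 'a) \<Rightarrow> 'a topology \<Rightarrow> ('a \<Rightarrow> 'a) \<Rightarrow> complex set" where
  "spectrum smul T U = - resolvent_set smul T U"

definition point_spectrum ::
  "(complex \<Rightarrow> 'a::ab_group_add \<Rightarrow> 'a) \<Rightarrow> 'a topology \<Rightarrow> ('a \<Rightarrow> 'a) \<Rightarrow> complex set" where
  "point_spectrum smul T U = {z \<in> spectrum smul T U. \<not> inj (pencil smul U z)}"

text \<open>The supremum is taken in the extended reals, so that it also makes sense for unbounded sets.\<close>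

definition peripheral_part :: "complex set \<Rightarrow> complex set" where
  "peripheral_part S = {z \<in> S. ereal (cmod z) = (SUP w\<in>S. ereal (cmod w))}"

text \<open>\<open>U\<close> has dominating point spectrum iff this holds for some \<open>R\<close>. The radius is kept as
  a parameter because nothing is known about the spectrum inside \<open>ball 0 R\<close>: averages normalised
  by an eigenvalue of modulus below every such \<open>R\<close> may diverge.\<close>

definition dominating_point_spectrum_from ::
  "(complex \<Rightarrow> 'a::ab_group_add \<Rightarrow> 'a) \<Rightarrow> 'a topology \<Rightarrow> ('a \<Rightarrow> 'a) \<Rightarrow> real \<Rightarrow> bool" where
  "dominating_point_spectrum_from smul T U R \<longleftrightarrow>
     0 < R \<and> spectrum smul T U - ball 0 R \<noteq> {} \<and>
     (\<forall>r>R.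
        (ball 0 r \<inter> spectrum smul T U \<inter> point_spectrum smul T U \<noteq> {} \<longrightarrow>
           peripheral_part (ball 0 r \<inter> spectrum smul T U) \<noteq> {}) \<and>
        spectrum smul T U - ball 0 r \<subseteq> point_spectrum smul T U)"

definition concentrated_on_isolated_circles ::
  "(complex \<Rightarrow> 'a::ab_group_add \<Rightarrow> 'a) \<Rightarrow> 's measure \<Rightarrow> ('s \<Rightarrow> complex) \<Rightarrow> ('a \<Rightarrow> 'a) \<Rightarrow> bool" where
  "concentrated_on_isolated_circles smul M f U \<longleftrightarrow>
     discrete {r :: real. \<exists>s\<in>space M. cmod (f s) = r \<and> \<not> inj (pencil smul U (f s))}"

definition averaging ::
  "(complex \<Rightarrow> 'a::ab_group_add \<Rightarrow> 'a) \<Rightarrow> nat \<Rightarrow> ('a \<Rightarrow> 'a) \<Rightarrow> 'a \<Rightarrow> 'a" where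
  "averaging smul n A \<psi> = smul (inverse (of_nat n)) (\<Sum>k<n. (A ^^ k) \<psi>)"

end

theory Submission
  imports Defs "HOL-Library.Diagonal_Subsequence" "HOL-Real_Asymp.Real_Asymp"
begin

text \<open>On the range of \<open>I - \<Sum> P\<^sub>\<mu>\<close> the operator \<open>\<lambda>\<^sup>-\<^sup>1 U\<close> is the integral of a function of modulus at most one, so
  its averages are integrals of functions that converge boundedly to the indicator of \<open>f = \<lambda>\<close>, and a
  bounded convergence theorem (equicontinuity, and strong countable additivity from Hahn--Banach)
  gives the limit. This needs \<open>\<Sum> P\<^sub>\<mu> = E(|z| > |\<lambda>|)\<close>, that is, no continuous part of \<open>E\<close> outside
  the circle. The set \<open>{|z| > |\<lambda>|}\<close> consists of eigenvalues and resolvent points. A Borel set of resolvent points is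
  null. A continuous part would, by Wiener's lemma, yield a sequence of characters \<open>(z/|z|)\<^sup>n\<close>
  no subsequence of which converges almost everywhere, whereas separability and
  sequential weak compactness give a subsequence that converges at every eigenvalue.\<close>

section \<open>Seminorms and the Hahn--Banach theorem\<close>

text \<open>Separability alone does not bound the number of eigenvalues: a product of continuum many
  copies of the complex numbers is separable, and multiplication by a bounded injective function of
  the index has continuum many eigenvalues there. So \<open>\<Omega>\<close> is never enumerated.
  Its projections are summed as a net over finite subsets, and Hahn--Banach reduces the convergence
  to scalars: a functional \<open>\<phi>\<close> that is unchanged by E(|z| > |\<lambda>|) and
  annihilates every \<open>P \<nu>\<close> must be zero. The characters see only the angle, so they
  identify the points of a ray. Isolated circles make the moduli of the eigenvalues countable, hence
  a ray carries countably many of them and is null for \<open>\<phi>\<close>. This is the absence of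
  angular atoms that Wiener's lemma requires. The contradiction works with differences of exponents.
  They are chosen so that the coefficients at all differences are small; once the characters
  converge at each eigenvalue, consecutive quotients tend to 1 there, and bounded convergence drives
  the same coefficients to \<open>\<phi> \<psi>\<close>.\<close>

definition sublinear :: "(complex \<Rightarrow> 'a::ab_group_add \<Rightarrow> 'a) \<Rightarrow> ('a \<Rightarrow> real) \<Rightarrow> bool" where
  "sublinear smul q \<longleftrightarrow>
     (\<forall>x y. q (x + y) \<le> q x + q y) \<and> (\<forall>t>0. \<forall>x. q (smul (of_real t) x) = t * q x)"

text \<open>The one-sided directional derivative of \<open>q\<close> at \<open>y\<close> in the
  direction \<open>x\<close>: for \<open>t = 1/s\<close> the bracket is the difference quotient with
  step \<open>s\<close>. For sublinear \<open>q\<close> it is a minorant of \<open>q\<close> whose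
  value at \<open>- y\<close> is at most \<open>- q y\<close>.\<close>

definition slope ::
  "(complex \<Rightarrow> 'a::ab_group_add \<Rightarrow> 'a) \<Rightarrow> ('a \<Rightarrow> real) \<Rightarrow> 'a \<Rightarrow> 'a \<Rightarrow> real" where
  "slope smul q y x = (INF t\<in>{0..}. q (x + smul (of_real t) y) - t * q y)"

locale complex_vector_space = vector_space smul
  for smul :: "complex \<Rightarrow> 'a::ab_group_add \<Rightarrow> 'a"
begin

lemma seminorm_add: "seminorm smul p \<Longrightarrow> p (x + y) \<le> p x + p y"
  by (simp add: seminorm_def)

lemma seminorm_scale: "seminorm smul p \<Longrightarrow> p (smul c x) = cmod c * p x"
  by (simp add: seminorm_def)

lemma seminorm_zero: "seminorm smul p \<Longrightarrow> p 0 = 0"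
  using seminorm_scale[of p 0 0] by simp

lemma seminorm_minus: "seminorm smul p \<Longrightarrow> p (- x) = p x"
  using seminorm_scale[of p "-1" x] by simp

lemma seminorm_nonneg: "seminorm smul p \<Longrightarrow> 0 \<le> p x"
  using seminorm_add[of p x "-x"] seminorm_minus[of p x] seminorm_zero[of p] by simp

lemma seminorm_diff: "seminorm smul p \<Longrightarrow> p (x - y) \<le> p x + p y"
  using seminorm_add[of p x "-y"] seminorm_minus[of p y] by simp

lemma seminorm_commute: "seminorm smul p \<Longrightarrow> p (x - y) = p (y - x)"
  using seminorm_minus[of p "x - y"] by simp

lemma seminorm_triangle: "seminorm smul p \<Longrightarrow> p (x - z) \<le> p (x - y) + p (y - z)"
  using seminorm_add[of p "x - y" "y - z"] by simp

lemma seminorm_sum: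
  assumes "seminorm smul p"
  shows "p (\<Sum>i\<in>I. x i) \<le> (\<Sum>i\<in>I. p (x i))"
proof (induction I rule: infinite_finite_induct)
  case (insert i I)
  then show ?case using seminorm_add[OF assms, of "x i" "\<Sum>i\<in>I. x i"] by simp
qed (simp_all add: seminorm_zero[OF assms])

lemma seminorm_add_fun:
  "seminorm smul p \<Longrightarrow> seminorm smul q \<Longrightarrow> seminorm smul (\<lambda>x. p x + q x)"
  unfolding seminorm_def by (smt (verit) distrib_left)

lemma seminorm_cmult: "0 \<le> c \<Longrightarrow> seminorm smul p \<Longrightarrow> seminorm smul (\<lambda>x. c * p x)"
  unfolding seminorm_def by (metis (no_types, lifting) distrib_left mult.left_commute mult_left_mono)

lemma seminorm_sublinear: "seminorm smul p \<Longrightarrow> sublinear smul p"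
  by (simp add: sublinear_def seminorm_def)

lemma sublinear_zero: "sublinear smul q \<Longrightarrow> q 0 = 0"
  unfolding sublinear_def by (metis mult_2 numeral_One of_real_numeral add_cancel_right_right scale_zero_right zero_less_numeral)

lemma sublinear_ge: "sublinear smul q \<Longrightarrow> - q (- x) \<le> q x"
  using sublinear_zero[of q] unfolding sublinear_def by (metis add.right_inverse add.inverse_inverse le_minus_iff add_le_same_cancel1 diff_ge_0_iff_ge diff_minus_eq_add minus_le_iff)

lemma slope_bdd:
  assumes q: "sublinear smul q"
  shows "bdd_below ((\<lambda>t. q (x + smul (of_real t) y) - t * q y) ` {0..})"
proof -
  have "- q (- x) \<le> q (x + smul (of_real t) y) - t * q y" if "0 \<le> t" for t
  proof -
    have "q (smul (of_real t) y) = t * q y"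
      using that q sublinear_zero[OF q] by (cases "t = 0") (auto simp: sublinear_def)
    moreover have "q (smul (of_real t) y) \<le> q (x + smul (of_real t) y) + q (- x)"
      using q unfolding sublinear_def by (metis add.commute minus_add_cancel)
    ultimately show ?thesis by simp
  qed
  then show ?thesis by (auto intro!: bdd_belowI2)
qed

lemma slope_le:
  assumes "sublinear smul q" "0 \<le> t"
  shows "slope smul q y x \<le> q (x + smul (of_real t) y) - t * q y"
  unfolding slope_def by (rule cINF_lower[OF slope_bdd[OF assms(1)]]) (use assms in auto)

lemma slope_sublinear:
  assumes q: "sublinear smul q"
  shows "sublinear smul (slope smul q y)"
  unfolding sublinear_def
proof (intro conjI allI impI)
  fix x x'
  let ?h = "\<lambda>x t. q (x + smul (of_real t) y) - t * q y"
  have "slope smul q y (x + x') - ?h x t \<le> ?h x' t'" if "0 \<le> t" "0 \<le> t'" for t t'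
  proof -
    have "q ((x + smul (of_real t) y) + (x' + smul (of_real t') y))
        \<le> q (x + smul (of_real t) y) + q (x' + smul (of_real t') y)"
      using q unfolding sublinear_def by blast
    moreover have "(x + smul (of_real t) y) + (x' + smul (of_real t') y)
        = (x + x') + smul (of_real (t + t')) y"
      by (simp add: scale_left_distrib algebra_simps)
    ultimately show ?thesis
      using slope_le[OF q, of "t + t'" y "x + x'"] that by (simp add: algebra_simps)
  qed
  then have 1: "slope smul q y (x + x') - ?h x t \<le> slope smul q y x'" if "0 \<le> t" for t
    using that unfolding slope_def[of smul q y x'] by (intro cINF_greatest) auto
  have "slope smul q y (x + x') - slope smul q y x' \<le> slope smul q y x"
    unfolding slope_def[of smul q y x] using 1 by (intro cINF_greatest) (auto simp: algebra_simps)
  then show "slope smul q y (x + x') \<le> slope smul q y x + slope smul q y x'" by simp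
next
  fix s :: real and x assume s: "0 < s"
  have *: "s * slope smul q y x \<le> slope smul q y (smul (of_real s) x)" if s: "0 < s" for s x
    unfolding slope_def[of smul q y "smul (of_real s) x"]
  proof (intro cINF_greatest)
    fix t :: real assume t: "t \<in> {0..}"
    have "smul (of_real s) x + smul (of_real t) y
        = smul (of_real s) (x + smul (of_real (t / s)) y)"
      using s by (simp add: scale_right_distrib)
    then have "q (smul (of_real s) x + smul (of_real t) y)
        = s * q (x + smul (of_real (t / s)) y)"
      using q s unfolding sublinear_def by metis
    moreover have "s * slope smul q y x \<le> s * (q (x + smul (of_real (t / s)) y) - (t / s) * q y)"
      using s t by (intro mult_left_mono slope_le[OF q]) auto
    ultimately show "s * slope smul q y x \<le> q (smul (of_real s) x + smul (of_real t) y) - t * q y"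
      using s by (simp add: algebra_simps)
  qed auto
  have "(1 / s) * slope smul q y (smul (of_real s) x) \<le> slope smul q y x"
    using *[of "1 / s" "smul (of_real s) x"] s by simp
  then have "slope smul q y (smul (of_real s) x) \<le> s * slope smul q y x"
    using s by (simp add: field_simps)
  with *[OF s, of x] show "slope smul q y (smul (of_real s) x) = s * slope smul q y x" by simp
qed

text \<open>Zorn's lemma is applied to functionals on the whole space instead of extensions from
  subspaces: a chain has its pointwise infimum as lower bound, and minimal elements turn out to be
  linear.\<close>

lemma minimal_sublinear:
  assumes q0: "sublinear smul q0"
  obtains q where "sublinear smul q" "\<And>x. q x \<le> q0 x"
    "\<And>r. sublinear smul r \<Longrightarrow> (\<And>x. r x \<le> q x) \<Longrightarrow> r = q"
proof -
  define S where "S = {q. sublinear smul q \<and> (\<forall>x. q x \<le> q0 x)}"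
  define P where "P = (\<lambda>a b :: 'a \<Rightarrow> real. \<forall>x. b x \<le> a x)"
  have "\<exists>m\<in>S. \<forall>a\<in>S. P m a \<longrightarrow> a = m"
  proof (rule predicate_Zorn)
    show "partial_order_on S (relation_of P S)"
    proof (rule partial_order_on_relation_ofI)
      show "P a c" if "P a b" "P b c" for a b c
        using that unfolding P_def by (blast intro: order_trans)
      show "a = b" if "P a b" "P b a" for a b
        using that unfolding P_def by (intro ext antisym) auto
    qed (simp add: P_def)
  next
    fix C assume C: "C \<in> Chains (relation_of P S)"
    then have CS: "C \<subseteq> S" and ch: "\<And>a b. a \<in> C \<Longrightarrow> b \<in> C \<Longrightarrow> P a b \<or> P b a"
      by (auto simp: Chains_def relation_of_def)
    show "\<exists>u\<in>S. \<forall>a\<in>C. P a u"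
    proof (cases "C = {}")
      case True
      then show ?thesis using q0 by (auto simp: S_def)
    next
      case False
      define u where "u x = (INF a\<in>C. a x)" for x
      \<comment> \<open>A sublinear \<open>a \<le> q0\<close> satisfies
        \<open>a x \<ge> - a (- x) \<ge> - q0 (- x)\<close>, so the infimum is finite.\<close>
      have bdd: "bdd_below ((\<lambda>a. a x) ` C)" for x
      proof (rule bdd_belowI2)
        fix a assume "a \<in> C"
        then have "sublinear smul a" "a (- x) \<le> q0 (- x)" using CS by (auto simp: S_def)
        then show "- q0 (- x) \<le> a x" using sublinear_ge[of a x] by simp
      qed
      have u_le: "u x \<le> a x" if "a \<in> C" for a x
        unfolding u_def by (rule cINF_lower[OF bdd that])
      have "sublinear smul u"
        unfolding sublinear_def
      proof (intro conjI allI impI)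
        fix x y
        have "u (x + y) - a x \<le> b y" if ab: "a \<in> C" "b \<in> C" for a b
        proof -
          \<comment> \<open>The smaller of two comparable members of the chain serves both points at
            once.\<close>
          obtain c where c: "c \<in> C" "c x \<le> a x" "c y \<le> b y"
            using ch[OF ab] ab unfolding P_def by blast
          then have "c (x + y) \<le> c x + c y" using CS by (auto simp: S_def sublinear_def)
          with c u_le[of c "x + y"] show ?thesis by simp
        qed
        then have "u (x + y) - a x \<le> u y" if "a \<in> C" for a
          unfolding u_def[of y] using that False by (intro cINF_greatest) auto
        then have "u (x + y) - u y \<le> u x"
          unfolding u_def[of x] using False by (intro cINF_greatest) (auto simp: algebra_simps)
        then show "u (x + y) \<le> u x + u y" by simp
      next
        fix t :: real and x assume t: "0 < t"
        have eq: "a (smul (of_real t) x) = t * a x" if "a \<in> C" for a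
          using that CS t by (auto simp: S_def sublinear_def)
        have "t * u x \<le> u (smul (of_real t) x)"
          unfolding u_def[of "smul (of_real t) x"]
        proof (intro cINF_greatest False)
          fix a assume "a \<in> C"
          then show "t * u x \<le> a (smul (of_real t) x)" using u_le[of a x] eq[of a] t by simp
        qed
        moreover have "u (smul (of_real t) x) / t \<le> u x"
          unfolding u_def[of x]
        proof (intro cINF_greatest)
          fix a assume "a \<in> C"
          then show "u (smul (of_real t) x) / t \<le> a x"
            using u_le[of a "smul (of_real t) x"] eq t by (simp add: field_simps)
        qed (use False in auto)
        ultimately show "u (smul (of_real t) x) = t * u x"
          using t by (simp add: field_simps)
      qed
      moreover obtain a where "a \<in> C" using False by blast
      ultimately have "u \<in> S"
        using u_le[of a] CS by (force simp: S_def intro: order_trans)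
      then show ?thesis using u_le by (auto simp: P_def)
    qed
  qed
  then obtain m where m: "m \<in> S" "\<And>a. a \<in> S \<Longrightarrow> P m a \<Longrightarrow> a = m" by blast
  show thesis
  proof (rule that[of m])
    fix r assume r: "sublinear smul r" "\<And>x. r x \<le> m x"
    then have "r \<in> S" using m(1) unfolding S_def by (blast intro: order_trans)
    then show "r = m" using m(2) r(2) by (auto simp: P_def)
  qed (use m(1) in \<open>auto simp: S_def\<close>)
qed

text \<open>Minimality forces \<open>q\<close> to equal its slope in every direction; the term
  \<open>t = 1\<close> of that infimum is the reverse of subadditivity.\<close>

lemma minimal_sublinear_linear:
  assumes q: "sublinear smul q"
    and min: "\<And>r. sublinear smul r \<Longrightarrow> (\<And>x. r x \<le> q x) \<Longrightarrow> r = q"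
  shows "q (x + y) = q x + q y" "q (smul (of_real t) x) = t * q x"
proof -
  have add: "q (x + y) = q x + q y" for x y
  proof -
    have "slope smul q y = q"
      using slope_le[OF q, of 0 y] by (intro min slope_sublinear q) auto
    then have "q x \<le> q (x + smul (of_real 1) y) - 1 * q y"
      using slope_le[OF q, of 1 y x] by simp
    moreover have "q (x + y) \<le> q x + q y" using q by (simp add: sublinear_def)
    ultimately show ?thesis by simp
  qed
  then show "q (x + y) = q x + q y" .
  have neg: "q (- x) = - q x" for x
    using add[of x "- x"] sublinear_zero[OF q] by simp
  consider "t > 0" | "t = 0" | "- t > 0" by linarith
  then show "q (smul (of_real t) x) = t * q x"
  proof cases
    case 3
    then have "q (smul (of_real (- t)) x) = (- t) * q x" using q by (simp only: sublinear_def)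
    then show ?thesis using neg[of "smul (of_real t) x"] by simp
  qed (use q sublinear_zero[OF q] in \<open>auto simp: sublinear_def\<close>)
qed

text \<open>Minimising below the slope at \<open>x0\<close>, rather than below \<open>d\<close>,
  makes the functional reach \<open>d x0\<close>, since the slope at \<open>- x0\<close> is at most
  \<open>- d x0\<close>. No subspace occurs: vanishing on one is obtained by taking a quotient
  seminorm for \<open>d\<close>.\<close>

theorem Hahn_Banach_seminorm:
  assumes d: "seminorm smul d"
  obtains \<phi> where "Vector_Spaces.linear smul (*) \<phi>" "\<And>x. cmod (\<phi> x) \<le> d x" "d x0 \<le> Re (\<phi> x0)"
proof -
  note ds = seminorm_sublinear[OF d]
  obtain L where L: "sublinear smul L" "\<And>x. L x \<le> slope smul d x0 x"
    and min: "\<And>r. sublinear smul r \<Longrightarrow> (\<And>x. r x \<le> L x) \<Longrightarrow> r = L"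
    using minimal_sublinear[OF slope_sublinear[OF ds]] by blast
  note lin = minimal_sublinear_linear[OF L(1) min]
  have Ld: "L x \<le> d x" for x
    using L(2)[of x] slope_le[OF ds, of 0 x0 x] by simp
  have neg: "L (- x) = - L x" for x using lin(2)[of "-1" x] by simp
  have "L (- x0) \<le> d (- x0 + smul (of_real 1) x0) - 1 * d x0"
    using L(2) slope_le[OF ds, of 1 x0 "- x0"] by (meson order_trans zero_le_one)
  then have Lx0: "d x0 \<le> L x0" using seminorm_zero[OF d] neg by simp
  \<comment> \<open>The only complex linear map with real part \<open>L\<close>.\<close>
  define \<phi> where "\<phi> x = Complex (L x) (- L (smul \<i> x))" for x
  have smul_split: "smul c x = smul (of_real (Re c)) x + smul (of_real (Im c)) (smul \<i> x)" for c x
    by (metis complex_eq mult.commute scale_left_distrib scale_scale)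
  have scale: "\<phi> (smul c x) = c * \<phi> x" for c x
  proof (rule complex_eqI)
    have "L (smul c x) = Re c * L x + Im c * L (smul \<i> x)" for c x
      by (subst smul_split) (simp only: lin)
    note this[of c x] this[of "\<i> * c" x]
    then show "Re (\<phi> (smul c x)) = Re (c * \<phi> x)" "Im (\<phi> (smul c x)) = Im (c * \<phi> x)"
      by (auto simp: \<phi>_def)
  qed
  have add: "\<phi> (x + y) = \<phi> x + \<phi> y" for x y
    by (simp add: \<phi>_def scale_right_distrib lin complex_eq_iff)
  have "Vector_Spaces.linear smul (*) \<phi>"
    using add scale vector_space_axioms
    unfolding Vector_Spaces.linear_iff vector_space_def by (auto simp: algebra_simps)
  moreover have "cmod (\<phi> x) \<le> d x" for x
  proof -
    \<comment> \<open>A rotation makes the value real and nonnegative, so the bound on the real part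
      becomes a bound on the modulus.\<close>
    define c where "c = cnj (sgn (\<phi> x))"
    have "c * \<phi> x = of_real (cmod (\<phi> x))"
      by (simp add: c_def sgn_div_norm scaleR_conv_of_real complex_norm_square[symmetric] divide_simps
          power2_eq_square mult.commute)
    then have "cmod (\<phi> x) = Re (\<phi> (smul c x))" by (simp add: scale)
    also have "\<dots> \<le> d (smul c x)" using Ld by (simp add: \<phi>_def)
    also have "\<dots> \<le> d x"
      using seminorm_scale[OF d, of c x] seminorm_nonneg[OF d, of x]
      by (auto simp: c_def norm_sgn)
    finally show ?thesis .
  qed
  moreover have "d x0 \<le> Re (\<phi> x0)" using Lx0 by (simp add: \<phi>_def)
  ultimately show thesis using that by blast
qed

text \<open>The seminorm of the quotient by \<open>W\<close>, pulled back. A functional dominated by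
  it is dominated by \<open>p\<close> and vanishes on \<open>W\<close>.\<close>

lemma seminorm_quotient:
  assumes p: "seminorm smul p" and W: "subspace W"
  shows "seminorm smul (\<lambda>x. INF w\<in>W. p (x - w))"
proof -
  let ?d = "\<lambda>x. INF w\<in>W. p (x - w)"
  have ne: "W \<noteq> {}" using subspace_0[OF W] by blast
  have bdd: "bdd_below ((\<lambda>w. p (x - w)) ` W)" for x
    by (rule bdd_belowI2[where m = 0]) (simp add: seminorm_nonneg[OF p])
  have le: "?d x \<le> p (x - w)" if "w \<in> W" for x w
    by (rule cINF_lower[OF bdd that])
  have "?d (x + y) - p (x - v) \<le> p (y - w)" if "v \<in> W" "w \<in> W" for x y v w
    using le[of "v + w" "x + y"] subspace_add[OF W that] seminorm_add[OF p, of "x - v" "y - w"]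
    by (simp add: algebra_simps)
  then have "?d (x + y) - p (x - v) \<le> ?d y" if "v \<in> W" for x y v
    using that ne by (intro cINF_greatest) auto
  then have sub: "?d (x + y) - ?d y \<le> ?d x" for x y
    using ne by (intro cINF_greatest) (auto simp: algebra_simps)
  have add: "?d (x + y) \<le> ?d x + ?d y" for x y
    using sub[of x y] by (rule iffD1[OF diff_le_eq])
  have sc: "cmod c * ?d x \<le> ?d (smul c x)" for c x
  proof (cases "c = 0")
    case True
    then show ?thesis using ne by (auto intro!: cINF_greatest simp: seminorm_nonneg[OF p])
  next
    case False
    show ?thesis
    proof (intro cINF_greatest ne)
      fix w assume "w \<in> W"
      then have "?d x \<le> p (x - smul (inverse c) w)" by (intro le subspace_scale[OF W])
      then have "cmod c * ?d x \<le> p (smul c (x - smul (inverse c) w))"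
        by (simp add: seminorm_scale[OF p] mult_left_mono)
      then show "cmod c * ?d x \<le> p (smul c x - w)"
        using False by (simp add: scale_right_diff_distrib)
    qed
  qed
  have "?d (smul c x) = cmod c * ?d x" for c x
  proof (cases "c = 0")
    case True
    have "?d (smul c x) \<le> 0"
      using le[OF subspace_0[OF W], of 0] seminorm_zero[OF p] True by simp
    with sc[of c x] True show ?thesis by simp
  next
    case False
    have "cmod (inverse c) * ?d (smul c x) \<le> ?d x"
      using sc[of "inverse c" "smul c x"] False by simp
    then have "cmod c * (cmod (inverse c) * ?d (smul c x)) \<le> cmod c * ?d x"
      by (rule mult_left_mono) simp
    also have "cmod c * (cmod (inverse c) * ?d (smul c x)) = ?d (smul c x)"
      using False by (simp only: norm_inverse mult.assoc[symmetric]) simp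
    finally have "?d (smul c x) \<le> cmod c * ?d x" .
    with sc[of c x] show ?thesis by simp
  qed
  with add show ?thesis by (auto simp: seminorm_def)
qed

end

section \<open>Topology, limits and duality in terms of continuous seminorms\<close>

locale lcs = complex_vector_space smul
  for smul :: "complex \<Rightarrow> 'a::ab_group_add \<Rightarrow> 'a" +
  fixes T :: "'a topology"
  assumes lcs: "locally_convex_space smul T"
begin

abbreviation "CS \<equiv> continuous_seminorms smul T"

abbreviation "dual \<equiv> topological_dual smul T"

lemma CS_seminorm: "p \<in> CS \<Longrightarrow> seminorm smul p"
  by (simp add: continuous_seminorms_def)

lemmas CS_add = seminorm_add[OF CS_seminorm]
  and CS_scale = seminorm_scale[OF CS_seminorm]
  and CS_zero = seminorm_zero[OF CS_seminorm]
  and CS_nonneg = seminorm_nonneg[OF CS_seminorm]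
  and CS_diff = seminorm_diff[OF CS_seminorm]
  and CS_commute = seminorm_commute[OF CS_seminorm]
  and CS_triangle = seminorm_triangle[OF CS_seminorm]
  and CS_sum = seminorm_sum[OF CS_seminorm]

lemma CS_add_fun: "p \<in> CS \<Longrightarrow> q \<in> CS \<Longrightarrow> (\<lambda>x. p x + q x) \<in> CS"
  by (auto simp: continuous_seminorms_def intro: seminorm_add_fun continuous_map_add)

lemma CS_cmult: "p \<in> CS \<Longrightarrow> 0 \<le> c \<Longrightarrow> (\<lambda>x. c * p x) \<in> CS"
  by (auto simp: continuous_seminorms_def intro: seminorm_cmult continuous_map_real_mult_left)

text \<open>The generating family is opened only here; later arguments use all continuous seminorms.
  These are closed under sums and nonnegative multiples, so their unit balls suffice as
  neighbourhoods.\<close>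

lemma topology_facts:
  shows topspace_UNIV: "topspace T = UNIV"
    and ball_open: "p \<in> CS \<Longrightarrow> openin T {y. p (y - x) < e}"
    and open_ball: "openin T V \<Longrightarrow> x \<in> V \<Longrightarrow> \<exists>q\<in>CS. {y. q (y - x) < 1} \<subseteq> V"
    and CS_separating: "x \<noteq> 0 \<Longrightarrow> \<exists>p\<in>CS. p x \<noteq> 0"
proof -
  obtain SN where SN: "\<And>p. p \<in> SN \<Longrightarrow> seminorm smul p"
    and sep: "\<And>x. x \<noteq> 0 \<Longrightarrow> \<exists>p\<in>SN. p x \<noteq> 0" and T: "T = seminorm_topology SN"
    using lcs unfolding locally_convex_space_def by blast
  define B where "B = insert UNIV {{y. p (y - x) < e} | p x e. p \<in> SN \<and> 0 < e}"
  have TB: "T = topology_generated_by B" by (simp add: T B_def seminorm_topology_def)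
  have basis: "openin T s" if "s \<in> B" for s
    unfolding TB using that by (rule topology_generated_by_Basis)
  show top: "topspace T = UNIV" unfolding TB by (auto simp: B_def)
  have SN_ball: "openin T {y. p (y - x) < e}" if "p \<in> SN" for p x e
  proof (cases "0 < e")
    case False
    then have "{y. p (y - x) < e} = {}"
      using seminorm_nonneg[OF SN[OF that]] by (auto simp: not_less intro: order_trans)
    then show ?thesis by simp
  qed (use that in \<open>auto simp: B_def intro!: basis\<close>)
  have CSI: "p \<in> CS" if p: "seminorm smul p" and ball: "\<And>x e. openin T {y. p (y - x) < e}" for p
  proof -
    have "openin T {x. p x \<in> U}" if "open U" for U
    proof (subst openin_subopen, intro ballI)
      fix x assume "x \<in> {x. p x \<in> U}"
      then obtain e where e: "0 < e" "\<And>t. \<bar>t - p x\<bar> < e \<Longrightarrow> t \<in> U"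
        using \<open>open U\<close> unfolding open_dist dist_real_def by blast
      have "\<bar>p y - p x\<bar> \<le> p (y - x)" for y
        using seminorm_triangle[OF p, of y 0 x] seminorm_triangle[OF p, of x 0 y]
          seminorm_commute[OF p, of x y] by simp
      then have "{y. p (y - x) < e} \<subseteq> {x. p x \<in> U}"
        using e(2) by (auto intro: le_less_trans)
      then show "\<exists>V. openin T V \<and> x \<in> V \<and> V \<subseteq> {x. p x \<in> U}"
        using ball[of x e] e(1) seminorm_zero[OF p] by (intro exI[of _ "{y. p (y - x) < e}"]) auto
    qed
    then show ?thesis
      using p top by (simp add: continuous_seminorms_def continuous_map_def)
  qed
  have SNCS: "p \<in> CS" if "p \<in> SN" for p
    using that by (intro CSI SN SN_ball)
  show "\<exists>p\<in>CS. p x \<noteq> 0" if "x \<noteq> 0" using sep[OF that] SNCS by blast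
  \<comment> \<open>Balls of an arbitrary continuous seminorm are needed at every centre, so
    translations must be continuous; on the subbasis they only move the centre.\<close>
  have trans: "continuous_map T T (\<lambda>y. y - x)" for x
    unfolding TB
  proof (rule continuous_on_generated_topo)
    show "(\<lambda>y. y - x) ` topspace (topology_generated_by B) \<subseteq> \<Union> B" by (auto simp: B_def)
    fix U assume "U \<in> B"
    then consider "U = UNIV" | p z e where "p \<in> SN" "U = {y. p (y - z) < e}"
      by (auto simp: B_def)
    then have "openin T ((\<lambda>y. y - x) -` U \<inter> topspace T)"
    proof cases
      case 2
      then have "(\<lambda>y. y - x) -` U \<inter> topspace T = {y. p (y - (z + x)) < e}"
        using top by (auto simp: algebra_simps)
      then show ?thesis using SN_ball[OF 2(1)] by simp
    qed (metis Int_UNIV_right openin_topspace top vimage_UNIV)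
    then show "openin (topology_generated_by B)
        ((\<lambda>y. y - x) -` U \<inter> topspace (topology_generated_by B))" by (simp add: TB)
  qed
  show ball: "openin T {y. p (y - x) < e}" if "p \<in> CS" for p x e
  proof -
    have "continuous_map T euclideanreal (\<lambda>y. p (y - x))"
      using continuous_map_compose[OF trans, of euclideanreal p] that
      by (simp add: continuous_seminorms_def o_def)
    then have "openin T {y \<in> topspace T. p (y - x) \<in> {..<e}}"
      by (rule openin_continuous_map_preimage) simp
    then show ?thesis using top by simp
  qed
  show "\<exists>q\<in>CS. {y. q (y - x) < 1} \<subseteq> V" if "openin T V" "x \<in> V"
  proof -
    have "generate_topology_on B V"
      using that(1) unfolding TB by (rule openin_topology_generated_by)
    then have "\<forall>x\<in>V. \<exists>q\<in>CS. {y. q (y - x) < 1} \<subseteq> V"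
    proof induction
      case (Int a b)
      show ?case
      proof
        fix x assume "x \<in> a \<inter> b"
        then obtain q r where qr: "q \<in> CS" "r \<in> CS"
          "{y. q (y - x) < 1} \<subseteq> a" "{y. r (y - x) < 1} \<subseteq> b"
          using Int by blast
        have le: "q z \<le> q z + r z" "r z \<le> q z + r z" for z
          using qr(1,2) by (auto intro: CS_nonneg)
        have "{y. q (y - x) + r (y - x) < 1} \<subseteq> a \<inter> b"
        proof
          fix y assume "y \<in> {y. q (y - x) + r (y - x) < 1}"
          then have "q (y - x) < 1" "r (y - x) < 1" using le[of "y - x"] by simp_all
          then show "y \<in> a \<inter> b" using qr(3,4) by blast
        qed
        then show "\<exists>q\<in>CS. {y. q (y - x) < 1} \<subseteq> a \<inter> b"
          by (intro bexI[OF _ CS_add_fun[OF qr(1,2)]])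
      qed
    next
      case (UN K)
      then show ?case by (meson Sup_upper UnionE order_trans)
    next
      case (Basis s)
      then consider "s = UNIV" | p z e where "p \<in> SN" "0 < e" "s = {y. p (y - z) < e}"
        by (auto simp: B_def)
      then show ?case
      proof cases
        case 1
        have "(\<lambda>x. 0) \<in> CS"
          by (simp add: continuous_seminorms_def seminorm_def)
        with 1 show ?thesis by blast
      next
        case 2
        show ?thesis
        proof
          fix x assume "x \<in> s"
          \<comment> \<open>The radius left around \<open>x\<close> inside the ball; dividing
            \<open>p\<close> by it gives a unit ball.\<close>
          define k where "k = e - p (x - z)"
          have k: "0 < k" using \<open>x \<in> s\<close> 2 by (simp add: k_def)
          have "(\<lambda>y. (1 / k) * p y) \<in> CS"
            using SNCS[OF 2(1)] k by (intro CS_cmult) auto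
          moreover have "y \<in> s" if "(1 / k) * p (y - x) < 1" for y
            using that k 2(3) seminorm_triangle[OF SN[OF 2(1)], of y z x]
            by (simp add: k_def field_simps)
          ultimately show "\<exists>q\<in>CS. {y. q (y - x) < 1} \<subseteq> s" by (intro bexI) auto
        qed
      qed
    qed auto
    with that(2) show ?thesis by blast
  qed
qed

lemma openin_iff: "openin T V \<longleftrightarrow> (\<forall>x\<in>V. \<exists>q\<in>CS. {y. q (y - x) < 1} \<subseteq> V)" (is "_ \<longleftrightarrow> ?r")
proof
  assume ?r
  show "openin T V"
  proof (subst openin_subopen, intro ballI)
    fix x assume "x \<in> V"
    then obtain q where q: "q \<in> CS" "{y. q (y - x) < 1} \<subseteq> V" using \<open>?r\<close> by blast
    then show "\<exists>W. openin T W \<and> x \<in> W \<and> W \<subseteq> V"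
      using ball_open[OF q(1), of x 1] CS_zero[OF q(1)]
      by (intro exI[of _ "{y. q (y - x) < 1}"]) auto
  qed
qed (use open_ball in blast)

lemma limitin_iff: "limitin T x l F \<longleftrightarrow> (\<forall>p\<in>CS. ((\<lambda>i. p (x i - l)) \<longlongrightarrow> 0) F)"
proof
  assume lim: "limitin T x l F"
  show "\<forall>p\<in>CS. ((\<lambda>i. p (x i - l)) \<longlongrightarrow> 0) F"
  proof
    fix p assume p: "p \<in> CS"
    show "((\<lambda>i. p (x i - l)) \<longlongrightarrow> 0) F"
    proof (rule tendstoI)
      fix e :: real assume "0 < e"
      then have "\<forall>\<^sub>F i in F. x i \<in> {y. p (y - l) < e}"
        using lim ball_open[OF p, of l e] CS_zero[OF p] unfolding limitin_def by auto
      then show "\<forall>\<^sub>F i in F. dist (p (x i - l)) 0 < e"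
        by eventually_elim (simp add: CS_nonneg[OF p])
    qed
  qed
next
  assume r: "\<forall>p\<in>CS. ((\<lambda>i. p (x i - l)) \<longlongrightarrow> 0) F"
  show "limitin T x l F"
    unfolding limitin_def
  proof (intro conjI allI impI)
    fix V assume V: "openin T V \<and> l \<in> V"
    then obtain q where q: "q \<in> CS" "{y. q (y - l) < 1} \<subseteq> V" using open_ball by blast
    have "\<forall>\<^sub>F i in F. q (x i - l) < 1"
      using r q(1) by (intro order_tendstoD(2)[where y = 0]) auto
    then show "\<forall>\<^sub>F i in F. x i \<in> V" by eventually_elim (use q(2) in blast)
  qed (simp add: topspace_UNIV)
qed

lemma eq_if_CS_zero: "(\<And>p. p \<in> CS \<Longrightarrow> p (x - y) = 0) \<Longrightarrow> x = y"
  using CS_separating[of "x - y"] by auto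

lemma limitin_unique:
  assumes "limitin T x l F" "limitin T x l' F" "F \<noteq> bot"
  shows "l = l'"
proof (rule eq_if_CS_zero)
  fix p assume p: "p \<in> CS"
  have "((\<lambda>i. p (x i - l) + p (x i - l')) \<longlongrightarrow> 0 + 0) F"
    using assms p by (intro tendsto_add) (auto simp: limitin_iff)
  moreover have "p (l - l') \<le> p (x i - l) + p (x i - l')" for i
    using CS_triangle[OF p, of l l' "x i"] CS_commute[OF p, of l "x i"] by simp
  ultimately have "p (l - l') \<le> 0"
    using tendsto_lowerbound[OF _ always_eventually assms(3)] by fastforce
  then show "p (l - l') = 0" using CS_nonneg[OF p, of "l - l'"] by simp
qed

text \<open>For continuous linear \<open>A\<close> the seminorm \<open>p \<circ> A\<close> is itself
  the dominating one; conversely, linearity carries the estimate to every base point.\<close>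

lemma continuous_operators_iff:
  "A \<in> continuous_operators smul T \<longleftrightarrow>
     (\<forall>x y. A (x + y) = A x + A y) \<and> (\<forall>c x. A (smul c x) = smul c (A x)) \<and>
     (\<forall>p\<in>CS. \<exists>q\<in>CS. \<forall>x. p (A x) \<le> q x)" (is "_ \<longleftrightarrow> ?add \<and> ?scale \<and> ?bound")
proof (intro iffI conjI)
  assume A: "A \<in> continuous_operators smul T"
  then show add: ?add and sc: ?scale
    unfolding continuous_operators_def Vector_Spaces.linear_iff by blast+
  show ?bound
  proof
    fix p assume p: "p \<in> CS"
    then have "seminorm smul (\<lambda>x. p (A x))"
      using add sc by (auto simp: seminorm_def CS_add CS_scale)
    moreover have "continuous_map T euclideanreal (\<lambda>x. p (A x))"
      using continuous_map_compose[of T T A euclideanreal p] A p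
      by (simp add: continuous_operators_def continuous_seminorms_def o_def)
    ultimately show "\<exists>q\<in>CS. \<forall>x. p (A x) \<le> q x"
      by (auto simp: continuous_seminorms_def intro!: bexI[of _ "\<lambda>x. p (A x)"])
  qed
next
  assume *: "?add \<and> ?scale \<and> ?bound"
  then have diff: "A (x - y) = A x - A y" for x y by (metis diff_add_cancel add_diff_cancel)
  have "openin T {x. A x \<in> V}" if V: "openin T V" for V
    unfolding openin_iff
  proof
    fix x assume "x \<in> {x. A x \<in> V}"
    then obtain p where p: "p \<in> CS" "{y. p (y - A x) < 1} \<subseteq> V"
      using open_ball[OF V, of "A x"] by auto
    obtain q where q: "q \<in> CS" "\<And>x. p (A x) \<le> q x" using * p(1) by blast
    have "A y \<in> V" if "q (y - x) < 1" for y
    proof -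
      have "p (A y - A x) < 1" using q(2)[of "y - x"] that by (simp add: diff)
      then show ?thesis using p(2) by blast
    qed
    then have "{y. q (y - x) < 1} \<subseteq> {x. A x \<in> V}" by blast
    then show "\<exists>q\<in>CS. {y. q (y - x) < 1} \<subseteq> {x. A x \<in> V}" using q(1) by blast
  qed
  then show "A \<in> continuous_operators smul T"
    using * vector_space_axioms topspace_UNIV
    by (simp add: continuous_operators_def Vector_Spaces.linear_iff continuous_map_def)
qed

lemma dual_add: "\<phi> \<in> dual \<Longrightarrow> \<phi> (x + y) = \<phi> x + \<phi> y"
  and dual_scale: "\<phi> \<in> dual \<Longrightarrow> \<phi> (smul c x) = c * \<phi> x"
  by (auto simp: topological_dual_def Vector_Spaces.linear_iff)

lemma dual_zero: "\<phi> \<in> dual \<Longrightarrow> \<phi> 0 = 0"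
  using dual_scale[of \<phi> 0 0] by simp

lemma dual_diff: "\<phi> \<in> dual \<Longrightarrow> \<phi> (x - y) = \<phi> x - \<phi> y"
  using dual_add[of \<phi> "x - y" y] by simp

lemma dual_sum: "\<phi> \<in> dual \<Longrightarrow> \<phi> (\<Sum>i\<in>I. x i) = (\<Sum>i\<in>I. \<phi> (x i))"
  by (induction I rule: infinite_finite_induct) (simp_all add: dual_add dual_zero)

lemma cmod_dual_CS: "\<phi> \<in> dual \<Longrightarrow> (\<lambda>x. cmod (\<phi> x)) \<in> CS"
  unfolding continuous_seminorms_def mem_Collect_eq seminorm_def
  by (auto simp: dual_add dual_scale norm_triangle_ineq norm_mult topological_dual_def
      intro!: continuous_map_norm)

lemma dualI:
  assumes lin: "Vector_Spaces.linear smul (*) \<phi>" and q: "q \<in> CS" "\<And>x. cmod (\<phi> x) \<le> q x"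
  shows "\<phi> \<in> dual"
proof -
  have add: "\<phi> (x + y) = \<phi> x + \<phi> y" for x y
    using lin by (auto simp: Vector_Spaces.linear_iff)
  then have diff: "\<phi> (x - y) = \<phi> x - \<phi> y" for x y by (metis diff_add_cancel add_diff_cancel)
  have "openin T {x. \<phi> x \<in> U}" if "open U" for U
    unfolding openin_iff
  proof
    fix x assume "x \<in> {x. \<phi> x \<in> U}"
    then obtain e where e: "0 < e" "\<And>t. dist t (\<phi> x) < e \<Longrightarrow> t \<in> U"
      using \<open>open U\<close> unfolding open_dist by blast
    have "\<phi> y \<in> U" if "(1 / e) * q (y - x) < 1" for y
      using that e q(2)[of "y - x"] by (auto simp: dist_norm diff field_simps intro!: e(2))
    then show "\<exists>q\<in>CS. {y. q (y - x) < 1} \<subseteq> {x. \<phi> x \<in> U}"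
      using CS_cmult[OF q(1), of "1 / e"] e(1) by (intro bexI[of _ "\<lambda>y. (1 / e) * q y"]) auto
  qed
  then show ?thesis
    using lin topspace_UNIV by (simp add: topological_dual_def continuous_map_def)
qed

lemma dual_compose:
  assumes \<phi>: "\<phi> \<in> dual" and A: "A \<in> continuous_operators smul T"
  shows "(\<lambda>x. \<phi> (A x)) \<in> dual"
  using continuous_map_compose[of T T A euclidean \<phi>] \<phi> A
    Vector_Spaces.linear_compose[of smul smul A "(*)" \<phi>]
  by (simp add: topological_dual_def continuous_operators_def o_def)

text \<open>Hahn--Banach is applied to the \<open>p\<close>-distance from \<open>W\<close>, which is
  0 on \<open>W\<close> and at least \<open>e\<close> at \<open>x\<close>.\<close>

lemma separating_functional:
  assumes p: "p \<in> CS" and W: "subspace W" and e: "0 < e" "\<And>w. w \<in> W \<Longrightarrow> e \<le> p (x - w)"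
  obtains \<phi> where "\<phi> \<in> dual" "\<And>w. w \<in> W \<Longrightarrow> \<phi> w = 0" "\<phi> x \<noteq> 0"
proof -
  let ?d = "\<lambda>x. INF w\<in>W. p (x - w)"
  have ne: "W \<noteq> {}" using subspace_0[OF W] by blast
  have bdd: "bdd_below ((\<lambda>w. p (x - w)) ` W)" for x
    by (rule bdd_belowI2[where m = 0]) (simp add: CS_nonneg[OF p])
  have le: "?d x \<le> p (x - w)" if "w \<in> W" for x w
    by (rule cINF_lower[OF bdd that])
  obtain \<phi> where \<phi>: "Vector_Spaces.linear smul (*) \<phi>" "\<And>y. cmod (\<phi> y) \<le> ?d y" "?d x \<le> Re (\<phi> x)"
    using Hahn_Banach_seminorm[OF seminorm_quotient[OF CS_seminorm[OF p] W]] by blast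
  have "\<phi> \<in> dual"
    using \<phi>(2) le[OF subspace_0[OF W]] by (intro dualI[OF \<phi>(1) p]) (force intro: order_trans)
  moreover have "\<phi> w = 0" if "w \<in> W" for w
    using order_trans[OF \<phi>(2)[of w] le[OF that, of w]] CS_zero[OF p] by simp
  moreover have "e \<le> ?d x" using e(2) ne by (intro cINF_greatest)
  then have "\<phi> x \<noteq> 0" using \<phi>(3) e(1) by auto
  ultimately show thesis using that by blast
qed

lemma dual_separates:
  assumes "x \<noteq> 0"
  obtains \<phi> where "\<phi> \<in> dual" "\<phi> x \<noteq> 0"
proof -
  obtain p where p: "p \<in> CS" "p x \<noteq> 0" using CS_separating[OF assms] by blast
  have "0 < p x" using p CS_nonneg[OF p(1), of x] by simp
  then obtain \<phi> where "\<phi> \<in> dual" "\<phi> x \<noteq> 0"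
    using separating_functional[OF p(1) subspace_single_0, of "p x" x] by auto
  then show thesis using that by blast
qed

text \<open>Countable additivity of \<open>mu\<close> is assumed only weakly; this turns scalar
  identities into identities of vectors.\<close>

lemma eq_if_dual_eq: "(\<And>\<phi>. \<phi> \<in> dual \<Longrightarrow> \<phi> x = \<phi> y) \<Longrightarrow> x = y"
  using dual_separates[of "x - y"] by (metis dual_diff right_minus_eq)

end

section \<open>Spectral measures\<close>

text \<open>A point of the cube is a convex combination of its vertices, here the partial sums over
  \<open>A \<subseteq> J\<close>. The base point \<open>y\<close> varies in the induction to absorb
  the coordinate that is split off. The bound is independent of the number of summands.\<close>

lemma (in complex_vector_space) seminorm_convex_sum_le:
  assumes p: "seminorm smul p" and J: "finite J"
    and K: "\<And>A. A \<subseteq> J \<Longrightarrow> p (y + (\<Sum>j\<in>A. x j)) \<le> K"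
    and c: "\<And>j. j \<in> J \<Longrightarrow> 0 \<le> c j \<and> c j \<le> (1 :: real)"
  shows "p (y + (\<Sum>j\<in>J. smul (of_real (c j)) (x j))) \<le> K"
  using J K c
proof (induction J arbitrary: y rule: finite_induct)
  case empty
  then show ?case by force
next
  case (insert j J)
  let ?S = "\<Sum>j\<in>J. smul (of_real (c j)) (x j)" and ?t = "of_real (c j) :: complex"
  have "p (y + (\<Sum>j\<in>A. x j)) \<le> K" if "A \<subseteq> J" for A
    using insert.prems(1)[of A] that by blast
  then have 1: "p (y + ?S) \<le> K" using insert by simp
  have "p ((y + x j) + (\<Sum>j\<in>A. x j)) \<le> K" if "A \<subseteq> J" for A
  proof -
    have "finite A" "j \<notin> A" using that insert finite_subset by blast+
    then show ?thesis using insert.prems(1)[OF insert_mono[OF that]] by (simp add: add.assoc)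
  qed
  then have 2: "p ((y + x j) + ?S) \<le> K" using insert by simp
  have c: "0 \<le> c j" "c j \<le> 1" using insert.prems by auto
  have "y + (smul ?t (x j) + ?S) = smul (1 - ?t) (y + ?S) + smul ?t ((y + x j) + ?S)"
    by (simp add: scale_right_distrib scale_left_diff_distrib algebra_simps)
  then have "p (y + (smul ?t (x j) + ?S))
      \<le> p (smul (1 - ?t) (y + ?S)) + p (smul ?t ((y + x j) + ?S))"
    by (simp only: seminorm_add[OF p])
  also have "\<dots> = (1 - c j) * p (y + ?S) + c j * p ((y + x j) + ?S)"
  proof -
    have "cmod (1 - ?t) = 1 - c j"
      using c norm_of_real[of "1 - c j", where ?'a = complex] by simp
    then show ?thesis using c by (simp add: seminorm_scale[OF p])
  qed
  also have "\<dots> \<le> (1 - c j) * K + c j * K"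
    using 1 2 c by (intro add_mono mult_left_mono) auto
  finally show ?case using insert by (simp add: algebra_simps)
qed

locale spectral_space = lcs smul T
  for smul :: "complex \<Rightarrow> 'a::ab_group_add \<Rightarrow> 'a" and T :: "'a topology" +
  fixes M :: "'s measure" and mu :: "'s set \<Rightarrow> 'a \<Rightarrow> 'a"
  assumes complete: "sequentially_complete smul T"
    and esm: "equicontinuous_spectral_measure smul T M mu"
begin

lemma sm: "spectral_measure smul T M mu"
  using esm by (simp add: equicontinuous_spectral_measure_def)

lemma mu_operator: "A \<in> sets M \<Longrightarrow> mu A \<in> continuous_operators smul T"
  using sm by (simp add: spectral_measure_def)

lemma mu_add: "A \<in> sets M \<Longrightarrow> mu A (x + y) = mu A x + mu A y"
  and mu_scale: "A \<in> sets M \<Longrightarrow> mu A (smul c x) = smul c (mu A x)"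
  using mu_operator[of A] by (auto simp: continuous_operators_iff)

lemma mu_zero: "A \<in> sets M \<Longrightarrow> mu A 0 = 0"
  using mu_scale[of A 0 0] by simp

lemma mu_diff: "A \<in> sets M \<Longrightarrow> mu A (x - y) = mu A x - mu A y"
  using mu_add[of A "x - y" y] by simp

lemma mu_sum: "A \<in> sets M \<Longrightarrow> mu A (\<Sum>i\<in>I. x i) = (\<Sum>i\<in>I. mu A (x i))"
  by (induction I rule: infinite_finite_induct) (simp_all add: mu_add mu_zero)

lemma mu_space: "mu (space M) x = x"
  using sm by (simp add: spectral_measure_def)

lemma mu_Int: "A \<in> sets M \<Longrightarrow> B \<in> sets M \<Longrightarrow> mu (A \<inter> B) x = mu A (mu B x)"
  using sm by (simp add: spectral_measure_def)

lemma mu_sums: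
  "range A \<subseteq> sets M \<Longrightarrow> disjoint_family A \<Longrightarrow> \<phi> \<in> dual \<Longrightarrow>
    (\<lambda>i. \<phi> (mu (A i) x)) sums \<phi> (mu (\<Union>i. A i) x)"
  using sm by (simp add: spectral_measure_def)

lemma equicontinuous:
  assumes "p \<in> CS"
  obtains p' where "p' \<in> CS" "\<And>A x. A \<in> sets M \<Longrightarrow> p (mu A x) \<le> p' x"
  using esm assms unfolding equicontinuous_spectral_measure_def by blast

text \<open>The empty set is a disjoint union of infinitely many copies of itself, and a convergent
  series with constant terms has zero terms.\<close>

lemma mu_empty: "mu {} x = 0"
proof (rule eq_if_dual_eq)
  fix \<phi> assume "\<phi> \<in> dual"
  then have "(\<lambda>i :: nat. \<phi> (mu {} x)) sums \<phi> (mu {} x)"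
    using mu_sums[of "\<lambda>_. {}" \<phi> x] by (simp add: disjoint_family_on_def)
  then have "(\<lambda>i :: nat. \<phi> (mu {} x)) \<longlonglongrightarrow> 0"
    by (intro summable_LIMSEQ_zero sums_summable)
  then show "\<phi> (mu {} x) = \<phi> 0"
    using dual_zero[OF \<open>\<phi> \<in> dual\<close>] by (simp add: LIMSEQ_const_iff)
qed

lemma mu_Un:
  assumes "A \<in> sets M" "B \<in> sets M" "A \<inter> B = {}"
  shows "mu (A \<union> B) x = mu A x + mu B x"
proof (rule eq_if_dual_eq)
  fix \<phi> assume \<phi>: "\<phi> \<in> dual"
  have "disjoint_family (binaryset A B)"
    using assms(3) by (auto simp: disjoint_family_on_def binaryset_def)
  then have "(\<lambda>i. \<phi> (mu (binaryset A B i) x)) sums \<phi> (mu (A \<union> B) x)"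
    using mu_sums[of "binaryset A B" \<phi> x] assms \<phi> by (simp add: range_binaryset_eq UN_binaryset_eq)
  moreover have "(\<lambda>i. \<phi> (mu (binaryset A B i) x)) sums (\<phi> (mu A x) + \<phi> (mu B x))"
    by (rule binaryset_sums) (simp add: mu_empty dual_zero[OF \<phi>])
  ultimately show "\<phi> (mu (A \<union> B) x) = \<phi> (mu A x + mu B x)"
    using sums_unique2 by (simp add: dual_add[OF \<phi>])
qed

lemma mu_UN:
  assumes "finite I" "\<And>i. i \<in> I \<Longrightarrow> A i \<in> sets M" "disjoint_family_on A I"
  shows "mu (\<Union>i\<in>I. A i) x = (\<Sum>i\<in>I. mu (A i) x)"
  using assms
proof (induction I rule: finite_induct)
  case (insert i I)
  then have "mu (A i \<union> (\<Union>i\<in>I. A i)) x = mu (A i) x + mu (\<Union>i\<in>I. A i) x"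
    by (intro mu_Un sets.finite_UN) (auto simp: disjoint_family_on_def)
  with insert show ?case by (simp add: disjoint_family_on_def)
qed (simp add: mu_empty)

lemma mu_Diff:
  assumes "A \<in> sets M" "B \<in> sets M" "B \<subseteq> A"
  shows "mu (A - B) x = mu A x - mu B x"
proof -
  have "mu ((A - B) \<union> B) x = mu (A - B) x + mu B x" using assms by (intro mu_Un) auto
  then show ?thesis using assms(3) by (simp add: Un_absorb2)
qed

lemma mu_Compl: "A \<in> sets M \<Longrightarrow> mu (space M - A) x = x - mu A x"
  by (simp add: mu_Diff mu_space sets.sets_into_space)

text \<open>A functional annihilating the subspace of all vectors killed by some member of the directed
  family \<open>F\<close> is what the Hahn--Banach theorem produces when the conclusion fails.\<close>

lemma directed_family_small:
  assumes F: "F \<subseteq> sets M" "F \<noteq> {}"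
    and dir: "\<And>A B. A \<in> F \<Longrightarrow> B \<in> F \<Longrightarrow> \<exists>C\<in>F. C \<subseteq> A \<inter> B"
    and null: "\<And>\<phi>. \<phi> \<in> dual \<Longrightarrow> (\<And>A \<eta>. A \<in> F \<Longrightarrow> \<phi> (mu A \<eta>) = \<phi> \<eta>) \<Longrightarrow> \<phi> \<psi> = 0"
    and p: "p \<in> CS" and e: "0 < e"
  shows "\<exists>A\<in>F. \<forall>B\<in>sets M. B \<subseteq> A \<longrightarrow> p (mu B \<psi>) < e"
proof -
  define W where "W = {\<eta>. \<exists>A\<in>F. mu A \<eta> = 0}"
  have kill: "mu B w = 0" if "A \<in> F" "mu A w = 0" "B \<in> sets M" "B \<subseteq> A" for A B w
  proof -
    have "mu (B \<inter> A) w = mu B (mu A w)" using that F by (intro mu_Int) auto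
    then show ?thesis using that by (simp add: Int_absorb2 mu_zero)
  qed
  have W: "subspace W"
  proof (rule subspaceI)
    show "0 \<in> W" using F mu_zero by (auto simp: W_def)
    fix x y assume "x \<in> W" "y \<in> W"
    then obtain A B where AB: "A \<in> F" "mu A x = 0" "B \<in> F" "mu B y = 0" by (auto simp: W_def)
    then obtain C where C: "C \<in> F" "C \<subseteq> A" "C \<subseteq> B" using dir[of A B] by auto
    then have "mu C x = 0" "mu C y = 0" using kill AB F by blast+
    then show "x + y \<in> W" using C(1) F by (auto simp: W_def mu_add intro!: bexI[of _ C])
  next
    fix c x assume "x \<in> W"
    then obtain A where "A \<in> F" "mu A x = 0" by (auto simp: W_def)
    then show "smul c x \<in> W" using F by (auto simp: W_def mu_scale intro!: bexI[of _ A])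
  qed
  obtain p' where p': "p' \<in> CS" "\<And>A x. A \<in> sets M \<Longrightarrow> p (mu A x) \<le> p' x"
    using equicontinuous[OF p] by blast
  show ?thesis
  \<comment> \<open>Either \<open>\<psi>\<close> is \<open>p'\<close>-close to some \<open>w\<close>
    in \<open>W\<close>, which a whole member of \<open>F\<close> kills, or Hahn--Banach separates
    \<open>\<psi>\<close> from \<open>W\<close> and contradicts \<open>null\<close>.\<close>
  proof (cases "\<exists>w\<in>W. p' (\<psi> - w) < e")
    case True
    then obtain w A where w: "p' (\<psi> - w) < e" "A \<in> F" "mu A w = 0" by (auto simp: W_def)
    have "p (mu B \<psi>) < e" if "B \<in> sets M" "B \<subseteq> A" for B
    proof -
      have "mu B \<psi> = mu B (\<psi> - w)" using kill[OF w(2,3) that] that by (simp add: mu_diff)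
      then show ?thesis using p'(2)[OF that(1), of "\<psi> - w"] w(1) by simp
    qed
    then show ?thesis using w(2) by blast
  next
    case False
    then have ge: "e \<le> p' (\<psi> - w)" if "w \<in> W" for w using that by (auto simp: not_less)
    obtain \<phi> where \<phi>: "\<phi> \<in> dual" "\<And>w. w \<in> W \<Longrightarrow> \<phi> w = 0" "\<phi> \<psi> \<noteq> 0"
      by (rule separating_functional[OF p'(1) W e ge]) auto
    have "\<phi> (mu A \<eta>) = \<phi> \<eta>" if "A \<in> F" for A \<eta>
    proof -
      have A: "A \<in> sets M" using that F by blast
      then have "mu A (\<eta> - mu A \<eta>) = 0" using mu_Int[OF A A] by (simp add: mu_diff)
      then have "\<phi> (\<eta> - mu A \<eta>) = 0" using that by (auto intro!: \<phi>(2) simp: W_def)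
      then show ?thesis by (simp add: dual_diff[OF \<phi>(1)])
    qed
    then show ?thesis using null[OF \<phi>(1)] \<phi>(3) by blast
  qed
qed

text \<open>Weak additivity becomes strong here. A functional invariant under every
  \<open>mu (A i)\<close> gives no mass to differences of successive sets; these fill up
  \<open>A 0\<close>, so the functional vanishes.\<close>

lemma strong_continuity_from_above:
  assumes A: "range A \<subseteq> sets M" "decseq A" "(\<Inter>i. A i) = {}" and p: "p \<in> CS"
  shows "(\<lambda>n. p (mu (A n) \<psi>)) \<longlonglongrightarrow> 0"
proof (rule LIMSEQ_I)
  fix e :: real assume e: "0 < e"
  have "\<exists>A\<in>range A. \<forall>B\<in>sets M. B \<subseteq> A \<longrightarrow> p (mu B \<psi>) < e"
  proof (rule directed_family_small[OF A(1) _ _ _ p e])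
    fix X Y assume "X \<in> range A" "Y \<in> range A"
    then obtain i j where "X = A i" "Y = A j" by blast
    then show "\<exists>C\<in>range A. C \<subseteq> X \<inter> Y"
      using decseqD[OF A(2), of i "max i j"] decseqD[OF A(2), of j "max i j"] by auto
  next
    fix \<phi> assume \<phi>: "\<phi> \<in> dual" and inv: "\<And>X \<eta>. X \<in> range A \<Longrightarrow> \<phi> (mu X \<eta>) = \<phi> \<eta>"
    define D where "D i = A i - A (Suc i)" for i
    have "disjoint_family D"
      unfolding disjoint_family_on_def
    proof (intro ballI impI)
      have *: "D i \<inter> D j = {}" if "i < j" for i j
        using decseqD[OF A(2), of "Suc i" j] that by (auto simp: D_def)
      fix i j :: nat assume "i \<noteq> j"
      then show "D i \<inter> D j = {}" using *[of i j] *[of j i] by (cases i j rule: linorder_cases) auto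
    qed
    moreover have "range D \<subseteq> sets M" using A(1) by (auto simp: D_def)
    ultimately have sums: "(\<lambda>i. \<phi> (mu (D i) \<psi>)) sums \<phi> (mu (\<Union>i. D i) \<psi>)"
      using \<phi> by (intro mu_sums)
    have "mu (D i) \<psi> = mu (A i) \<psi> - mu (A (Suc i)) \<psi>" for i
      using A(1) decseqD[OF A(2), of i "Suc i"] unfolding D_def by (intro mu_Diff) auto
    then have "\<phi> (mu (D i) \<psi>) = 0" for i by (simp add: dual_diff[OF \<phi>] inv)
    then have "(\<lambda>i. 0) sums \<phi> (mu (\<Union>i. D i) \<psi>)" using sums by simp
    then have "\<phi> (mu (\<Union>i. D i) \<psi>) = 0" by (rule sums_unique2) simp
    moreover have "(\<Union>i. D i) = A 0"
    proof
      show "(\<Union>i. D i) \<subseteq> A 0" using decseqD[OF A(2)] by (fastforce simp: D_def)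
      show "A 0 \<subseteq> (\<Union>i. D i)"
      proof
        fix x assume x: "x \<in> A 0"
        then have "\<exists>i. x \<notin> A i" using A(3) by blast
        \<comment> \<open>The first index at which \<open>x\<close> drops out. It is positive
          because \<open>x \<in> A 0\<close>, so \<open>x\<close> lies in the difference just before
          it.\<close>
        define k where "k = (LEAST i. x \<notin> A i)"
        have k: "x \<notin> A k" unfolding k_def by (rule LeastI_ex) fact
        then obtain j where j: "k = Suc j" using x by (cases k) auto
        have "x \<in> A j" using not_less_Least[of j "\<lambda>i. x \<notin> A i"] j by (auto simp: k_def)
        with k j show "x \<in> (\<Union>i. D i)" by (auto simp: D_def)
      qed
    qed
    ultimately show "\<phi> \<psi> = 0" using inv by simp
  qed auto
  then obtain N where N: "\<And>B. B \<in> sets M \<Longrightarrow> B \<subseteq> A N \<Longrightarrow> p (mu B \<psi>) < e" by blast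
  have "p (mu (A n) \<psi>) < e" if "N \<le> n" for n
    using A(1) decseqD[OF A(2) that] by (intro N) auto
  then show "\<exists>no. \<forall>n\<ge>no. norm (p (mu (A n) \<psi>) - 0) < e"
    using CS_nonneg[OF p] by auto
qed

section \<open>Integrals of simple functions\<close>

abbreviation "sint \<equiv> simple_spectral_integral smul M mu"

abbreviation "spint \<equiv> spectral_integral smul T M mu"

text \<open>Any finite partition finer than the level sets may be used, and \<open>J\<close> may
  contain values that are not attained, whose cells are empty. With a pair of simple functions as
  \<open>h\<close>, both are integrated over one partition.\<close>

lemma sint_partition:
  assumes J: "finite J" "h ` space M \<subseteq> J" and meas: "\<And>j. h -` {j} \<inter> space M \<in> sets M"
    and s: "\<And>x. x \<in> space M \<Longrightarrow> s x = F (h x)"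
  shows "sint s \<psi> = (\<Sum>j\<in>J. smul (F j) (mu (h -` {j} \<inter> space M) \<psi>))"
proof -
  let ?H = "h ` space M" and ?E = "\<lambda>j. h -` {j} \<inter> space M"
  have fin: "finite ?H" using J by (rule finite_subset[rotated])
  have "mu (?E j) \<psi> = 0" if "j \<notin> ?H" for j
  proof -
    have "?E j = {}" using that by auto
    then show ?thesis by (simp only: mu_empty)
  qed
  then have "(\<Sum>j\<in>J. smul (F j) (mu (?E j) \<psi>)) = (\<Sum>j\<in>?H. smul (F j) (mu (?E j) \<psi>))"
    using J by (intro sum.mono_neutral_right) auto
  also have "\<dots> = (\<Sum>c\<in>F ` ?H. \<Sum>j | j \<in> ?H \<and> F j = c. smul (F j) (mu (?E j) \<psi>))"
    by (rule sum.image_gen[OF fin])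
  also have "\<dots> = (\<Sum>c\<in>F ` ?H. smul c (mu (s -` {c} \<inter> space M) \<psi>))"
  proof (rule sum.cong[OF refl])
    fix c
    have "s -` {c} \<inter> space M = (\<Union>j\<in>{j \<in> ?H. F j = c}. ?E j)" using s by auto
    then have "mu (s -` {c} \<inter> space M) \<psi> = (\<Sum>j\<in>{j \<in> ?H. F j = c}. mu (?E j) \<psi>)"
      using fin meas by (simp only:) (rule mu_UN, auto simp: disjoint_family_on_def)
    then show "(\<Sum>j | j \<in> ?H \<and> F j = c. smul (F j) (mu (?E j) \<psi>))
        = smul c (mu (s -` {c} \<inter> space M) \<psi>)"
      by (simp add: scale_sum_right)
  qed
  also have "F ` ?H = s ` space M" using s by (force simp: image_image)
  finally show ?thesis by (simp add: simple_spectral_integral_def)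
qed

lemma sint_comp:
  assumes "simple_function M h"
  shows "sint (\<lambda>x. F (h x)) \<psi>
    = (\<Sum>j\<in>h ` space M. smul (F j) (mu (h -` {j} \<inter> space M) \<psi>))"
  using assms by (intro sint_partition) (auto intro: simple_functionD)

lemma sint_add:
  assumes "simple_function M s" "simple_function M t"
  shows "sint (\<lambda>x. s x + t x) \<psi> = sint s \<psi> + sint t \<psi>"
proof -
  note h = simple_function_Pair[OF assms]
  show ?thesis
    using sint_comp[OF h, of "\<lambda>(a, b). a + b"] sint_comp[OF h, of fst]
      sint_comp[OF h, of snd]
    by (simp add: case_prod_beta scale_left_distrib sum.distrib)
qed

lemma sint_cmult:
  assumes "simple_function M s"
  shows "sint (\<lambda>x. c * s x) \<psi> = smul c (sint s \<psi>)"
  using sint_comp[OF assms, of "\<lambda>a. c * a"] sint_comp[OF assms, of "\<lambda>a. a"]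
  by (simp add: scale_sum_right)

lemma sint_diff:
  assumes "simple_function M s" "simple_function M t"
  shows "sint (\<lambda>x. s x - t x) \<psi> = sint s \<psi> - sint t \<psi>"
proof -
  have "simple_function M (\<lambda>x. (- 1) * t x)"
    using simple_function_compose1[OF assms(2), of "\<lambda>z. (- 1) * z"] .
  from sint_add[OF assms(1) this] sint_cmult[OF assms(2), of "- 1"]
  show ?thesis by simp
qed

lemma sint_indicator:
  assumes "A \<in> sets M"
  shows "sint (indicator A) \<psi> = mu A \<psi>"
proof -
  have "sint (indicator A) \<psi>
      = (\<Sum>j\<in>UNIV. smul (if j then 1 else 0) (mu ((\<lambda>x. x \<in> A) -` {j} \<inter> space M) \<psi>))"
  proof (rule sint_partition)
    have "(\<lambda>x. x \<in> A) -` {j} \<inter> space M = (if j then A else space M - A)" for j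
      using sets.sets_into_space[OF assms] by auto
    then show "(\<lambda>x. x \<in> A) -` {j} \<inter> space M \<in> sets M" for j using assms by simp
  qed (auto simp: indicator_def)
  moreover have "(\<lambda>x. x \<in> A) -` {True} \<inter> space M = A"
    using sets.sets_into_space[OF assms] by auto
  ultimately show ?thesis by (simp add: UNIV_bool)
qed

lemma sint_vec:
  assumes "simple_function M s"
  shows "sint s (x + y) = sint s x + sint s y"
    "sint s (smul c x) = smul c (sint s x)"
  using simple_functionD(2)[OF assms]
  by (simp_all add: simple_spectral_integral_def mu_add mu_scale scale_right_distrib
      sum.distrib scale_sum_right mult.commute)

text \<open>On the common partition, distinct cells multiply to \<open>mu {}\<close>, so only the
  diagonal of the double sum survives.\<close>

lemma sint_mult:
  assumes s: "simple_function M s" and t: "simple_function M t"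
  shows "sint (\<lambda>x. s x * t x) \<psi> = sint s (sint t \<psi>)"
proof -
  let ?h = "\<lambda>x. (s x, t x)" let ?E = "\<lambda>j. ?h -` {j} \<inter> space M"
  note h = simple_function_Pair[OF s t]
  note fin = simple_functionD(1)[OF h] and meas = simple_functionD(2)[OF h]
  have diag: "mu (?E j) (mu (?E k) \<psi>) = (if k = j then mu (?E j) \<psi> else 0)" for j k
  proof -
    have "mu (?E j) (mu (?E k) \<psi>) = mu (?E j \<inter> ?E k) \<psi>" using meas by (simp add: mu_Int)
    moreover have "?E j \<inter> ?E k = (if k = j then ?E j else {})" by auto
    ultimately show ?thesis by (simp add: mu_empty split: if_splits)
  qed
  have t_eq: "sint t \<psi> = (\<Sum>k\<in>?h ` space M. smul (snd k) (mu (?E k) \<psi>))"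
    using sint_comp[OF h, of snd] by simp
  have "sint s (sint t \<psi>)
      = (\<Sum>j\<in>?h ` space M. smul (fst j) (mu (?E j) (sint t \<psi>)))"
    using sint_comp[OF h, of fst] by simp
  also have "\<dots> = (\<Sum>j\<in>?h ` space M. smul (fst j * snd j) (mu (?E j) \<psi>))"
  proof (rule sum.cong[OF refl])
    fix j assume j: "j \<in> ?h ` space M"
    have "mu (?E j) (sint t \<psi>)
        = (\<Sum>k\<in>?h ` space M. smul (snd k) (if k = j then mu (?E j) \<psi> else 0))"
      unfolding t_eq by (subst mu_sum[OF meas]) (simp add: mu_scale meas diag)
    also have "\<dots> = (\<Sum>k\<in>?h ` space M. if k = j then smul (snd j) (mu (?E j) \<psi>) else 0)"
      by (intro sum.cong) auto
    also have "\<dots> = smul (snd j) (mu (?E j) \<psi>)" using fin j by (simp add: sum.delta')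
    finally show "smul (fst j) (mu (?E j) (sint t \<psi>))
        = smul (fst j * snd j) (mu (?E j) \<psi>)" by simp
  qed
  also have "\<dots> = sint (\<lambda>x. s x * t x) \<psi>"
    using sint_comp[OF h, of "\<lambda>(a, b). a * b"] by (simp add: case_prod_beta)
  finally show ?thesis by simp
qed

text \<open>With coefficients in the unit interval, each vertex of the cube is \<open>mu\<close> of
  a union of level sets; one bound on the values of \<open>mu\<close> thus controls the integral for
  any number of levels.\<close>

lemma sint_bound_unit:
  assumes p: "p \<in> CS" and s: "simple_function M s"
    and K: "\<And>A. A \<in> sets M \<Longrightarrow> p (mu A \<psi>) \<le> K"
    and F: "\<And>z. z \<in> s ` space M \<Longrightarrow> 0 \<le> F z \<and> F z \<le> (1 :: real)"
  shows "p (sint (\<lambda>x. of_real (F (s x))) \<psi>) \<le> K"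
proof -
  let ?E = "\<lambda>j. s -` {j} \<inter> space M"
  note fin = simple_functionD(1)[OF s] and meas = simple_functionD(2)[OF s]
  have "p (0 + (\<Sum>j\<in>s ` space M. smul (of_real (F j)) (mu (?E j) \<psi>))) \<le> K"
  proof (rule seminorm_convex_sum_le[OF CS_seminorm[OF p] fin _ F])
    fix A assume "A \<subseteq> s ` space M"
    then have "finite A" using fin finite_subset by blast
    then have "(\<Sum>j\<in>A. mu (?E j) \<psi>) = mu (\<Union>j\<in>A. ?E j) \<psi>"
      using meas by (intro mu_UN[symmetric]) (auto simp: disjoint_family_on_def)
    moreover have "(\<Union>j\<in>A. ?E j) \<in> sets M" using meas \<open>finite A\<close> by (intro sets.finite_UN)
    ultimately show "p (0 + (\<Sum>j\<in>A. mu (?E j) \<psi>)) \<le> K" using K by (simp only: add_0)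
  qed
  then show ?thesis by (simp add: sint_comp[OF s, of "\<lambda>z. of_real (F z)"])
qed

text \<open>The factor 4 counts the positive and negative parts of the real and imaginary parts,
  each scaled by \<open>1 / C\<close> into the unit interval. This takes the place of a total
  variation estimate.\<close>

lemma sint_bound:
  assumes p: "p \<in> CS" and s: "simple_function M s" and C: "0 < C" "\<And>x. x \<in> space M \<Longrightarrow> cmod (s x) \<le> C"
    and K: "\<And>A. A \<in> sets M \<Longrightarrow> p (mu A \<psi>) \<le> K"
  shows "p (sint s \<psi>) \<le> 4 * C * K"
proof -
  have bound: "p (sint (\<lambda>x. of_real (F (s x))) \<psi>) \<le> K"
    if "\<And>z. cmod z \<le> C \<Longrightarrow> 0 \<le> F z \<and> F z \<le> 1" for F
    using that C by (intro sint_bound_unit[OF p s K]) auto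
  define G where "G k z = (case k of 0 \<Rightarrow> max 0 (Re z) / C | Suc 0 \<Rightarrow> max 0 (- Re z) / C
    | Suc (Suc 0) \<Rightarrow> max 0 (Im z) / C | _ \<Rightarrow> max 0 (- Im z) / C)" for k :: nat and z
  have G: "0 \<le> G k z \<and> G k z \<le> 1" if "cmod z \<le> C" for k z
    using C(1) that abs_Re_le_cmod[of z] abs_Im_le_cmod[of z]
    by (auto simp: G_def divide_simps split: nat.splits)
  let ?I = "\<lambda>k. sint (\<lambda>x. of_real (G k (s x))) \<psi>"
  note comp = simple_function_compose1[OF s]
  have simp: "simple_function M (\<lambda>x. complex_of_real (G k (s x)))"
    "simple_function M (\<lambda>x. complex_of_real (G k (s x)) - of_real (G l (s x)))"
    "simple_function M (\<lambda>x. \<i> * (complex_of_real (G k (s x)) - of_real (G l (s x))))"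
    "simple_function M (\<lambda>x. of_real (G 0 (s x)) - of_real (G 1 (s x))
      + \<i> * (of_real (G 2 (s x)) - of_real (G 3 (s x))))" for k l
    using comp[of "\<lambda>z. complex_of_real (G k z)"]
      comp[of "\<lambda>z. complex_of_real (G k z) - of_real (G l z)"]
      comp[of "\<lambda>z. \<i> * (complex_of_real (G k z) - of_real (G l z))"]
      comp[of "\<lambda>z. of_real (G 0 z) - of_real (G 1 z) + \<i> * (of_real (G 2 z) - of_real (G 3 z))"]
    by simp_all
  have "s x = of_real C * (of_real (G 0 (s x)) - of_real (G 1 (s x))
      + \<i> * (of_real (G 2 (s x)) - of_real (G 3 (s x))))" for x
    using C(1) by (auto simp: G_def complex_eq_iff max_def numeral_eq_Suc)
  then have "sint s \<psi> = sint (\<lambda>x. of_real C * (of_real (G 0 (s x)) - of_real (G 1 (s x))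
      + \<i> * (of_real (G 2 (s x)) - of_real (G 3 (s x))))) \<psi>" by presburger
  also have "\<dots> = smul (of_real C) (?I 0 - ?I 1 + smul \<i> (?I 2 - ?I 3))"
    by (simp only: sint_cmult[OF simp(4)] sint_add[OF simp(2,3)] sint_cmult[OF simp(2)]
        sint_diff[OF simp(1) simp(1)])
  finally have "p (sint s \<psi>) = C * p (?I 0 - ?I 1 + smul \<i> (?I 2 - ?I 3))"
    using C(1) by (simp add: CS_scale[OF p])
  also have "\<dots> \<le> C * ((p (?I 0) + p (?I 1)) + (p (?I 2) + p (?I 3)))"
  proof (intro mult_left_mono order_trans[OF CS_add[OF p]] add_mono CS_diff[OF p])
    show "p (smul \<i> (?I 2 - ?I 3)) \<le> p (?I 2) + p (?I 3)"
      using CS_diff[OF p] by (simp add: CS_scale[OF p])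
  qed (use C(1) in auto)
  also have "\<dots> \<le> C * ((K + K) + (K + K))"
    using C(1) G bound[of "G _"] by (intro mult_left_mono add_mono) auto
  finally show ?thesis by simp
qed

end

section \<open>The spectral integral\<close>

lemma cmod_grid_approx:
  fixes a b :: real
  assumes "0 < N"
  shows "cmod (Complex a b - (of_real (of_int \<lfloor>N * a\<rfloor> / N) + \<i> * of_real (of_int \<lfloor>N * b\<rfloor> / N))) \<le> 2 / N"
proof -
  have *: "\<bar>c - of_int \<lfloor>N * c\<rfloor> / N\<bar> \<le> 1 / N" for c
  proof -
    have "\<bar>N * c - of_int \<lfloor>N * c\<rfloor>\<bar> \<le> 1" by linarith
    moreover have "c - of_int \<lfloor>N * c\<rfloor> / N = (N * c - of_int \<lfloor>N * c\<rfloor>) / N"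
      using assms by (simp add: field_simps)
    ultimately show ?thesis using assms by (simp add: divide_right_mono)
  qed
  show ?thesis
    using cmod_le[of "Complex a b - (of_real (of_int \<lfloor>N * a\<rfloor> / N) + \<i> * of_real (of_int \<lfloor>N * b\<rfloor> / N))"]
      *[of a] *[of b] by simp
qed

lemma floor_mult_bounded:
  fixes C t :: real
  assumes "0 < N" "\<bar>t\<bar> \<le> C"
  shows "\<lfloor>N * t\<rfloor> \<in> {- \<lceil>N * C\<rceil>..\<lceil>N * C\<rceil>}"
proof -
  have "N * t \<le> N * C" "N * (- C) \<le> N * t"
    using assms by (intro mult_left_mono; simp)+
  from floor_mono[OF this(1)] floor_mono[OF this(2)] show ?thesis
    using floor_le_ceiling[of "N * C"] by (simp add: ceiling_def)
qed

lemma small_factor: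
  fixes e K :: real
  assumes "0 < e" "0 \<le> K"
  obtains d where "0 < d" "d * K < e"
  using assms by (intro that[of "e / (K + 1)"]) (auto simp: field_simps)

context spectral_space
begin

lemma limitin_sequentially_unique:
  "limitin T x l sequentially \<Longrightarrow> limitin T x l' sequentially \<Longrightarrow> l = l'"
  by (erule limitin_unique) simp_all

definition bounded_measurable :: "('s \<Rightarrow> complex) \<Rightarrow> bool" where
  "bounded_measurable g \<longleftrightarrow> g \<in> borel_measurable M \<and> bounded (g ` space M)"

lemma bounded_measurableI:
  "g \<in> borel_measurable M \<Longrightarrow> (\<And>x. x \<in> space M \<Longrightarrow> cmod (g x) \<le> C) \<Longrightarrow> bounded_measurable g"
  unfolding bounded_measurable_def bounded_iff by auto

lemma bounded_measurableE:
  assumes "bounded_measurable g"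
  obtains C where "0 < C" "\<And>x. x \<in> space M \<Longrightarrow> cmod (g x) \<le> C"
  using assms unfolding bounded_measurable_def bounded_pos by auto

lemma bounded_measurable_borel: "bounded_measurable g \<Longrightarrow> g \<in> borel_measurable M"
  by (simp add: bounded_measurable_def)

lemma bounded_measurable_mult:
  assumes "bounded_measurable g" "bounded_measurable h"
  shows "bounded_measurable (\<lambda>x. g x * h x)"
proof -
  obtain C D where CD: "0 < C" "\<And>x. x \<in> space M \<Longrightarrow> cmod (g x) \<le> C"
    "\<And>x. x \<in> space M \<Longrightarrow> cmod (h x) \<le> D"
    using bounded_measurableE[OF assms(1)] bounded_measurableE[OF assms(2)] by metis
  show ?thesis
    by (rule bounded_measurableI[where C = "C * D"])
      (use assms CD in \<open>auto simp: norm_mult bounded_measurable_def intro!: mult_mono borel_measurable_times\<close>)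
qed

lemma bounded_measurable_add:
  assumes "bounded_measurable g" "bounded_measurable h"
  shows "bounded_measurable (\<lambda>x. g x + h x)"
proof -
  obtain C D where CD: "\<And>x. x \<in> space M \<Longrightarrow> cmod (g x) \<le> C"
    "\<And>x. x \<in> space M \<Longrightarrow> cmod (h x) \<le> D"
    using bounded_measurableE[OF assms(1)] bounded_measurableE[OF assms(2)] by metis
  show ?thesis
    by (rule bounded_measurableI[where C = "C + D"])
      (use assms CD in \<open>auto simp: bounded_measurable_def intro!: norm_triangle_le add_mono borel_measurable_add\<close>)
qed

lemma bounded_measurable_const: "bounded_measurable (\<lambda>x. c)"
  by (rule bounded_measurableI[where C = "cmod c"]) auto

lemma bounded_measurable_cmult: "bounded_measurable g \<Longrightarrow> bounded_measurable (\<lambda>x. c * g x)"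
  by (rule bounded_measurable_mult[OF bounded_measurable_const])

lemma bounded_measurable_diff:
  "bounded_measurable g \<Longrightarrow> bounded_measurable h \<Longrightarrow> bounded_measurable (\<lambda>x. g x - h x)"
  using bounded_measurable_add[of g "\<lambda>x. (- 1) * h x"] bounded_measurable_cmult[of h "- 1"] by simp

lemma bounded_measurable_sum:
  "(\<And>i. i \<in> I \<Longrightarrow> bounded_measurable (g i)) \<Longrightarrow> bounded_measurable (\<lambda>x. \<Sum>i\<in>I. g i x)"
  by (induction I rule: infinite_finite_induct)
    (simp_all add: bounded_measurable_const bounded_measurable_add)

lemma bounded_measurable_power: "bounded_measurable g \<Longrightarrow> bounded_measurable (\<lambda>x. g x ^ n)"
  by (induction n) (simp_all add: bounded_measurable_const bounded_measurable_mult)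

lemma bounded_measurable_indicator: "A \<in> sets M \<Longrightarrow> bounded_measurable (indicator A)"
  by (rule bounded_measurableI[where C = 1]) (auto simp: indicator_def)

lemmas bounded_measurable_intros =
  bounded_measurable_mult bounded_measurable_add bounded_measurable_const bounded_measurable_diff
  bounded_measurable_sum bounded_measurable_power bounded_measurable_indicator

text \<open>Real and imaginary parts are rounded down to multiples of 1/(n+1); boundedness leaves
  finitely many grid points. \<open>Suc n\<close> keeps the mesh meaningful at
  \<open>n = 0\<close>.\<close>

lemma uniform_simple_approx:
  assumes g: "bounded_measurable g"
  obtains s where "\<And>n. simple_function M (s n)" "uniform_limit (space M) s g sequentially"
proof -
  define s where "s n x = of_real (of_int \<lfloor>real (Suc n) * Re (g x)\<rfloor> / real (Suc n))
    + \<i> * of_real (of_int \<lfloor>real (Suc n) * Im (g x)\<rfloor> / real (Suc n))" for n x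
  obtain C where C: "0 < C" "\<And>x. x \<in> space M \<Longrightarrow> cmod (g x) \<le> C"
    using bounded_measurableE[OF g] by blast
  note [measurable] = bounded_measurable_borel[OF g]
  have "simple_function M (s n)" for n
  proof (rule simple_function_borel_measurable)
    show "s n \<in> borel_measurable M" unfolding s_def by measurable
    define L where "L = \<lceil>real (Suc n) * C\<rceil>"
    have L: "\<lfloor>real (Suc n) * t\<rfloor> \<in> {- L..L}" if "\<bar>t\<bar> \<le> C" for t
      unfolding L_def by (rule floor_mult_bounded[OF _ that]) simp
    have "s n ` space M \<subseteq> (\<lambda>(a, b). of_real (of_int a / real (Suc n))
        + \<i> * of_real (of_int b / real (Suc n))) ` ({- L..L} \<times> {- L..L})"
    proof
      fix y assume "y \<in> s n ` space M"
      then obtain x where x: "x \<in> space M" "y = s n x" by blast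
      then have "\<bar>Re (g x)\<bar> \<le> C" "\<bar>Im (g x)\<bar> \<le> C"
        using C(2) abs_Re_le_cmod[of "g x"] abs_Im_le_cmod[of "g x"] by fastforce+
      then have "(\<lfloor>real (Suc n) * Re (g x)\<rfloor>, \<lfloor>real (Suc n) * Im (g x)\<rfloor>) \<in> {- L..L} \<times> {- L..L}"
        using L by blast
      then show "y \<in> (\<lambda>(a, b). of_real (of_int a / real (Suc n))
        + \<i> * of_real (of_int b / real (Suc n))) ` ({- L..L} \<times> {- L..L})"
        unfolding x(2) s_def by (rule rev_image_eqI) simp
    qed
    then show "finite (s n ` space M)" by (rule finite_subset) simp
  qed
  moreover have "uniform_limit (space M) s g sequentially"
  proof (rule uniform_limitI)
    fix e :: real assume "0 < e"
    then have "\<forall>\<^sub>F n in sequentially. 2 / real (Suc n) < e"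
      by (intro order_tendstoD(2)[of _ 0]) real_asymp
    then show "\<forall>\<^sub>F n in sequentially. \<forall>x\<in>space M. dist (s n x) (g x) < e"
    proof eventually_elim
      case (elim n)
      have "dist (s n x) (g x) \<le> 2 / real (Suc n)" for x
        using cmod_grid_approx[of "real (Suc n)" "Re (g x)" "Im (g x)"]
        unfolding s_def dist_norm by (simp only: complex.collapse norm_minus_commute of_nat_0_less_iff zero_less_Suc)
      with elim show ?case by (auto intro: le_less_trans)
    qed
  qed
  ultimately show thesis using that by blast
qed

lemma sint_uniform_null:
  assumes s: "\<And>n. simple_function M (s n)" and lim: "uniform_limit (space M) s (\<lambda>_. 0) sequentially"
    and p: "p \<in> CS"
  shows "(\<lambda>n. p (sint (s n) \<psi>)) \<longlonglongrightarrow> 0"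
proof (rule LIMSEQ_I)
  fix e :: real assume e: "0 < e"
  obtain p' where p': "p' \<in> CS" "\<And>A x. A \<in> sets M \<Longrightarrow> p (mu A x) \<le> p' x"
    using equicontinuous[OF p] by blast
  obtain d where d: "0 < d" and "d * (4 * p' \<psi>) < e"
    using small_factor[of "e" "4 * p' \<psi>"] e CS_nonneg[OF p'(1), of \<psi>] by auto
  then have less: "4 * d * p' \<psi> < e" by (simp add: mult.assoc mult.left_commute)
  have *: "norm (p (sint (s n) \<psi>) - 0) < e" if "\<And>x. x \<in> space M \<Longrightarrow> cmod (s n x) \<le> d" for n
    using sint_bound[OF p s d(1) that p'(2), where \<psi> = \<psi>] less CS_nonneg[OF p, of "sint (s n) \<psi>"]
    by simp
  have "\<forall>\<^sub>F n in sequentially. \<forall>x\<in>space M. dist (s n x) 0 < d"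
    using uniform_limitD[OF lim d] .
  then obtain N where "\<And>n. N \<le> n \<Longrightarrow> \<forall>x\<in>space M. dist (s n x) 0 < d"
    unfolding eventually_sequentially by blast
  then show "\<exists>no. \<forall>n\<ge>no. norm (p (sint (s n) \<psi>) - 0) < e"
    using * by (metis dist_norm diff_zero less_imp_le)
qed

text \<open>Justifies the definite description: sequential completeness gives a limit for one
  approximating sequence, and any other sequence differs from it by a uniformly null one.\<close>

lemma spint_limit:
  assumes g: "bounded_measurable g" and s: "\<And>n. simple_function M (s n)"
    and lim: "uniform_limit (space M) s g sequentially"
  shows "limitin T (\<lambda>n. sint (s n) \<psi>) (spint g \<psi>) sequentially"
proof -
  have cauchy: "\<exists>N. \<forall>m\<ge>N. \<forall>n\<ge>N. p (sint (s m) \<psi> - sint (s n) \<psi>) < e" if p: "p \<in> CS" and e: "0 < e" for p e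
  proof -
    obtain p' where p': "p' \<in> CS" "\<And>A x. A \<in> sets M \<Longrightarrow> p (mu A x) \<le> p' x"
      using equicontinuous[OF p] by blast
    obtain d where d: "0 < d" and less: "d * (4 * p' \<psi>) < e"
      using small_factor[of "e" "4 * p' \<psi>"] e CS_nonneg[OF p'(1), of \<psi>] by auto
    obtain N where N: "\<And>n x. N \<le> n \<Longrightarrow> x \<in> space M \<Longrightarrow> dist (s n x) (g x) < d / 2"
      using uniform_limitD[OF lim, of "d / 2"] d unfolding eventually_sequentially by auto
    have "p (sint (s m) \<psi> - sint (s n) \<psi>) < e" if "N \<le> m" "N \<le> n" for m n
    proof -
      have "p (sint (\<lambda>x. s m x - s n x) \<psi>) \<le> 4 * d * p' \<psi>"
      proof (rule sint_bound[OF p _ d _ p'(2)])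
        show "simple_function M (\<lambda>x. s m x - s n x)" using s by (intro simple_function_diff)
        fix x assume "x \<in> space M"
        then show "cmod (s m x - s n x) \<le> d"
          using N[OF that(1)] N[OF that(2)] dist_triangle_half_l[of "s m x" "g x" d "s n x"]
          by (simp add: dist_norm)
      qed
      with less show ?thesis by (simp add: sint_diff s algebra_simps)
    qed
    then show ?thesis by blast
  qed
  then have "\<exists>l. limitin T (\<lambda>n. sint (s n) \<psi>) l sequentially"
    using complete[unfolded sequentially_complete_def, rule_format, of "\<lambda>n. sint (s n) \<psi>"] by blast
  then obtain l where l: "limitin T (\<lambda>n. sint (s n) \<psi>) l sequentially" by blast
  have all: "limitin T (\<lambda>n. sint (t n) \<psi>) l sequentially"
    if t: "\<forall>n. simple_function M (t n)" and tl: "uniform_limit (space M) t g sequentially" for t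
    unfolding limitin_iff
  proof
    fix p assume p: "p \<in> CS"
    have "uniform_limit (space M) (\<lambda>n x. t n x - s n x) (\<lambda>x. g x - g x) sequentially"
      by (intro uniform_limit_minus tl lim)
    then have "(\<lambda>n. p (sint (\<lambda>x. t n x - s n x) \<psi>)) \<longlonglongrightarrow> 0"
      using s t p by (intro sint_uniform_null) (auto intro: simple_function_diff)
    then have "(\<lambda>n. p (sint (t n) \<psi> - sint (s n) \<psi>) + p (sint (s n) \<psi> - l)) \<longlonglongrightarrow> 0 + 0"
      using l p t s by (intro tendsto_add) (simp_all add: limitin_iff sint_diff)
    then have lim: "(\<lambda>n. p (sint (t n) \<psi> - sint (s n) \<psi>) + p (sint (s n) \<psi> - l)) \<longlonglongrightarrow> 0"
      by simp
    show "(\<lambda>n. p (sint (t n) \<psi> - l)) \<longlonglongrightarrow> 0"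
      by (intro tendsto_sandwich[OF _ _ tendsto_const lim] always_eventually)
        (simp_all add: CS_nonneg[OF p] CS_triangle[OF p])
  qed
  have "spint g \<psi> = l"
    unfolding spectral_integral_def
  proof (rule the_equality)
    fix v assume "\<forall>s. (\<forall>n. simple_function M (s n)) \<longrightarrow> uniform_limit (space M) s g sequentially \<longrightarrow>
        limitin T (\<lambda>n. sint (s n) \<psi>) v sequentially"
    then show "v = l" using s lim l by (intro limitin_unique[OF _ l]) auto
  qed (use all in blast)
  with l show ?thesis by simp
qed

lemma spint_cong: "(\<And>x. x \<in> space M \<Longrightarrow> g x = h x) \<Longrightarrow> spint g = spint h"
  proof
  assume eq: "\<And>x. x \<in> space M \<Longrightarrow> g x = h x"
  then have "uniform_limit (space M) s g sequentially = uniform_limit (space M) s h sequentially" for s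
    by (intro uniform_limit_cong') auto
  then show "spint g \<psi> = spint h \<psi>" for \<psi> unfolding spectral_integral_def by presburger
qed

lemma spint_simple:
  assumes "simple_function M s"
  shows "spint s \<psi> = sint s \<psi>"
proof -
  have "bounded_measurable s"
    using assms by (auto simp: bounded_measurable_def borel_measurable_simple_function
        intro: finite_imp_bounded simple_functionD)
  then have "limitin T (\<lambda>n. sint s \<psi>) (spint s \<psi>) sequentially"
    using assms uniform_limit_const by (intro spint_limit) auto
  moreover have "limitin T (\<lambda>n. sint s \<psi>) (sint s \<psi>) sequentially"
    by (simp add: limitin_const_iff topspace_UNIV)
  ultimately show ?thesis by (rule limitin_unique) simp
qed

lemma spint_indicator: "A \<in> sets M \<Longrightarrow> spint (indicator A) \<psi> = mu A \<psi>"
  by (simp add: spint_simple sint_indicator)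

lemma spint_one: "spint (\<lambda>x. 1) \<psi> = \<psi>"
  using spint_indicator[of "space M" \<psi>] spint_cong[of "indicator (space M)" "\<lambda>x. 1"]
  by (simp add: mu_space)

lemma limitin_add:
  assumes "limitin T x k F" "limitin T y l F"
  shows "limitin T (\<lambda>i. x i + y i) (k + l) F"
  unfolding limitin_iff
proof
  fix p assume p: "p \<in> CS"
  have "((\<lambda>i. p (x i - k) + p (y i - l)) \<longlongrightarrow> 0 + 0) F"
    using assms p by (intro tendsto_add) (auto simp: limitin_iff)
  then have lim: "((\<lambda>i. p (x i - k) + p (y i - l)) \<longlongrightarrow> 0) F" by simp
  have "p (x i + y i - (k + l)) \<le> p (x i - k) + p (y i - l)" for i
    using CS_add[OF p, of "x i - k" "y i - l"] by (simp add: algebra_simps)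
  then show "((\<lambda>i. p (x i + y i - (k + l))) \<longlongrightarrow> 0) F"
    by (intro tendsto_sandwich[OF _ _ tendsto_const lim] always_eventually)
      (simp_all add: CS_nonneg[OF p])
qed

lemma limitin_scale:
  assumes "limitin T x k F"
  shows "limitin T (\<lambda>i. smul c (x i)) (smul c k) F"
  unfolding limitin_iff
proof
  fix p assume p: "p \<in> CS"
  have "((\<lambda>i. cmod c * p (x i - k)) \<longlongrightarrow> cmod c * 0) F"
    using assms p by (intro tendsto_mult_left) (auto simp: limitin_iff)
  then show "((\<lambda>i. p (smul c (x i) - smul c k)) \<longlongrightarrow> 0) F"
    by (simp add: CS_scale[OF p] flip: scale_right_diff_distrib)
qed

lemma limitin_dual:
  assumes "limitin T x k F" "\<phi> \<in> dual"
  shows "((\<lambda>i. \<phi> (x i)) \<longlongrightarrow> \<phi> k) F"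
proof -
  have "((\<lambda>i. cmod (\<phi> (x i - k))) \<longlongrightarrow> 0) F"
    using assms cmod_dual_CS by (auto simp: limitin_iff)
  then show ?thesis
    by (simp add: dual_diff[OF assms(2)] tendsto_norm_zero_iff LIM_zero_iff)
qed

lemma spint_add:
  assumes "bounded_measurable g" "bounded_measurable h"
  shows "spint (\<lambda>x. g x + h x) \<psi> = spint g \<psi> + spint h \<psi>"
proof -
  obtain s t where s: "\<And>n. simple_function M (s n)" "uniform_limit (space M) s g sequentially"
    and t: "\<And>n. simple_function M (t n)" "uniform_limit (space M) t h sequentially"
    using uniform_simple_approx[OF assms(1)] uniform_simple_approx[OF assms(2)] by metis
  have 1: "limitin T (\<lambda>n. sint (\<lambda>x. s n x + t n x) \<psi>) (spint (\<lambda>x. g x + h x) \<psi>) sequentially"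
    using assms s t by (intro spint_limit) (auto intro: bounded_measurable_intros uniform_limit_add)
  have 2: "limitin T (\<lambda>n. sint (s n) \<psi> + sint (t n) \<psi>) (spint g \<psi> + spint h \<psi>) sequentially"
    using assms s t by (intro limitin_add spint_limit)
  show ?thesis by (rule limitin_sequentially_unique[OF 1[unfolded sint_add[OF s(1) t(1)]] 2])
qed

lemma spint_cmult:
  assumes "bounded_measurable g"
  shows "spint (\<lambda>x. c * g x) \<psi> = smul c (spint g \<psi>)"
proof -
  obtain s where s: "\<And>n. simple_function M (s n)" "uniform_limit (space M) s g sequentially"
    using uniform_simple_approx[OF assms(1)] by metis
  have "uniform_limit (space M) (\<lambda>n x. c * s n x) (\<lambda>x. c * g x) sequentially"
    using s(2) by (intro bounded_linear.uniform_limit[OF bounded_linear_mult_right])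
  then have 1: "limitin T (\<lambda>n. sint (\<lambda>x. c * s n x) \<psi>) (spint (\<lambda>x. c * g x) \<psi>) sequentially"
    using assms s by (intro spint_limit bounded_measurable_cmult simple_function_compose1[OF s(1)])
  have 2: "limitin T (\<lambda>n. smul c (sint (s n) \<psi>)) (smul c (spint g \<psi>)) sequentially"
    using assms s by (intro limitin_scale spint_limit)
  show ?thesis by (rule limitin_sequentially_unique[OF 1[unfolded sint_cmult[OF s(1)]] 2])
qed

lemma spint_diff:
  assumes "bounded_measurable g" "bounded_measurable h"
  shows "spint (\<lambda>x. g x - h x) \<psi> = spint g \<psi> - spint h \<psi>"
  using spint_add[OF assms(1) bounded_measurable_cmult[OF assms(2)], of "- 1"]
    spint_cmult[OF assms(2), of "- 1"] by simp

lemma spint_sum: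
  "(\<And>i. i \<in> I \<Longrightarrow> bounded_measurable (g i)) \<Longrightarrow>
    spint (\<lambda>x. \<Sum>i\<in>I. g i x) \<psi> = (\<Sum>i\<in>I. spint (g i) \<psi>)"
proof (induction I rule: infinite_finite_induct)
  case (insert i I)
  then show ?case by (simp add: spint_add bounded_measurable_intros)
qed (use spint_cmult[OF bounded_measurable_const, of 0 0] in simp_all)

lemma spint_vec:
  assumes "bounded_measurable g"
  shows "spint g (x + y) = spint g x + spint g y"
    and "spint g (smul c x) = smul c (spint g x)"
proof -
  obtain s where s: "\<And>n. simple_function M (s n)" "uniform_limit (space M) s g sequentially"
    using uniform_simple_approx[OF assms(1)] by metis
  note lim = spint_limit[OF assms s]
  show "spint g (x + y) = spint g x + spint g y"
    by (rule limitin_sequentially_unique[OF lim[of "x + y", unfolded sint_vec(1)[OF s(1)]]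
          limitin_add[OF lim[of x] lim[of y]]])
  show "spint g (smul c x) = smul c (spint g x)"
    by (rule limitin_sequentially_unique[OF lim[of "smul c x", unfolded sint_vec(2)[OF s(1)]]
          limitin_scale[OF lim[of x]]])
qed

lemma spint_vec_diff: "bounded_measurable g \<Longrightarrow> spint g (x - y) = spint g x - spint g y"
  using spint_vec(1)[of g "x - y" y] by simp

lemma spint_bound:
  assumes p: "p \<in> CS" and g: "bounded_measurable g"
    and C: "0 \<le> C" "\<And>x. x \<in> space M \<Longrightarrow> cmod (g x) \<le> C"
    and K: "\<And>A. A \<in> sets M \<Longrightarrow> p (mu A \<psi>) \<le> K"
  shows "p (spint g \<psi>) \<le> 4 * C * K"
proof -
  have K0: "0 \<le> K" using K[of "{}"] CS_zero[OF p] by (simp add: mu_empty)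
  obtain s where s: "\<And>n. simple_function M (s n)" "uniform_limit (space M) s g sequentially"
    using uniform_simple_approx[OF g] by metis
  \<comment> \<open>The simple approximants are bounded only by \<open>C + e\<close>, which is also
    positive for \<open>C = 0\<close>, as \<open>sint_bound\<close> demands; \<open>e\<close> tends
    to 0 at the end.\<close>
  have "p (spint g \<psi>) \<le> 4 * (C + e) * K" if e: "0 < e" for e
  proof (rule tendsto_lowerbound)
    have "(\<lambda>n. 4 * (C + e) * K + p (sint (s n) \<psi> - spint g \<psi>)) \<longlonglongrightarrow> 4 * (C + e) * K + 0"
      using spint_limit[OF g s, of \<psi>] p by (intro tendsto_add) (auto simp: limitin_iff)
    then show "(\<lambda>n. 4 * (C + e) * K + p (sint (s n) \<psi> - spint g \<psi>)) \<longlonglongrightarrow> 4 * (C + e) * K" by simp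
    show "\<forall>\<^sub>F n in sequentially. p (spint g \<psi>) \<le> 4 * (C + e) * K + p (sint (s n) \<psi> - spint g \<psi>)"
      using uniform_limitD[OF s(2) e]
    proof eventually_elim
      case (elim n)
      have "p (sint (s n) \<psi>) \<le> 4 * (C + e) * K"
      proof (rule sint_bound[OF p s(1) _ _ K])
        fix x assume x: "x \<in> space M"
        have "cmod (s n x) \<le> cmod (g x) + cmod (s n x - g x)" by (metis add.commute norm_triangle_sub)
        also have "\<dots> \<le> C + e" using elim x C(2) by (intro add_mono) (auto simp: dist_norm intro: less_imp_le)
        finally show "cmod (s n x) \<le> C + e" .
      qed (use e C in auto)
      moreover have "p (spint g \<psi>) \<le> p (sint (s n) \<psi>) + p (sint (s n) \<psi> - spint g \<psi>)"
        using CS_diff[OF p, of "sint (s n) \<psi>" "sint (s n) \<psi> - spint g \<psi>"] by simp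
      ultimately show ?case by simp
    qed
  qed simp
  moreover have "((\<lambda>e. 4 * (C + e) * K) \<longlongrightarrow> 4 * (C + 0) * K) (at_right 0)"
    by (intro tendsto_intros)
  ultimately show ?thesis
    by (intro tendsto_lowerbound[of "\<lambda>e. 4 * (C + e) * K" _ "at_right 0"])
      (auto simp: eventually_at_right_less intro: eventually_mono[OF eventually_at_right_less])
qed

lemma spint_operator:
  assumes g: "bounded_measurable g"
  shows "spint g \<in> continuous_operators smul T"
  unfolding continuous_operators_iff
proof (intro conjI allI ballI)
  fix p assume p: "p \<in> CS"
  obtain p' where p': "p' \<in> CS" "\<And>A x. A \<in> sets M \<Longrightarrow> p (mu A x) \<le> p' x"
    using equicontinuous[OF p] by blast
  obtain C where C: "0 < C" "\<And>x. x \<in> space M \<Longrightarrow> cmod (g x) \<le> C"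
    using bounded_measurableE[OF g] by blast
  have "p (spint g x) \<le> 4 * C * p' x" for x
    using C by (intro spint_bound[OF p g] p') auto
  then show "\<exists>q\<in>CS. \<forall>x. p (spint g x) \<le> q x"
    using CS_cmult[OF p'(1), of "4 * C"] C by (intro bexI[of _ "\<lambda>x. 4 * C * p' x"]) auto
qed (simp_all add: spint_vec[OF g])

lemma limitin_operator:
  assumes A: "A \<in> continuous_operators smul T" and lim: "limitin T x l F"
  shows "limitin T (\<lambda>i. A (x i)) (A l) F"
  using continuous_map_limit[of T T A x l F] A lim
  by (simp add: continuous_operators_def o_def)

text \<open>One factor is approximated at a time: for a simple left factor its continuity as an
  operator suffices, and then the left factor varies while the vector \<open>spint h \<psi>\<close>
  stays fixed.\<close>

lemma spint_mult:
  assumes g: "bounded_measurable g" and h: "bounded_measurable h"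
  shows "spint (\<lambda>x. g x * h x) \<psi> = spint g (spint h \<psi>)"
proof -
  have simple_left: "spint (\<lambda>x. s x * h x) \<psi> = spint s (spint h \<psi>)"
    if s: "simple_function M s" "bounded_measurable s" for s
  proof -
    obtain t where t: "\<And>n. simple_function M (t n)" "uniform_limit (space M) t h sequentially"
      using uniform_simple_approx[OF h] by metis
    have "uniform_limit (space M) (\<lambda>n x. s x * t n x) (\<lambda>x. s x * h x) sequentially"
      using s(2) h t(2) by (intro uniform_lim_mult uniform_limit_const) (auto simp: bounded_measurable_def)
    then have 1: "limitin T (\<lambda>n. sint (\<lambda>x. s x * t n x) \<psi>) (spint (\<lambda>x. s x * h x) \<psi>) sequentially"
      using s h t by (intro spint_limit bounded_measurable_mult simple_function_mult)
    have 2: "limitin T (\<lambda>n. spint s (sint (t n) \<psi>)) (spint s (spint h \<psi>)) sequentially"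
      by (rule limitin_operator[OF spint_operator[OF s(2)] spint_limit[OF h t]])
    show ?thesis
      by (rule limitin_sequentially_unique[OF 1[unfolded sint_mult[OF s(1) t(1)]]
            2[unfolded spint_simple[OF s(1)]], folded spint_simple[OF s(1)]])
  qed
  obtain s where s: "\<And>n. simple_function M (s n)" "uniform_limit (space M) s g sequentially"
    using uniform_simple_approx[OF g] by metis
  have bs: "bounded_measurable (s n)" for n
    using s(1)[of n] by (auto simp: bounded_measurable_def borel_measurable_simple_function
        intro: finite_imp_bounded simple_functionD)
  show ?thesis
  proof (rule limitin_unique[OF _ spint_limit[OF g s]])
    show "limitin T (\<lambda>n. sint (s n) (spint h \<psi>)) (spint (\<lambda>x. g x * h x) \<psi>) sequentially"
      unfolding limitin_iff
    proof
      fix p assume p: "p \<in> CS"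
      obtain p' where p': "p' \<in> CS" "\<And>A x. A \<in> sets M \<Longrightarrow> p (mu A x) \<le> p' x"
        using equicontinuous[OF p] by blast
      obtain C where C: "0 < C" "\<And>x. x \<in> space M \<Longrightarrow> cmod (h x) \<le> C"
        using bounded_measurableE[OF h] by blast
      show "(\<lambda>n. p (sint (s n) (spint h \<psi>) - spint (\<lambda>x. g x * h x) \<psi>)) \<longlonglongrightarrow> 0"
      proof (rule tendstoI)
        fix e :: real assume e: "0 < e"
        obtain d where d: "0 < d" and less: "d * (4 * C * p' \<psi>) < e"
          using small_factor[OF e, of "4 * C * p' \<psi>"] C CS_nonneg[OF p'(1), of \<psi>] by auto
        show "\<forall>\<^sub>F n in sequentially. dist (p (sint (s n) (spint h \<psi>) - spint (\<lambda>x. g x * h x) \<psi>)) 0 < e"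
          using uniform_limitD[OF s(2) d]
        proof eventually_elim
          case (elim n)
          have "sint (s n) (spint h \<psi>) - spint (\<lambda>x. g x * h x) \<psi> = spint (\<lambda>x. s n x * h x - g x * h x) \<psi>"
            using s bs g h by (subst spint_diff) (auto simp: simple_left spint_simple intro: bounded_measurable_mult)
          also have "p \<dots> \<le> 4 * (d * C) * p' \<psi>"
          proof (rule spint_bound[OF p _ _ _ p'(2)])
            fix x assume x: "x \<in> space M"
            have "cmod (s n x - g x) * cmod (h x) \<le> d * C"
              using elim x C d by (intro mult_mono) (auto simp: dist_norm intro: less_imp_le)
            then show "cmod (s n x * h x - g x * h x) \<le> d * C"
              by (simp add: norm_mult flip: left_diff_distrib)
          qed (use d C bs g h in \<open>auto intro!: bounded_measurable_intros\<close>)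
          finally show ?case using less CS_nonneg[OF p] by (simp add: algebra_simps)
        qed
      qed
    qed
  qed simp
qed

lemma spint_mult_mu:
  assumes "bounded_measurable g" "A \<in> sets M"
  shows "spint (\<lambda>x. g x * indicator A x) \<psi> = spint g (mu A \<psi>)"
    and "mu A (spint g \<psi>) = spint g (mu A \<psi>)"
  using spint_mult[OF assms(1) bounded_measurable_indicator[OF assms(2)], of \<psi>]
    spint_mult[OF bounded_measurable_indicator[OF assms(2)] assms(1), of \<psi>]
  by (simp_all add: spint_indicator assms mult.commute)

text \<open>Egorov's idea. The sets \<open>B N\<close>, where a deviation above \<open>d\<close>
  still occurs from \<open>N\<close> on, decrease to the empty set, so
  \<open>mu (B N) \<psi>\<close> tends to 0 strongly; off \<open>B N\<close> the deviation is at
  most \<open>d\<close>.\<close>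

theorem spint_bounded_convergence:
  assumes g: "\<And>n. bounded_measurable (g n)" and h: "bounded_measurable h"
    and C: "\<And>n x. x \<in> space M \<Longrightarrow> cmod (g n x) \<le> C"
    and lim: "\<And>x. x \<in> space M \<Longrightarrow> (\<lambda>n. g n x) \<longlonglongrightarrow> h x"
  shows "limitin T (\<lambda>n. spint (g n) \<psi>) (spint h \<psi>) sequentially"
  unfolding limitin_iff
proof
  fix p assume p: "p \<in> CS"
  obtain p' where p': "p' \<in> CS" "\<And>A x. A \<in> sets M \<Longrightarrow> p (mu A x) \<le> p' x"
    using equicontinuous[OF p] by blast
  obtain D where D: "0 < D" "\<And>x. x \<in> space M \<Longrightarrow> cmod (h x) \<le> D"
    using bounded_measurableE[OF h] by blast
  define c where "c = \<bar>C\<bar> + D"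
  define u where "u n x = g n x - h x" for n x
  have u: "bounded_measurable (u n)" for n
    unfolding u_def using g h by (intro bounded_measurable_diff)
  note [measurable] = bounded_measurable_borel[OF u]
  have c0: "0 \<le> c" using D by (simp add: c_def)
  have uc: "cmod (u n x) \<le> c" if "x \<in> space M" for n x
    using C[OF that, of n] D(2)[OF that] norm_triangle_ineq4[of "g n x" "h x"] by (simp add: u_def c_def)
  show "(\<lambda>n. p (spint (g n) \<psi> - spint h \<psi>)) \<longlonglongrightarrow> 0"
  proof (rule tendstoI)
    fix e :: real assume e: "0 < e"
    obtain d where d: "0 < d" and less: "d * (4 * p' \<psi>) < e / 2"
      using small_factor[of "e / 2" "4 * p' \<psi>"] e CS_nonneg[OF p'(1), of \<psi>] by auto
    define B where "B N = {x \<in> space M. \<exists>n\<ge>N. d < cmod (u n x)}" for N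
    have B: "B N \<in> sets M" for N unfolding B_def by measurable
    have "decseq B" by (auto simp: decseq_def B_def intro: order_trans)
    moreover have "(\<Inter>N. B N) = {}"
    proof -
      have "\<exists>N. x \<notin> B N" if x: "x \<in> space M" for x
      proof -
        have "(\<lambda>n. u n x) \<longlonglongrightarrow> 0" using lim[OF x] by (simp add: u_def LIM_zero)
        then obtain N where "\<And>n. N \<le> n \<Longrightarrow> cmod (u n x) < d"
          using LIMSEQ_D[OF _ d] by fastforce
        then have "x \<notin> B N" by (auto simp: B_def not_less intro: less_imp_le)
        then show ?thesis ..
      qed
      moreover have "B 0 \<subseteq> space M" by (auto simp: B_def)
      ultimately show ?thesis by blast
    qed
    ultimately have "(\<lambda>n. p' (mu (B n) \<psi>)) \<longlonglongrightarrow> 0"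
      using B p'(1) by (intro strong_continuity_from_above) auto
    then have "(\<lambda>n. 4 * c * p' (mu (B n) \<psi>)) \<longlonglongrightarrow> 4 * c * 0" by (intro tendsto_mult_left)
    then have "\<forall>\<^sub>F n in sequentially. 4 * c * p' (mu (B n) \<psi>) < e / 2"
      using e by (intro order_tendstoD(2)[where y = 0]) auto
    then show "\<forall>\<^sub>F n in sequentially. dist (p (spint (g n) \<psi> - spint h \<psi>)) 0 < e"
    proof eventually_elim
      case (elim n)
      let ?i = "indicator (B n) :: 's \<Rightarrow> complex" and ?j = "indicator (space M - B n) :: 's \<Rightarrow> complex"
      have Bc: "space M - B n \<in> sets M" using B by blast
      have "spint (g n) \<psi> - spint h \<psi> = spint (\<lambda>x. u n x * ?i x + u n x * ?j x) \<psi>"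
        using g h by (subst spint_diff[symmetric]) (auto simp: u_def indicator_def intro!: fun_cong[OF spint_cong])
      also have "\<dots> = spint (\<lambda>x. u n x * ?i x) \<psi> + spint (\<lambda>x. u n x * ?j x) \<psi>"
        using u B Bc by (intro spint_add bounded_measurable_intros)
      finally have "p (spint (g n) \<psi> - spint h \<psi>)
          \<le> p (spint (\<lambda>x. u n x * ?i x) \<psi>) + p (spint (\<lambda>x. u n x * ?j x) \<psi>)"
        by (simp only: CS_add[OF p])
      also have "p (spint (\<lambda>x. u n x * ?i x) \<psi>) \<le> 4 * c * p' (mu (B n) \<psi>)"
        \<comment> \<open>On \<open>B n\<close> the integrand is bounded only by \<open>c\<close>,
          but it acts on the vector \<open>mu (B n) \<psi>\<close>, which is small in
          \<open>p'\<close>.\<close>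
        unfolding spint_mult_mu(1)[OF u B] by (rule spint_bound[OF p u c0 uc p'(2)])
      also have "p (spint (\<lambda>x. u n x * ?j x) \<psi>) \<le> 4 * d * p' \<psi>"
      proof (rule spint_bound[OF p _ _ _ p'(2)])
        fix x assume "x \<in> space M"
        then show "cmod (u n x * ?j x) \<le> d" using d by (auto simp: B_def indicator_def norm_mult not_less)
      qed (use d u Bc in \<open>auto intro: bounded_measurable_intros\<close>)
      finally show ?case using less elim CS_nonneg[OF p] by (simp add: algebra_simps)
    qed
  qed
qed

end

section \<open>Spectrum and spectral measure\<close>

locale spectral_operator = spectral_space smul T M mu
  for smul :: "complex \<Rightarrow> 'a::ab_group_add \<Rightarrow> 'a" and T :: "'a topology"
    and M :: "'s measure" and mu :: "'s set \<Rightarrow> 'a \<Rightarrow> 'a" +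
  fixes f :: "'s \<Rightarrow> complex"
  assumes f_borel [measurable]: "f \<in> borel_measurable M" and f_bounded: "bounded (f ` space M)"
begin

abbreviation "U \<equiv> spint f"

abbreviation "pen \<equiv> pencil smul U"

abbreviation "P \<nu> \<equiv> mu (f -` {\<nu>} \<inter> space M)"

lemma f_bm: "bounded_measurable f"
  using f_borel f_bounded by (simp add: bounded_measurable_def)

lemma level_sets [measurable]: "B \<in> sets borel \<Longrightarrow> f -` B \<inter> space M \<in> sets M"
  by (rule measurable_sets[OF f_borel])

lemma level_set_point: "f -` {\<nu>} \<inter> space M \<in> sets M"
  by (rule level_sets) simp

lemma pencil_eq: "pen \<xi> \<psi> = spint (\<lambda>x. \<xi> - f x) \<psi>"
proof -
  have "spint (\<lambda>x. \<xi> - f x) \<psi> = spint (\<lambda>x. \<xi> * 1) \<psi> - U \<psi>"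
    using f_bm by (subst spint_diff) (auto intro: bounded_measurable_const)
  also have "spint (\<lambda>x. \<xi> * 1) \<psi> = smul \<xi> \<psi>"
    by (subst spint_cmult[OF bounded_measurable_const]) (simp add: spint_one)
  finally show ?thesis by (simp add: pencil_def)
qed

lemma pencil_bm: "bounded_measurable (\<lambda>x. \<xi> - f x)"
  by (intro bounded_measurable_diff bounded_measurable_const f_bm)

lemma pencil_scale: "pen \<xi> (smul c x) = smul c (pen \<xi> x)"
  and pencil_vec_diff: "pen \<xi> (x - y) = pen \<xi> x - pen \<xi> y"
  by (simp_all add: pencil_eq spint_vec spint_vec_diff pencil_bm)

text \<open>Continuity at 0 of the inverse on its range, made quantitative by homogeneity: the
  pencil is bounded below in the sense of seminorms.\<close>

lemma resolvent_bound:
  assumes \<xi>: "\<xi> \<in> resolvent_set smul T U" and p: "p \<in> CS"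
  obtains q where "q \<in> CS" "\<And>\<eta>. p \<eta> \<le> q (pen \<xi> \<eta>)"
proof -
  have inj: "inj (pen \<xi>)"
    and cont: "continuous_map (subtopology T (range (pen \<xi>))) T (inv (pen \<xi>))"
    using \<xi> by (auto simp: resolvent_set_def)
  have zero: "pen \<xi> 0 = 0" using pencil_vec_diff[of \<xi> 0 0] by simp
  have "openin T {y. p (y - 0) < 1}" by (rule ball_open[OF p])
  then have "openin (subtopology T (range (pen \<xi>)))
      {x \<in> topspace (subtopology T (range (pen \<xi>))). inv (pen \<xi>) x \<in> {y. p (y - 0) < 1}}"
    by (rule openin_continuous_map_preimage[OF cont])
  then obtain V where V: "openin T V"
    "{x \<in> range (pen \<xi>). p (inv (pen \<xi>) x) < 1} = V \<inter> range (pen \<xi>)"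
    by (auto simp: openin_subtopology topspace_UNIV)
  have inv0: "inv (pen \<xi>) (pen \<xi> x) = x" for x by (rule inv_f_f[OF inj])
  have "pen \<xi> 0 \<in> V" using V(2) inv0[of 0] CS_zero[OF p] by auto
  then obtain q where q: "q \<in> CS" "{y. q (y - 0) < 1} \<subseteq> V"
    using open_ball[OF V(1), of 0] zero by auto
  have less: "p \<eta> < 1" if "q (pen \<xi> \<eta>) < 1" for \<eta>
  proof -
    have "pen \<xi> \<eta> \<in> V \<inter> range (pen \<xi>)" using q(2) that by auto
    then show ?thesis unfolding V(2)[symmetric] using inv0 by auto
  qed
  have "p \<eta> \<le> q (pen \<xi> \<eta>)" for \<eta>
  \<comment> \<open>Rescaling by a strictly larger \<open>t\<close> avoids dividing by
    \<open>q (pen \<xi> \<eta>)\<close>, which may be 0.\<close>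
  proof (rule dense_ge)
    fix t assume t: "q (pen \<xi> \<eta>) < t"
    then have t0: "0 < t" using CS_nonneg[OF q(1), of "pen \<xi> \<eta>"] by simp
    have "q (pen \<xi> (smul (of_real (1 / t)) \<eta>)) < 1"
      using t t0 unfolding pencil_scale CS_scale[OF q(1)] by (simp add: norm_divide)
    from less[OF this] have "p \<eta> / t < 1" using t0 by (simp add: CS_scale[OF p] norm_divide)
    then show "p \<eta> \<le> t" using t0 by simp
  qed
  with q(1) show thesis using that by blast
qed

lemma resolvent_power_bound:
  assumes "\<xi> \<in> resolvent_set smul T U" "p \<in> CS"
  shows "\<exists>q\<in>CS. \<forall>\<eta>. p \<eta> \<le> q ((pen \<xi> ^^ k) \<eta>)"
proof (induction k)
  case 0
  then show ?case using assms(2) by auto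
next
  case (Suc k)
  then obtain q where q: "q \<in> CS" "\<And>\<eta>. p \<eta> \<le> q ((pen \<xi> ^^ k) \<eta>)" by blast
  obtain q' where "q' \<in> CS" "\<And>\<eta>. q \<eta> \<le> q' (pen \<xi> \<eta>)"
    using resolvent_bound[OF assms(1) q(1)] by blast
  then show ?case using q(2) by (auto intro!: bexI[of _ q'] intro: order_trans)
qed

lemma pencil_power: "(pen \<xi> ^^ k) (mu A \<psi>) = spint (\<lambda>x. (\<xi> - f x) ^ k * indicator A x) \<psi>"
  if "A \<in> sets M"
proof (induction k)
  case 0
  then show ?case using that by (simp add: spint_indicator)
next
  case (Suc k)
  have "bounded_measurable (\<lambda>x. (\<xi> - f x) ^ k * indicator A x)"
    using that by (intro bounded_measurable_mult bounded_measurable_power bounded_measurable_indicator pencil_bm)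
  then show ?case
    using Suc by (simp add: pencil_eq spint_mult[OF pencil_bm, symmetric] mult.assoc)
qed

text \<open>Over \<open>A\<close> the third power of the pencil integrates
  \<open>(\<xi> - f) ^ 3\<close>, of size at most \<open>e ^ 3\<close>, while three lower bounds in
  succession recover \<open>p\<close>. The exponent only has to exceed 2, the real dimension of the
  plane.\<close>

lemma resolvent_cubic_bound:
  assumes \<xi>: "\<xi> \<in> resolvent_set smul T U" and p: "p \<in> CS"
  shows "\<exists>K. \<forall>A\<in>sets M. \<forall>e\<ge>0. (\<forall>x\<in>A. cmod (\<xi> - f x) \<le> e) \<longrightarrow> p (mu A \<psi>) \<le> K * e ^ 3"
proof -
  obtain q where q: "q \<in> CS" "\<And>\<eta>. p \<eta> \<le> q ((pen \<xi> ^^ 3) \<eta>)"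
    using resolvent_power_bound[OF \<xi> p] by blast
  obtain q' where q': "q' \<in> CS" "\<And>A x. A \<in> sets M \<Longrightarrow> q (mu A x) \<le> q' x"
    using equicontinuous[OF q(1)] by blast
  have "p (mu A \<psi>) \<le> (4 * q' \<psi>) * e ^ 3"
    if A: "A \<in> sets M" and e: "0 \<le> e" and close: "\<forall>x\<in>A. cmod (\<xi> - f x) \<le> e" for A e
  proof -
    have "q (spint (\<lambda>x. (\<xi> - f x) ^ 3 * indicator A x) \<psi>) \<le> 4 * e ^ 3 * q' \<psi>"
    proof (rule spint_bound[OF q(1) _ _ _ q'(2)])
      show "bounded_measurable (\<lambda>x. (\<xi> - f x) ^ 3 * indicator A x)"
        using A by (intro bounded_measurable_mult bounded_measurable_power bounded_measurable_indicator pencil_bm)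
      show "cmod ((\<xi> - f x) ^ 3 * indicator A x) \<le> e ^ 3" for x
        using e close by (auto simp: indicator_def norm_mult norm_power intro!: power_mono)
    qed (use e in auto)
    then show ?thesis using q(2)[of "mu A \<psi>"] by (simp add: pencil_power[OF A] mult_ac)
  qed
  then show ?thesis by blast
qed

text \<open>About \<open>N\<^sup>2\<close> squares of side \<open>1/N\<close> cover the range of \<open>f\<close>; each one that meets the resolvent set
  has measure \<open>O(1/N\<^sup>3)\<close> by the cubic bound. The constants depend on the point,
  so the argument is run on the sublevel sets of the constant.\<close>

theorem mu_resolvent_null:
  assumes A: "A \<in> sets M" and res: "f ` A \<subseteq> resolvent_set smul T U"
  shows "mu A \<psi> = 0"
proof (rule eq_if_CS_zero)
  fix p assume p: "p \<in> CS"
  have "\<forall>\<xi>\<in>f ` A. \<exists>K. \<forall>B\<in>sets M. \<forall>e\<ge>0. (\<forall>x\<in>B. cmod (\<xi> - f x) \<le> e) \<longrightarrow> p (mu B \<psi>) \<le> K * e ^ 3"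
    using resolvent_cubic_bound[OF _ p] res by auto
  \<comment> \<open>The constants are chosen point by point, so \<open>K\<close> need not be
    measurable. Its sublevel sets are therefore enclosed in the unions \<open>V n k\<close> of grid
    cells.\<close>
  from bchoice[OF this] obtain K where K: "\<And>\<xi> B e. \<xi> \<in> f ` A \<Longrightarrow> B \<in> sets M \<Longrightarrow> 0 \<le> e \<Longrightarrow>
      (\<And>x. x \<in> B \<Longrightarrow> cmod (\<xi> - f x) \<le> e) \<Longrightarrow> p (mu B \<psi>) \<le> K \<xi> * e ^ 3"
    by meson
  obtain C where C: "0 < C" "\<And>x. x \<in> space M \<Longrightarrow> cmod (f x) \<le> C"
    using bounded_measurableE[OF f_bm] by blast
  have Asp: "A \<subseteq> space M" using A by (rule sets.sets_into_space)
  define cell where "cell n z = (\<lfloor>real (Suc n) * Re z\<rfloor>, \<lfloor>real (Suc n) * Im z\<rfloor>)" for n z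
  define J where "J n k = cell n ` {\<xi> \<in> f ` A. K \<xi> \<le> real k}" for n k
  define Q where "Q n j = {x \<in> space M. cell n (f x) = j}" for n j
  have Q: "Q n j \<in> sets M" for n j
    unfolding Q_def cell_def by (cases j) (simp, measurable)
  have cell_close: "cmod (z - w) \<le> 2 / real (Suc n)" if "cell n z = cell n w" for z w n
  proof -
    have *: "\<bar>a - b\<bar> \<le> 1 / real (Suc n)" if "\<lfloor>real (Suc n) * a\<rfloor> = \<lfloor>real (Suc n) * b\<rfloor>" for a b
    proof -
      have "\<bar>real (Suc n) * a - real (Suc n) * b\<bar> \<le> 1" using that by linarith
      then have "real (Suc n) * \<bar>a - b\<bar> \<le> 1"
        by (metis abs_mult abs_of_nat right_diff_distrib)
      then show ?thesis by (simp add: field_simps)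
    qed
    have "\<bar>Re z - Re w\<bar> \<le> 1 / real (Suc n)" "\<bar>Im z - Im w\<bar> \<le> 1 / real (Suc n)"
      by (rule *, use that in \<open>simp add: cell_def\<close>)+
    then show ?thesis using cmod_le[of "z - w"] by simp
  qed
  define L where "L n = \<lceil>real (Suc n) * C\<rceil>" for n
  have cell_range: "cell n (f x) \<in> {- L n..L n} \<times> {- L n..L n}" if x: "x \<in> space M" for n x
  proof -
    have *: "\<lfloor>real (Suc n) * t\<rfloor> \<in> {- L n..L n}" if "\<bar>t\<bar> \<le> C" for t
      unfolding L_def by (rule floor_mult_bounded[OF _ that]) simp
    have "\<bar>Re (f x)\<bar> \<le> C" "\<bar>Im (f x)\<bar> \<le> C"
      using C(2)[OF x] abs_Re_le_cmod[of "f x"] abs_Im_le_cmod[of "f x"] by linarith+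
    then show ?thesis using * by (simp add: cell_def)
  qed
  have J_sub: "J n k \<subseteq> {- L n..L n} \<times> {- L n..L n}" for n k
  proof
    fix j assume "j \<in> J n k"
    then obtain x where "x \<in> space M" "j = cell n (f x)" using Asp by (auto simp: J_def)
    then show "j \<in> {- L n..L n} \<times> {- L n..L n}" using cell_range by simp
  qed
  then have J_fin: "finite (J n k)" for n k by (rule finite_subset) simp
  \<comment> \<open>Each axis has \<open>2 * L n + 1\<close> indices, and \<open>L n\<close> is at
    most (n+1)C + 1; hence the factor (n+1)(2C+3) per axis.\<close>
  have J_card: "real (card (J n k)) \<le> (real (Suc n) * (2 * C + 3))\<^sup>2" for n k
  proof -
    have "0 \<le> real (Suc n) * C" using C(1) by (intro mult_nonneg_nonneg) auto
    then have L0: "0 \<le> L n" unfolding L_def by linarith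
    have "card (J n k) \<le> card ({- L n..L n} \<times> {- L n..L n})"
      by (rule card_mono[OF _ J_sub]) simp
    also have "\<dots> = (nat (2 * L n + 1))\<^sup>2"
      by (simp add: card_cartesian_product power2_eq_square)
    finally have "real (card (J n k)) \<le> (real_of_int (2 * L n + 1))\<^sup>2"
      using L0 by (simp add: of_nat_power flip: of_nat_le_iff[where ?'a = real])
    also have "\<dots> \<le> (real (Suc n) * (2 * C + 3))\<^sup>2"
    proof (rule power_mono)
      have "real_of_int (L n) \<le> real (Suc n) * C + 1" unfolding L_def by linarith
      then show "real_of_int (2 * L n + 1) \<le> real (Suc n) * (2 * C + 3)"
        by (simp add: algebra_simps)
    qed (use L0 in simp)
    finally show ?thesis .
  qed
  define V where "V n k = (\<Union>j\<in>J n k. Q n j)" for n k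
  have V: "V n k \<in> sets M" for n k unfolding V_def using J_fin Q by (intro sets.finite_UN)
  have V_bound: "p (mu B \<psi>) \<le> real k * 8 * (2 * C + 3)\<^sup>2 / real (Suc n)"
    if B: "B \<in> sets M" "B \<subseteq> V n k" for B n k
  proof -
    have "B = (\<Union>j\<in>J n k. B \<inter> Q n j)" using B(2) by (auto simp: V_def)
    then have "mu B \<psi> = mu (\<Union>j\<in>J n k. B \<inter> Q n j) \<psi>" by simp
    also have "\<dots> = (\<Sum>j\<in>J n k. mu (B \<inter> Q n j) \<psi>)"
      using J_fin B(1) Q by (intro mu_UN) (auto simp: disjoint_family_on_def Q_def)
    finally have "p (mu B \<psi>) \<le> (\<Sum>j\<in>J n k. p (mu (B \<inter> Q n j) \<psi>))"
      using CS_sum[OF p] by simp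
    also have "\<dots> \<le> (\<Sum>j\<in>J n k. real k * (2 / real (Suc n)) ^ 3)"
    proof (rule sum_mono)
      fix j assume "j \<in> J n k"
      then obtain \<xi> where \<xi>: "\<xi> \<in> f ` A" "K \<xi> \<le> real k" "j = cell n \<xi>" by (auto simp: J_def)
      have "p (mu (B \<inter> Q n j) \<psi>) \<le> K \<xi> * (2 / real (Suc n)) ^ 3"
        using B(1) Q \<xi> by (intro K cell_close) (auto simp: Q_def)
      also have "\<dots> \<le> real k * (2 / real (Suc n)) ^ 3"
        using \<xi>(2) by (intro mult_right_mono) auto
      finally show "p (mu (B \<inter> Q n j) \<psi>) \<le> real k * (2 / real (Suc n)) ^ 3" .
    qed
    also have "\<dots> = real (card (J n k)) * (real k * (2 / real (Suc n)) ^ 3)" by simp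
    also have "\<dots> \<le> (real (Suc n) * (2 * C + 3))\<^sup>2 * (real k * (2 / real (Suc n)) ^ 3)"
      by (intro mult_right_mono J_card) auto
    also have "\<dots> = real k * 8 * (2 * C + 3)\<^sup>2 / real (Suc n)"
      by (simp add: power_mult_distrib power_divide power2_eq_square power3_eq_cube)
    finally show ?thesis .
  qed
  \<comment> \<open>\<open>N k\<close> contains every point of \<open>A\<close> with constant at
    most \<open>k\<close>. It is null for \<open>p\<close> because it lies in \<open>V n k\<close>
    at every scale and the bound there tends to 0 as \<open>n\<close> grows.\<close>
  define N where "N k = (\<Inter>n. V n k)" for k
  have N: "N k \<in> sets M" for k unfolding N_def using V by (intro sets.countable_INT) auto
  have N_null: "p (mu B \<psi>) = 0" if B: "B \<in> sets M" "B \<subseteq> N k" for B k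
  proof -
    have "(\<lambda>n. real k * 8 * (2 * C + 3)\<^sup>2 / real (Suc n)) \<longlonglongrightarrow> 0" by real_asymp
    moreover have "p (mu B \<psi>) \<le> real k * 8 * (2 * C + 3)\<^sup>2 / real (Suc n)" for n
      using B by (intro V_bound) (auto simp: N_def)
    ultimately have "p (mu B \<psi>) \<le> 0" by (intro LIMSEQ_le_const) auto
    then show ?thesis using CS_nonneg[OF p, of "mu B \<psi>"] by simp
  qed
  have "incseq N" unfolding incseq_def N_def V_def J_def by (fastforce intro: order_trans)
  then have "decseq (\<lambda>k. A - N k)" by (auto simp: incseq_def decseq_def)
  moreover have "(\<Inter>k. A - N k) = {}"
  proof -
    have "\<exists>k. x \<in> N k" if x: "x \<in> A" for x
    proof -
      obtain k where "K (f x) \<le> real k" using real_arch_simple by blast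
      then have "x \<in> N k" using x Asp by (auto simp: N_def V_def J_def Q_def)
      then show ?thesis ..
    qed
    then show ?thesis by blast
  qed
  ultimately have "(\<lambda>k. p (mu (A - N k) \<psi>)) \<longlonglongrightarrow> 0"
    using A N p by (intro strong_continuity_from_above) auto
  moreover have "p (mu A \<psi>) \<le> p (mu (A - N k) \<psi>)" for k
  proof -
    have "mu ((A - N k) \<union> (A \<inter> N k)) \<psi> = mu (A - N k) \<psi> + mu (A \<inter> N k) \<psi>"
      using A N by (intro mu_Un) auto
    then have "p (mu A \<psi>) \<le> p (mu (A - N k) \<psi>) + p (mu (A \<inter> N k) \<psi>)"
      using CS_add[OF p] by (simp add: Un_Diff_Int)
    then show ?thesis using N_null[of "A \<inter> N k" k] A N by simp
  qed
  ultimately have "p (mu A \<psi>) \<le> 0" by (intro LIMSEQ_le_const) auto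
  then show "p (mu A \<psi> - 0) = 0" using CS_nonneg[OF p, of "mu A \<psi>"] by simp
qed

text \<open>Where \<open>f\<close> stays away from \<open>\<nu>\<close> the function
  \<open>1 / (\<nu> - f)\<close> is bounded and its integral inverts the pencil, so an eigenvector
  has no component over \<open>B n\<close>. These sets increase to the complement of the level
  set.\<close>

lemma eigenvector_fixed:
  assumes "U \<psi> = smul \<nu> \<psi>"
  shows "P \<nu> \<psi> = \<psi>"
proof -
  define B where "B n = {x \<in> space M. 1 / real (Suc n) \<le> cmod (\<nu> - f x)}" for n
  have B [measurable]: "B n \<in> sets M" for n unfolding B_def by measurable
  define D where "D = {x \<in> space M. f x \<noteq> \<nu>}"
  have D: "D \<in> sets M" unfolding D_def by measurable
  have zero: "spint (indicator (B n)) \<psi> = 0" for n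
  proof -
    define g where "g x = inverse (\<nu> - f x) * indicator (B n) x" for x
    have g: "bounded_measurable g"
    proof (rule bounded_measurableI)
      show "g \<in> borel_measurable M" unfolding g_def by measurable
      fix x assume "x \<in> space M"
      show "cmod (g x) \<le> real (Suc n)"
      proof (cases "x \<in> B n")
        case True
        then have *: "1 / real (Suc n) \<le> cmod (\<nu> - f x)" by (simp add: B_def)
        then have "inverse (cmod (\<nu> - f x)) \<le> inverse (1 / real (Suc n))"
          by (intro le_imp_inverse_le) auto
        with True show ?thesis by (simp add: g_def norm_inverse)
      qed (simp add: g_def)
    qed
    have "spint (indicator (B n)) \<psi> = spint (\<lambda>x. g x * (\<nu> - f x)) \<psi>"
    proof (rule fun_cong[OF spint_cong])
      fix x assume "x \<in> space M"
      have "\<nu> - f x \<noteq> 0" if "x \<in> B n"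
      proof
        assume "\<nu> - f x = 0"
        with that show False by (simp add: B_def)
      qed
      then show "indicator (B n) x = g x * (\<nu> - f x)" by (auto simp: g_def indicator_def)
    qed
    also have "\<dots> = spint g (pen \<nu> \<psi>)" by (simp add: spint_mult[OF g pencil_bm] pencil_eq)
    also have "pen \<nu> \<psi> = 0" using assms by (simp add: pencil_def)
    also have "spint g 0 = 0" using spint_vec_diff[OF g, of 0 0] by simp
    finally show ?thesis .
  qed
  have "limitin T (\<lambda>n. spint (indicator (B n)) \<psi>) (spint (indicator D) \<psi>) sequentially"
  proof (rule spint_bounded_convergence[where C = 1])
    fix x assume x: "x \<in> space M"
    have "\<forall>\<^sub>F n in sequentially. indicator (B n) x = (indicator D x :: complex)"
    proof (cases "x \<in> D")
      case True
      then have "0 < cmod (\<nu> - f x)" by (auto simp: D_def)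
      moreover have "(\<lambda>n. 1 / real (Suc n)) \<longlonglongrightarrow> 0" by real_asymp
      ultimately have "\<forall>\<^sub>F n in sequentially. 1 / real (Suc n) < cmod (\<nu> - f x)"
        by (rule order_tendstoD(2)[rotated])
      then show ?thesis by eventually_elim (use x True in \<open>simp add: B_def\<close>)
    next
      case False
      then have "x \<notin> B n" for n using x by (auto simp: B_def D_def)
      then show ?thesis using False by simp
    qed
    then show "(\<lambda>n. indicator (B n) x) \<longlonglongrightarrow> (indicator D x :: complex)"
      by (rule tendsto_eventually)
  qed (use B D in \<open>auto intro: bounded_measurable_indicator simp: indicator_def\<close>)
  moreover have "limitin T (\<lambda>n. spint (indicator (B n)) \<psi>) 0 sequentially"
    unfolding zero by (simp add: limitin_const_iff topspace_UNIV)
  ultimately have "spint (indicator D) \<psi> = 0" by (rule limitin_sequentially_unique)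
  then have "mu D \<psi> = 0" using D by (simp add: spint_indicator)
  moreover have "f -` {\<nu>} \<inter> space M = space M - D" by (auto simp: D_def)
  ultimately show ?thesis using mu_Compl[OF D, of \<psi>] by simp
qed

lemma point_spectrum_eigenvector:
  assumes "\<not> inj (pen \<nu>)"
  obtains \<psi> where "\<psi> \<noteq> 0" "P \<nu> \<psi> = \<psi>"
proof -
  obtain x y where "pen \<nu> x = pen \<nu> y" "x \<noteq> y" using assms by (auto simp: inj_def)
  then have "x - y \<noteq> 0" "pen \<nu> (x - y) = 0" by (auto simp: pencil_vec_diff)
  then show thesis using that[of "x - y"] eigenvector_fixed[of "x - y" \<nu>] by (simp add: pencil_def)
qed

text \<open>An eigenvalue outside the range of \<open>f\<close> would have its eigenvectors fixed by
  \<open>mu {}\<close>. This links the isolated circles, stated for values of \<open>f\<close>, to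
  the eigenvalues themselves.\<close>

lemma point_spectrum_value:
  assumes "\<not> inj (pen \<nu>)"
  shows "\<nu> \<in> f ` space M"
proof (rule ccontr)
  assume "\<nu> \<notin> f ` space M"
  then have "f -` {\<nu>} \<inter> space M = {}" by auto
  moreover obtain \<psi> where "\<psi> \<noteq> 0" "P \<nu> \<psi> = \<psi>" using point_spectrum_eigenvector[OF assms] .
  ultimately show False by (simp add: mu_empty)
qed

end

section \<open>Spectral measures without atoms\<close>

text \<open>Second countability: basic open sets isolating distinct points are distinct.\<close>

lemma countable_discrete_real:
  fixes S :: "real set"
  assumes "discrete S"
  shows "countable S"
proof -
  obtain \<B> :: "real set set" where \<B>: "countable \<B>" "\<And>X. X \<in> \<B> \<Longrightarrow> open X"
    "\<And>X x. open X \<Longrightarrow> x \<in> X \<Longrightarrow> \<exists>Y\<in>\<B>. x \<in> Y \<and> Y \<subseteq> X"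
    using ex_countable_basis by (metis topological_basisE topological_basis_open)
  have "\<forall>x\<in>S. \<exists>Y\<in>\<B>. Y \<inter> S = {x}"
  proof
    fix x assume x: "x \<in> S"
    then obtain X where X: "open X" "X \<inter> S = {x}"
      using assms by (auto simp: discrete_def isolated_in_def)
    then have "x \<in> X" by blast
    then obtain Y where "Y \<in> \<B>" "x \<in> Y" "Y \<subseteq> X" using \<B>(3)[OF X(1)] by blast
    with X x show "\<exists>Y\<in>\<B>. Y \<inter> S = {x}" by (intro bexI[of _ Y]) auto
  qed
  then obtain Y where Y: "\<And>x. x \<in> S \<Longrightarrow> Y x \<in> \<B>" "\<And>x. x \<in> S \<Longrightarrow> Y x \<inter> S = {x}"
    by metis
  have "inj_on Y S" by (rule inj_onI) (metis Y(2) singleton_inject)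
  moreover have "countable (Y ` S)" using Y(1) \<B>(1) by (meson countable_subset image_subsetI)
  ultimately show ?thesis by (rule countable_image_inj_on[rotated])
qed

text \<open>For \<open>z \<noteq> 1\<close> in the closed disc the geometric sums stay below 2/|z -
  1|, so their means vanish.\<close>

lemma cesaro_geometric:
  fixes z :: complex
  assumes "cmod z \<le> 1"
  shows "(\<lambda>N. inverse (of_nat N) * (\<Sum>n<N. z ^ n)) \<longlonglongrightarrow> (if z = 1 then 1 else 0)"
proof (cases "z = 1")
  case True
  have "\<forall>\<^sub>F N in sequentially. inverse (of_nat N) * (\<Sum>n<N. z ^ n) = 1"
    using eventually_gt_at_top[of 0] by eventually_elim (simp add: True)
  then show ?thesis using True by (simp add: tendsto_eventually)
next
  case False
  have "(\<lambda>N. inverse (of_nat N) * (\<Sum>n<N. z ^ n)) \<longlonglongrightarrow> 0"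
  proof (rule Lim_null_comparison)
    show "\<forall>\<^sub>F N in sequentially. norm (inverse (of_nat N) * (\<Sum>n<N. z ^ n))
        \<le> (2 / cmod (z - 1)) * inverse (real N)"
    proof (rule always_eventually, rule allI)
      fix N
      have "cmod (z ^ N - 1) \<le> cmod (z ^ N) + 1" using norm_triangle_ineq4[of "z ^ N" 1] by simp
      also have "\<dots> \<le> 2" using assms by (simp add: norm_power power_le_one)
      finally have "cmod (\<Sum>n<N. z ^ n) \<le> 2 / cmod (z - 1)"
        using False by (simp add: geometric_sum norm_divide divide_right_mono)
      then have "inverse (real N) * cmod (\<Sum>n<N. z ^ n) \<le> inverse (real N) * (2 / cmod (z - 1))"
        by (intro mult_left_mono) auto
      then show "norm (inverse (of_nat N) * (\<Sum>n<N. z ^ n)) \<le> (2 / cmod (z - 1)) * inverse (real N)"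
        by (simp add: norm_mult norm_inverse mult_ac)
    qed
    have "(\<lambda>N. (2 / cmod (z - 1)) * inverse (real N)) \<longlonglongrightarrow> (2 / cmod (z - 1)) * 0"
      by (intro tendsto_mult_left lim_inverse_n)
    then show "(\<lambda>N. (2 / cmod (z - 1)) * inverse (real N)) \<longlonglongrightarrow> 0" by simp
  qed
  then show ?thesis using False by simp
qed

text \<open>If \<open>b\<close> has mean zero then its small values have density one, so finitely many translates of
  the set of small values always have a common element.\<close>

lemma cesaro_null_small_differences:
  fixes b :: "nat \<Rightarrow> real"
  assumes b: "\<And>n. 0 \<le> b n" and lim: "(\<lambda>N. inverse (real N) * (\<Sum>n<N. b n)) \<longlonglongrightarrow> 0" and d: "0 < d"
  shows "\<exists>s :: nat \<Rightarrow> nat. strict_mono s \<and> (\<forall>i j. i < j \<longrightarrow> b (s j - s i) \<le> d)"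
proof -
  have step: "\<exists>n. \<forall>i\<in>I. i < n \<and> b (n - i) \<le> d" if I: "finite I" for I :: "nat set"
  proof (rule ccontr)
    assume no: "\<not> ?thesis"
    from I obtain m where "\<forall>i\<in>I. i < m" unfolding finite_nat_set_iff_bounded ..
    then have m: "\<And>i. i \<in> I \<Longrightarrow> i < m" by blast
    \<comment> \<open>If no \<open>n\<close> serves all of \<open>I\<close>, then for each
      \<open>n\<close> beyond \<open>I\<close> some translate exceeds \<open>d\<close>. Averaging
      over \<open>n\<close> bounds \<open>d\<close> by \<open>card I\<close> times the vanishing
      mean, since every shift of the range stays among the indices below \<open>N\<close>.\<close>
    have big: "d \<le> (\<Sum>i\<in>I. b (n - i))" if n: "m \<le> n" for n
    proof -
      obtain i where "i \<in> I" "\<not> (i < n \<and> b (n - i) \<le> d)" using no by blast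
      then have i: "i \<in> I" "d < b (n - i)" using m[of i] n by auto
      then have "b (n - i) \<le> (\<Sum>i\<in>I. b (n - i))" using b I by (intro member_le_sum) auto
      with i show ?thesis by simp
    qed
    have le: "d * (real N - real m) \<le> real (card I) * (\<Sum>n<N. b n)" if N: "m \<le> N" for N
    proof -
      have "d * (real N - real m) = (\<Sum>n\<in>{m..<N}. d)" using N by (simp add: of_nat_diff)
      also have "\<dots> \<le> (\<Sum>n\<in>{m..<N}. \<Sum>i\<in>I. b (n - i))" using big by (intro sum_mono) auto
      also have "\<dots> = (\<Sum>i\<in>I. \<Sum>n\<in>{m..<N}. b (n - i))" by (rule sum.swap)
      also have "\<dots> \<le> (\<Sum>i\<in>I. \<Sum>n<N. b n)"
      proof (rule sum_mono)
        fix i assume i: "i \<in> I"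
        have "(\<Sum>n\<in>{m..<N}. b (n - i)) = (\<Sum>k\<in>(\<lambda>n. n - i) ` {m..<N}. b k)"
          using m[OF i] by (subst sum.reindex) (auto simp: inj_on_def)
        also have "\<dots> \<le> (\<Sum>n<N. b n)" using b by (intro sum_mono2) auto
        finally show "(\<Sum>n\<in>{m..<N}. b (n - i)) \<le> (\<Sum>n<N. b n)" .
      qed
      finally show ?thesis by simp
    qed
    have "(\<lambda>N. d * (1 - real m * inverse (real N))) \<longlonglongrightarrow> d * (1 - real m * 0)"
      by (intro tendsto_intros lim_inverse_n)
    moreover have "(\<lambda>N. real (card I) * (inverse (real N) * (\<Sum>n<N. b n))) \<longlonglongrightarrow> real (card I) * 0"
      by (intro tendsto_mult_left lim)
    moreover have "\<forall>\<^sub>F N in sequentially. d * (1 - real m * inverse (real N))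
        \<le> real (card I) * (inverse (real N) * (\<Sum>n<N. b n))"
      using eventually_ge_at_top[of m] eventually_gt_at_top[of 0]
    proof eventually_elim
      case (elim N)
      have "inverse (real N) * (d * (real N - real m)) \<le> inverse (real N) * (real (card I) * (\<Sum>n<N. b n))"
        by (intro mult_left_mono le elim) auto
      then show ?case using elim by (simp add: field_simps)
    qed
    ultimately have "d * (1 - real m * 0) \<le> real (card I) * 0"
      by (intro tendsto_le[OF sequentially_bot])
    then show False using d by simp
  qed
  \<comment> \<open>Each new term must suit all earlier ones, hence a well-founded recursion on the
    whole initial segment.\<close>
  have "\<exists>s :: nat \<Rightarrow> nat. \<forall>j. \<forall>i<j. s i < s j \<and> b (s j - s i) \<le> d"
  proof (rule dependent_wf_choice[OF wf_less_than, unfolded less_than_iff])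
    show "(\<forall>i<j. g i < r \<and> b (r - g i) \<le> d) = (\<forall>i<j. h i < r \<and> b (r - h i) \<le> d)"
      if "\<And>z. z < j \<Longrightarrow> g z = h z" for g h :: "nat \<Rightarrow> nat" and j r
      using that by auto
    show "\<exists>r. \<forall>i<j. g i < r \<and> b (r - g i) \<le> d" for g :: "nat \<Rightarrow> nat" and j
      using step[of "g ` {..<j}"] by auto
  qed
  then obtain s :: "nat \<Rightarrow> nat" where "\<And>i j. i < j \<Longrightarrow> s i < s j \<and> b (s j - s i) \<le> d" by blast
  then show ?thesis by (intro exI[of _ s]) (simp add: strict_mono_def)
qed

section \<open>Functionals that annihilate all eigenprojections\<close>

context spectral_operator
begin

lemma mu_P: "A \<in> sets M \<Longrightarrow> A \<subseteq> f -` {\<nu>} \<Longrightarrow> mu A x = P \<nu> (mu A x)"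
  using mu_Int[OF level_set_point, of A \<nu> x] sets.sets_into_space[of A M]
  by (simp add: Int_absorb1)

text \<open>Making the union disjoint shrinks its pieces, which is why \<open>null\<close> ranges
  over all measurable subsets of each \<open>A i\<close>.\<close>

lemma countable_union_null:
  assumes \<phi>: "\<phi> \<in> dual" and I: "countable I" and A: "\<And>i. i \<in> I \<Longrightarrow> A i \<in> sets M"
    and null: "\<And>i B. i \<in> I \<Longrightarrow> B \<in> sets M \<Longrightarrow> B \<subseteq> A i \<Longrightarrow> \<phi> (mu B \<psi>) = 0"
    and B: "B \<in> sets M" "B \<subseteq> (\<Union>i\<in>I. A i)"
  shows "\<phi> (mu B \<psi>) = 0"
proof (cases "I = {}")
  case True
  then show ?thesis using B mu_empty dual_zero[OF \<phi>] by auto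
next
  case False
  define C where "C n = B \<inter> A (from_nat_into I n)" for n
  have mem: "from_nat_into I n \<in> I" for n using False by (rule from_nat_into)
  have C: "range C \<subseteq> sets M" using mem A B(1) by (auto simp: C_def)
  have "(\<Union>n. disjointed C n) = B"
  proof -
    have "(\<Union>n. C n) = B \<inter> (\<Union>i\<in>I. A i)"
      using range_from_nat_into[OF False I] by (auto simp: C_def mem) (metis mem rangeE)
    then show ?thesis using B(2) by (simp add: UN_disjointed_eq Int_absorb2)
  qed
  then have "(\<lambda>n. \<phi> (mu (disjointed C n) \<psi>)) sums \<phi> (mu B \<psi>)"
    using mu_sums[OF sets.range_disjointed_sets[OF C] disjoint_family_disjointed \<phi>, of \<psi>] by simp
  moreover have "\<phi> (mu (disjointed C n) \<psi>) = 0" for n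
    using sets.range_disjointed_sets[OF C] disjointed_subset[of C n]
    by (intro null[OF mem[of n]]) (auto simp: C_def)
  ultimately have "(\<lambda>n. 0) sums \<phi> (mu B \<psi>)" by simp
  then show ?thesis by (rule sums_unique2) simp
qed

end

text \<open>Later \<open>r\<close> is the modulus of the eigenvalue under study. The hypotheses on
  the spectrum enter only through what they say beyond the circle of radius \<open>r\<close>: there
  the spectrum consists of the eigenvalues in \<open>\<Omega>\<close>, and their moduli are
  countable.\<close>

locale circular_point_spectrum = spectral_operator smul T M mu f
  for smul :: "complex \<Rightarrow> 'a::ab_group_add \<Rightarrow> 'a" and T :: "'a topology"
    and M :: "'s measure" and mu :: "'s set \<Rightarrow> 'a \<Rightarrow> 'a" and f :: "'s \<Rightarrow> complex" +
  fixes r :: real and \<Omega> :: "complex set"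
  assumes separable: "separable_space T"
    and weakly_compact: "locally_sequentially_weakly_compact smul T"
    and r_nonneg: "0 \<le> r"
    and \<Omega>_eigen: "\<nu> \<in> \<Omega> \<Longrightarrow> \<not> inj (pencil smul (spectral_integral smul T M mu f) \<nu>)"
    and \<Omega>_outside: "\<nu> \<in> \<Omega> \<Longrightarrow> r < cmod \<nu>"
    and outside: "r < cmod z \<Longrightarrow> z \<notin> \<Omega> \<Longrightarrow> z \<in> resolvent_set smul T (spectral_integral smul T M mu f)"
    and circles: "countable (cmod ` \<Omega>)"
begin

definition G :: "'s set" where "G = {x \<in> space M. r < cmod (f x)}"

lemma G_sets [measurable]: "G \<in> sets M"
  unfolding G_def by measurable

lemma G_null: "A \<in> sets M \<Longrightarrow> A \<subseteq> G \<Longrightarrow> f ` A \<inter> \<Omega> = {} \<Longrightarrow> mu A \<psi> = 0"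
  by (rule mu_resolvent_null) (auto simp: G_def intro!: outside)

text \<open>Characters of the angle, cut off to \<open>G\<close>, where \<open>f\<close> does not
  vanish and \<open>sgn (f x)\<close> lies on the unit circle. \<open>spint (e n) \<psi>\<close> is
  thus a vector-valued Fourier coefficient.\<close>

abbreviation "e n x \<equiv> indicator G x * sgn (f x) ^ n"

lemma e_bm: "bounded_measurable (e n)"
  by (rule bounded_measurableI[where C = 1])
    (auto simp: indicator_def norm_mult norm_power norm_sgn intro!: power_le_one)

lemma e_le_1: "cmod (e n x) \<le> 1"
  by (auto simp: indicator_def norm_mult norm_power norm_sgn intro!: power_le_one)

text \<open>A ray meets each circle in a single point, which is in \<open>\<Omega>\<close>, where
  \<open>\<phi>\<close> vanishes by \<open>P0\<close>, or in the resolvent set. Countably many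
  circles carry \<open>\<Omega>\<close>; the rest of the ray has only resolvent points.\<close>

lemma ray_null:
  assumes \<phi>: "\<phi> \<in> dual" and P0: "\<And>\<nu> \<eta>. \<nu> \<in> \<Omega> \<Longrightarrow> \<phi> (P \<nu> \<eta>) = 0"
  shows "\<phi> (mu {x \<in> G. sgn (f x) = c} \<psi>) = 0"
proof -
  let ?X = "{x \<in> G. sgn (f x) = c}"
  have X: "?X \<in> sets M" by measurable
  define A where "A t = {x \<in> ?X. cmod (f x) = t}" for t
  have A: "A t \<in> sets M" for t unfolding A_def by measurable
  have UA: "(\<Union>t\<in>cmod ` \<Omega>. A t) \<in> sets M" using circles A by (intro sets.countable_UN') auto
  have point: "\<phi> (mu B \<psi>) = 0" if B: "B \<in> sets M" "B \<subseteq> A t" for B t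
  proof -
    have Bz: "B \<subseteq> f -` {of_real t * c}"
    proof
      fix x assume "x \<in> B"
      then have "cmod (f x) = t" "sgn (f x) = c" using B by (auto simp: A_def)
      then have "f x = of_real t * c"
        using norm_sgn[of "f x"] by (cases "f x = 0") (auto simp: sgn_div_norm scaleR_conv_of_real field_simps)
      then show "x \<in> f -` {of_real t * c}" by simp
    qed
    show ?thesis
    proof (cases "of_real t * c \<in> \<Omega>")
      case True
      then show ?thesis using P0 mu_P[OF B(1) Bz, of \<psi>] by metis
    next
      case False
      then have "mu B \<psi> = 0" using B Bz by (intro G_null) (auto simp: A_def)
      then show ?thesis by (simp add: dual_zero[OF \<phi>])
    qed
  qed
  have "\<phi> (mu (\<Union>t\<in>cmod ` \<Omega>. A t) \<psi>) = 0"
    using point by (intro countable_union_null[OF \<phi> circles A _ UA]) auto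
  moreover have "mu (?X - (\<Union>t\<in>cmod ` \<Omega>. A t)) \<psi> = 0"
    using X UA by (intro G_null) (auto simp: A_def)
  moreover have "mu ?X \<psi> = mu (\<Union>t\<in>cmod ` \<Omega>. A t) \<psi> + mu (?X - (\<Union>t\<in>cmod ` \<Omega>. A t)) \<psi>"
  proof -
    have "mu ((\<Union>t\<in>cmod ` \<Omega>. A t) \<union> (?X - (\<Union>t\<in>cmod ` \<Omega>. A t))) \<psi>
        = mu (\<Union>t\<in>cmod ` \<Omega>. A t) \<psi> + mu (?X - (\<Union>t\<in>cmod ` \<Omega>. A t)) \<psi>"
      using X UA by (intro mu_Un) auto
    moreover have "(\<Union>t\<in>cmod ` \<Omega>. A t) \<union> (?X - (\<Union>t\<in>cmod ` \<Omega>. A t)) = ?X" by (auto simp: A_def)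
    ultimately show ?thesis by metis
  qed
  ultimately show ?thesis by (simp add: dual_add[OF \<phi>] dual_zero[OF \<phi>])
qed

text \<open>Wiener's lemma for the Fourier coefficients of \<open>\<phi> \<circ> mu\<close> in the angular variable, which has no atoms.\<close>

lemma Wiener_mean:
  assumes \<phi>: "\<phi> \<in> dual" and P0: "\<And>\<nu> \<eta>. \<nu> \<in> \<Omega> \<Longrightarrow> \<phi> (P \<nu> \<eta>) = 0"
  shows "(\<lambda>N. inverse (real N) * (\<Sum>n<N. (cmod (\<phi> (spint (e n) \<psi>)))\<^sup>2)) \<longlonglongrightarrow> 0"
proof -
  define a where "a n = \<phi> (spint (e n) \<psi>)" for n
  obtain p' where p': "p' \<in> CS" "\<And>A x. A \<in> sets M \<Longrightarrow> cmod (\<phi> (mu A x)) \<le> p' x"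
    using equicontinuous[OF cmod_dual_CS[OF \<phi>]] by blast
  have a_le: "cmod (a n) \<le> 4 * p' \<psi>" for n
    unfolding a_def using spint_bound[OF cmod_dual_CS[OF \<phi>] e_bm _ e_le_1 p'(2), of n \<psi>] by simp
  \<comment> \<open>Integrated against \<open>\<phi>\<close>, \<open>h N\<close> gives the mean of
    the squared coefficients; pointwise it tends to the conjugate of the \<open>\<phi>\<close>-mass
    of the ray through \<open>x\<close>. The double integral of the classical proof becomes two
    nested bounded convergences.\<close>
  define h where "h N x = inverse (of_nat N) * (\<Sum>n<N. cnj (a n) * e n x)" for N x
  have h: "bounded_measurable (h N)" for N
    unfolding h_def by (intro bounded_measurable_cmult bounded_measurable_sum e_bm)
  have ptw: "(\<lambda>N. h N x) \<longlonglongrightarrow> 0" for x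
  proof (cases "x \<in> G")
    case False
    then show ?thesis by (simp add: h_def)
  next
    case True
    define c where "c = sgn (f x)"
    have "f x \<noteq> 0" using True r_nonneg by (auto simp: G_def)
    then have c: "c * cnj c = 1" by (simp add: c_def complex_norm_square[symmetric] norm_sgn)
    then have c1: "cmod c = 1" using \<open>f x \<noteq> 0\<close> by (simp add: c_def norm_sgn)
    \<comment> \<open>After the twist by \<open>cnj c\<close>, the base of the powers is 1 exactly
      on the ray of direction \<open>c\<close>, so the means converge to its indicator.\<close>
    define k where "k N y = inverse (of_nat N) * (\<Sum>n<N. (cnj c) ^ n * e n y)" for N y
    have k: "bounded_measurable (k N)" for N
      unfolding k_def by (intro bounded_measurable_cmult bounded_measurable_sum e_bm)
    have k_eq: "k N y = indicator G y * (inverse (of_nat N) * (\<Sum>n<N. (cnj c * sgn (f y)) ^ n))" for N y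
      unfolding k_def by (simp add: sum_distrib_left power_mult_distrib mult_ac)
    have w: "cmod (cnj c * sgn (f y)) \<le> 1" for y using c1 by (simp add: norm_mult norm_sgn)
    have "limitin T (\<lambda>N. spint (k N) \<psi>) (spint (indicator {y \<in> G. sgn (f y) = c}) \<psi>) sequentially"
    proof (rule spint_bounded_convergence[OF k, where C = 1])
      show "bounded_measurable (indicator {y \<in> G. sgn (f y) = c})"
        by (intro bounded_measurable_indicator) measurable
      fix y
      show "(\<lambda>N. k N y) \<longlonglongrightarrow> indicator {y \<in> G. sgn (f y) = c} y"
      proof -
        have "cnj c * sgn (f y) = 1 \<longleftrightarrow> sgn (f y) = c"
          using c by (metis mult.assoc mult.commute mult.right_neutral)
        then have "(if cnj c * sgn (f y) = 1 then 1 else 0) = (if sgn (f y) = c then 1 else 0 :: complex)"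
          by simp
        then have "(\<lambda>N. k N y) \<longlonglongrightarrow> indicator G y * (if sgn (f y) = c then 1 else 0)"
          unfolding k_eq using cesaro_geometric[OF w[of y]] by (intro tendsto_mult_left) simp
        then show ?thesis by (cases "y \<in> G"; cases "sgn (f y) = c") simp_all
      qed
      fix N
      have "cmod (\<Sum>n<N. (cnj c) ^ n * e n y) \<le> (\<Sum>n<N. 1)"
        using c1 e_le_1 by (intro sum_norm_le) (simp add: norm_mult norm_power)
      then have "inverse (real N) * cmod (\<Sum>n<N. (cnj c) ^ n * e n y) \<le> inverse (real N) * real N"
        by (intro mult_left_mono) auto
      also have "\<dots> \<le> 1" by (cases "N = 0") auto
      finally show "cmod (k N y) \<le> 1" by (simp add: k_def norm_mult norm_inverse)
    qed
    then have "(\<lambda>N. \<phi> (spint (k N) \<psi>)) \<longlonglongrightarrow> \<phi> (spint (indicator {y \<in> G. sgn (f y) = c}) \<psi>)"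
      by (rule limitin_dual[OF _ \<phi>])
    also have "\<phi> (spint (indicator {y \<in> G. sgn (f y) = c}) \<psi>) = 0"
      by (subst spint_indicator) (measurable, rule ray_null[OF \<phi> P0])
    finally have "(\<lambda>N. cnj (\<phi> (spint (k N) \<psi>))) \<longlonglongrightarrow> cnj 0" by (intro tendsto_cnj)
    moreover have "h N x = cnj (\<phi> (spint (k N) \<psi>))" for N
    proof -
      have "spint (k N) \<psi> = smul (inverse (of_nat N)) (\<Sum>n<N. smul (cnj c ^ n) (spint (e n) \<psi>))"
        unfolding k_def
        by (subst spint_cmult[OF bounded_measurable_sum[OF bounded_measurable_cmult[OF e_bm]]],
            subst spint_sum[OF bounded_measurable_cmult[OF e_bm]], subst spint_cmult[OF e_bm]) simp
      then show ?thesis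
        using True by (simp add: h_def a_def dual_scale[OF \<phi>] dual_sum[OF \<phi>] c_def mult_ac)
    qed
    ultimately show ?thesis by simp
  qed
  have "limitin T (\<lambda>N. spint (h N) \<psi>) (spint (\<lambda>x. 0) \<psi>) sequentially"
  proof (rule spint_bounded_convergence[OF h bounded_measurable_const, where C = "4 * p' \<psi>"])
    fix N x
    have "cmod (\<Sum>n<N. cnj (a n) * e n x) \<le> (\<Sum>n<N. (4 * p' \<psi>) * 1)"
    proof (rule sum_norm_le)
      fix n
      have "cmod (a n) * cmod (e n x) \<le> (4 * p' \<psi>) * 1"
        using CS_nonneg[OF p'(1), of \<psi>] by (intro mult_mono a_le e_le_1) auto
      then show "cmod (cnj (a n) * e n x) \<le> (4 * p' \<psi>) * 1"
        by (simp only: norm_mult complex_mod_cnj)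
    qed
    then have "inverse (real N) * cmod (\<Sum>n<N. cnj (a n) * e n x)
        \<le> inverse (real N) * (real N * (4 * p' \<psi>))"
      by (intro mult_left_mono) auto
    also have "\<dots> \<le> 4 * p' \<psi>"
      using CS_nonneg[OF p'(1), of \<psi>] by (cases "N = 0") (simp_all flip: mult.assoc)
    finally show "cmod (h N x) \<le> 4 * p' \<psi>" by (simp add: h_def norm_mult norm_inverse)
  qed (rule ptw)
  then have "(\<lambda>N. \<phi> (spint (h N) \<psi>)) \<longlonglongrightarrow> \<phi> (spint (\<lambda>x. 0) \<psi>)"
    by (rule limitin_dual[OF _ \<phi>])
  moreover have "spint (\<lambda>x. 0) \<psi> = 0" using spint_cmult[OF bounded_measurable_const, of 0 0] by simp
  moreover have "\<phi> (spint (h N) \<psi>) = of_real (inverse (real N) * (\<Sum>n<N. (cmod (a n))\<^sup>2))" for N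
  proof -
    have "spint (h N) \<psi> = smul (inverse (of_nat N)) (\<Sum>n<N. smul (cnj (a n)) (spint (e n) \<psi>))"
      unfolding h_def
      by (subst spint_cmult[OF bounded_measurable_sum[OF bounded_measurable_cmult[OF e_bm]]],
          subst spint_sum[OF bounded_measurable_cmult[OF e_bm]], subst spint_cmult[OF e_bm]) simp
    then have "\<phi> (spint (h N) \<psi>) = inverse (of_nat N) * (\<Sum>n<N. cnj (a n) * a n)"
      by (simp add: a_def dual_scale[OF \<phi>] dual_sum[OF \<phi>])
    also have "(\<Sum>n<N. cnj (a n) * a n) = of_real (\<Sum>n<N. (cmod (a n))\<^sup>2)"
      unfolding of_real_sum by (intro sum.cong refl) (metis complex_norm_square mult.commute of_real_power)
    finally show ?thesis by simp
  qed
  ultimately have "(\<lambda>N. complex_of_real (inverse (real N) * (\<Sum>n<N. (cmod (a n))\<^sup>2))) \<longlonglongrightarrow> of_real 0"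
    by (simp add: dual_zero[OF \<phi>])
  then show ?thesis unfolding tendsto_of_real_iff by (simp add: a_def)
qed

text \<open>Separability enters only here: countably many vectors suffice to detect all eigenprojections, so
  a diagonal subsequence makes the characters converge at every eigenvalue simultaneously.\<close>

lemma characters_converge:
  fixes n :: "nat \<Rightarrow> nat"
  obtains s where "strict_mono s" "\<And>\<nu>. \<nu> \<in> \<Omega> \<Longrightarrow> convergent (\<lambda>j. sgn \<nu> ^ n (s j))"
proof -
  obtain D where D: "countable D" "T closure_of D = UNIV"
    using separable by (auto simp: separable_space_def topspace_UNIV)
  have "D \<noteq> {}" using D(2) by auto
  define d where "d = from_nat_into D"
  have ranged: "range d = D" unfolding d_def by (rule range_from_nat_into[OF \<open>D \<noteq> {}\<close> D(1)])
  define Q where "Q m s \<longleftrightarrow> (\<forall>\<phi>\<in>dual. convergent (\<lambda>j. \<phi> (spint (e (n (s j))) (d m))))" for m and s :: "nat \<Rightarrow> nat"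
  interpret subseqs Q
  proof
    fix m and s :: "nat \<Rightarrow> nat"
    let ?x = "\<lambda>j. spint (e (n (s j))) (d m)"
    have "bdd_above (range (\<lambda>j. p (?x j)))" if p: "p \<in> CS" for p
    proof -
      obtain p' where p': "p' \<in> CS" "\<And>A x. A \<in> sets M \<Longrightarrow> p (mu A x) \<le> p' x"
        using equicontinuous[OF p] by blast
      show ?thesis
        by (rule bdd_aboveI2[where M = "4 * 1 * p' (d m)"])
          (rule spint_bound[OF p e_bm _ e_le_1 p'(2)], simp_all)
    qed
    then have "\<exists>r' l. strict_mono r' \<and> weakly_converges smul T (?x \<circ> r') l"
      by (intro weakly_compact[unfolded locally_sequentially_weakly_compact_def, rule_format])
    then obtain r' l where "strict_mono r'" "weakly_converges smul T (?x \<circ> r') l" by blast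
    then show "\<exists>r'. strict_mono r' \<and> Q m (s \<circ> r')"
      by (auto simp: Q_def weakly_converges_def o_def convergent_def)
  qed
  have Q_sub: "Q m (s \<circ> t)" if "strict_mono t" "Q m s" for t m s
  proof -
    have "convergent ((\<lambda>j. \<phi> (spint (e (n (s j))) (d m))) \<circ> t)" if "\<phi> \<in> dual" for \<phi>
      using \<open>Q m s\<close> that by (intro convergent_subseq_convergent \<open>strict_mono t\<close>) (simp add: Q_def)
    then show ?thesis by (simp add: Q_def o_def)
  qed
  have Q_diag: "convergent (\<lambda>j. \<phi> (spint (e (n (diagseq j))) (d m)))" if \<phi>: "\<phi> \<in> dual" for m \<phi>
  proof -
    \<comment> \<open>The diagonal sequence is controlled for the vector \<open>d m\<close> only
      from index \<open>Suc m\<close> on; an initial segment does not affect convergence.\<close>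
    have "convergent (\<lambda>j. \<phi> (spint (e (n (diagseq (j + Suc m)))) (d m)))"
      using diagseq_holds[of m, OF Q_sub] \<phi> by (simp add: Q_def o_def add.commute)
    then show ?thesis
      by (subst (asm) convergent_ignore_initial_segment[where f = "\<lambda>j. \<phi> (spint (e (n (diagseq j))) (d m))"])
  qed
  show thesis
  proof (rule that[OF subseq_diagseq])
    fix \<nu> assume \<nu>: "\<nu> \<in> \<Omega>"
    note Pop = mu_operator[OF level_set_point]
    obtain y where y: "y \<noteq> 0" "P \<nu> y = y" using point_spectrum_eigenvector[OF \<Omega>_eigen[OF \<nu>]] .
    obtain p where p: "p \<in> CS" "p y \<noteq> 0" using CS_separating[OF y(1)] by blast
    obtain q where q: "q \<in> CS" "\<And>x. p (P \<nu> x) \<le> q x"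
      using Pop p(1) unfolding continuous_operators_iff by blast
    have "0 < p y" using p CS_nonneg[OF p(1), of y] by simp
    then have "y \<in> {x. q (x - y) < p y}" using CS_zero[OF q(1)] by simp
    moreover have "y \<in> W \<and> openin T W \<longrightarrow> (\<exists>x. x \<in> D \<and> x \<in> W)" for W
      using D(2) in_closure_of[of y T D] by simp
    ultimately have "\<exists>x. x \<in> D \<and> x \<in> {x. q (x - y) < p y}"
      using ball_open[OF q(1), of y "p y"] by metis
    then obtain m where m: "q (d m - y) < p y" using ranged by auto
    \<comment> \<open>The seminorm \<open>q\<close> dominates \<open>p \<circ> P \<nu>\<close>, so a
      point of \<open>D\<close> that is \<open>q\<close>-close to the eigenvector \<open>y\<close>
      keeps a nonzero projection.\<close>
    have "P \<nu> (d m) \<noteq> 0"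
    proof
      assume "P \<nu> (d m) = 0"
      then have "p y = p (P \<nu> (d m - y))"
        using y(2) seminorm_minus[OF CS_seminorm[OF p(1)]] by (simp add: mu_diff level_set_point)
      also have "\<dots> < p y" using q(2)[of "d m - y"] m by simp
      finally show False by simp
    qed
    then obtain \<phi> where \<phi>: "\<phi> \<in> dual" "\<phi> (P \<nu> (d m)) \<noteq> 0" using dual_separates by blast
    \<comment> \<open>The eigenprojection turns the Fourier coefficient into
      \<open>sgn \<nu> ^ k\<close> times a fixed nonzero vector, so weak convergence of coefficients
      becomes convergence of the character at \<open>\<nu>\<close>.\<close>
    have "P \<nu> (spint (e k) (d m)) = smul (sgn \<nu> ^ k) (P \<nu> (d m))" for k
    proof -
      have "P \<nu> (spint (e k) (d m)) = spint (\<lambda>x. e k x * indicator (f -` {\<nu>} \<inter> space M) x) (d m)"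
        using spint_mult_mu[OF e_bm level_set_point] by simp
      also have "\<dots> = spint (\<lambda>x. sgn \<nu> ^ k * indicator (f -` {\<nu>} \<inter> space M) x) (d m)"
        using \<Omega>_outside[OF \<nu>] by (intro fun_cong[OF spint_cong]) (auto simp: indicator_def G_def)
      also have "\<dots> = smul (sgn \<nu> ^ k) (P \<nu> (d m))"
        by (simp add: spint_cmult bounded_measurable_indicator spint_indicator level_set_point)
      finally show ?thesis .
    qed
    then have "sgn \<nu> ^ k = \<phi> (P \<nu> (spint (e k) (d m))) / \<phi> (P \<nu> (d m))" for k
      using \<phi> by (simp add: dual_scale)
    moreover have "convergent (\<lambda>j. \<phi> (P \<nu> (spint (e (n (diagseq j))) (d m))))"
      by (rule Q_diag[OF dual_compose[OF \<phi>(1) Pop]])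
    ultimately show "convergent (\<lambda>j. sgn \<nu> ^ n (diagseq j))"
      using convergent_mult_const_right_iff[of "inverse (\<phi> (P \<nu> (d m)))"] \<phi>(2)
      by (simp add: divide_inverse)
  qed
qed

theorem no_continuous_part:
  assumes \<phi>: "\<phi> \<in> dual" and GP: "\<And>\<eta>. \<phi> (mu G \<eta>) = \<phi> \<eta>"
    and P0: "\<And>\<nu> \<eta>. \<nu> \<in> \<Omega> \<Longrightarrow> \<phi> (P \<nu> \<eta>) = 0"
  shows "\<phi> \<psi> = 0"
proof (rule ccontr)
  assume "\<phi> \<psi> \<noteq> 0"
  then have "0 < (cmod (\<phi> \<psi>) / 2)\<^sup>2" by simp
  \<comment> \<open>Wiener's mean is quadratic, hence the square in the threshold; half of |\<phi>
    \<psi>| is small enough to contradict a limit equal to |\<phi> \<psi>|.\<close>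
  have "\<exists>n :: nat \<Rightarrow> nat. strict_mono n \<and>
      (\<forall>i j. i < j \<longrightarrow> (cmod (\<phi> (spint (e (n j - n i)) \<psi>)))\<^sup>2 \<le> (cmod (\<phi> \<psi>) / 2)\<^sup>2)"
    by (rule cesaro_null_small_differences[OF _ Wiener_mean[OF \<phi> P0]]) (simp, assumption, fact)
  then obtain n :: "nat \<Rightarrow> nat" where n: "strict_mono n \<and>
      (\<forall>i j. i < j \<longrightarrow> (cmod (\<phi> (spint (e (n j - n i)) \<psi>)))\<^sup>2 \<le> (cmod (\<phi> \<psi>) / 2)\<^sup>2)" ..
  obtain s where s: "strict_mono s" "\<And>\<nu>. \<nu> \<in> \<Omega> \<Longrightarrow> convergent (\<lambda>j. sgn \<nu> ^ n (s j))"
    using characters_converge by blast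
  \<comment> \<open>Consecutive differences along the subsequence are still differences of terms of
    \<open>n\<close>, so the smallness survives.\<close>
  define k where "k j = n (s (Suc j)) - n (s j)" for j
  have less: "n (s j) < n (s (Suc j))" "s j < s (Suc j)" for j
    using n s(1) by (auto simp: strict_mono_def)
  have small: "cmod (\<phi> (spint (e (k j)) \<psi>)) \<le> cmod (\<phi> \<psi>) / 2" for j
    
  proof (rule power2_le_imp_le)
    show "(cmod (\<phi> (spint (e (k j)) \<psi>)))\<^sup>2 \<le> (cmod (\<phi> \<psi>) / 2)\<^sup>2"
      unfolding k_def by (rule conjunct2[OF n, rule_format, OF less(2)])
  qed simp
  have one: "(\<lambda>j. sgn \<nu> ^ k j) \<longlonglongrightarrow> 1" if \<nu>: "\<nu> \<in> \<Omega>" for \<nu>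
  proof -
    have norm1: "cmod (sgn \<nu>) = 1" using \<Omega>_outside[OF \<nu>] r_nonneg by (auto simp: norm_sgn)
    obtain l where l: "(\<lambda>j. sgn \<nu> ^ n (s j)) \<longlonglongrightarrow> l" using s(2)[OF \<nu>] by (auto simp: convergent_def)
    have "cmod l = 1" using tendsto_norm[OF l] norm1 by (simp add: norm_power LIMSEQ_const_iff)
    then have "l \<noteq> 0" by auto
    have "(\<lambda>j. sgn \<nu> ^ n (s (Suc j)) / sgn \<nu> ^ n (s j)) \<longlonglongrightarrow> l / l"
      using LIMSEQ_Suc[OF l] l \<open>l \<noteq> 0\<close> by (intro tendsto_divide)
    moreover have "sgn \<nu> ^ n (s (Suc j)) / sgn \<nu> ^ n (s j) = sgn \<nu> ^ k j" for j
      unfolding k_def using norm1 less(1)[of j] by (subst power_diff) auto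
    ultimately show ?thesis using \<open>l \<noteq> 0\<close> by simp
  qed
  \<comment> \<open>The set where the characters tend to 1, written with countable quantifiers to be
    visibly measurable; no measurability of \<open>\<Omega>\<close> is available to use
    instead.\<close>
  define Y where "Y = {x \<in> G. \<forall>m::nat. \<exists>N. \<forall>j\<ge>N. cmod (sgn (f x) ^ k j - 1) < inverse (real (Suc m))}"
  have Y [measurable]: "Y \<in> sets M" unfolding Y_def by measurable
  have inverse_small: "(\<forall>\<epsilon>>0. \<exists>N. \<forall>j\<ge>N. t j < \<epsilon>) \<longleftrightarrow> (\<forall>m. \<exists>N. \<forall>j\<ge>N. t j < inverse (real (Suc m)))"
    for t :: "nat \<Rightarrow> real"
  proof safe
    fix \<epsilon> :: real assume t: "\<forall>m. \<exists>N. \<forall>j\<ge>N. t j < inverse (real (Suc m))" and "0 < \<epsilon>"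
    then obtain m where "inverse (real (Suc m)) < \<epsilon>" using reals_Archimedean by blast
    with t show "\<exists>N. \<forall>j\<ge>N. t j < \<epsilon>" by (meson order.strict_trans)
  qed simp
  have Y_iff: "x \<in> Y \<longleftrightarrow> x \<in> G \<and> (\<lambda>j. sgn (f x) ^ k j) \<longlonglongrightarrow> 1" for x
    unfolding Y_def lim_sequentially dist_norm
    using inverse_small by simp
  \<comment> \<open>By \<open>one\<close> no eigenvalue lies over \<open>G - Y\<close>, so only
    resolvent points remain there.\<close>
  have "mu (G - Y) x = 0" for x
    using one by (intro G_null) (auto simp: Y_iff)
  moreover have "mu (Y \<union> (G - Y)) x = mu Y x + mu (G - Y) x" for x by (intro mu_Un) auto
  moreover have "Y \<union> (G - Y) = G" by (auto simp: Y_iff)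
  ultimately have GY: "mu G x = mu Y x" for x by simp
  have "limitin T (\<lambda>j. spint (\<lambda>x. e (k j) x * indicator Y x) \<psi>) (spint (indicator Y) \<psi>) sequentially"
  proof (rule spint_bounded_convergence[where C = 1])
    show "bounded_measurable (\<lambda>x. e (k j) x * indicator Y x)" for j
      by (intro bounded_measurable_mult e_bm bounded_measurable_indicator Y)
    show "bounded_measurable (indicator Y)" by (intro bounded_measurable_indicator Y)
    show "cmod (e (k j) x * indicator Y x) \<le> 1" for j x
      using e_le_1[of x "k j"] by (simp add: indicator_def)
    show "(\<lambda>j. e (k j) x * indicator Y x) \<longlonglongrightarrow> indicator Y x" for x
      by (cases "x \<in> Y") (auto simp: Y_iff)
  qed
  then have "(\<lambda>j. \<phi> (spint (\<lambda>x. e (k j) x * indicator Y x) \<psi>)) \<longlonglongrightarrow> \<phi> (mu Y \<psi>)"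
    using limitin_dual[OF _ \<phi>] by (simp add: spint_indicator)
  moreover have "spint (\<lambda>x. e (k j) x * indicator Y x) \<psi> = spint (e (k j)) \<psi>" for j
  proof -
    have "spint (\<lambda>x. e (k j) x * indicator Y x) \<psi> = spint (\<lambda>x. e (k j) x * indicator G x) \<psi>"
      by (simp add: spint_mult_mu(1)[OF e_bm] GY)
    also have "\<dots> = spint (e (k j)) \<psi>"
      by (intro fun_cong[OF spint_cong]) (simp add: indicator_def)
    finally show ?thesis .
  qed
  moreover have "\<phi> (mu Y \<psi>) = \<phi> \<psi>" using GP[of \<psi>] by (simp add: GY)
  ultimately have "(\<lambda>j. cmod (\<phi> (spint (e (k j)) \<psi>))) \<longlonglongrightarrow> cmod (\<phi> \<psi>)"
    by (intro tendsto_norm) simp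
  then have "cmod (\<phi> \<psi>) \<le> cmod (\<phi> \<psi>) / 2" using small by (intro LIMSEQ_le_const2) auto
  with \<open>\<phi> \<psi> \<noteq> 0\<close> show False by simp
qed

text \<open>The directed family is \<open>G\<close> with finitely many eigenvalue levels removed. A
  functional invariant under all members annihilates each \<open>P \<nu>\<close>, as one sees by
  comparing \<open>G\<close> with \<open>G\<close> minus one level, and so has no continuous part
  left to live on.\<close>

theorem eigenprojections_has_sum: "sot_has_sum smul T P \<Omega> (mu G)"
  unfolding sot_has_sum_def sot_tendsto_def
proof (intro allI ballI tendstoI)
  fix \<psi> p and \<epsilon> :: real assume p: "p \<in> CS" and \<epsilon>: "0 < \<epsilon>"
  define L where "L F = f -` F \<inter> space M" for F
  have L: "L F \<in> sets M" if "finite F" for F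
    unfolding L_def by (intro level_sets borel_closed finite_imp_closed that)
  define \<F> where "\<F> = {G - L F | F. finite F \<and> F \<subseteq> \<Omega>}"
  have "\<exists>A\<in>\<F>. \<forall>B\<in>sets M. B \<subseteq> A \<longrightarrow> p (mu B \<psi>) < \<epsilon>"
  proof (rule directed_family_small[OF _ _ _ _ p \<epsilon>])
    show "\<F> \<subseteq> sets M" "\<F> \<noteq> {}" using L by (auto simp: \<F>_def)
    show "\<exists>C\<in>\<F>. C \<subseteq> A \<inter> B" if AB: "A \<in> \<F>" "B \<in> \<F>" for A B
    proof -
      obtain F F' where "A = G - L F" "finite F" "F \<subseteq> \<Omega>" "B = G - L F'" "finite F'" "F' \<subseteq> \<Omega>"
        using AB by (auto simp: \<F>_def)
      then have "G - L (F \<union> F') \<in> \<F>" "G - L (F \<union> F') \<subseteq> A \<inter> B"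
        unfolding \<F>_def by (blast, auto simp: L_def)
      then show ?thesis by blast
    qed
    fix \<phi> assume \<phi>: "\<phi> \<in> dual" and inv: "\<And>A \<eta>. A \<in> \<F> \<Longrightarrow> \<phi> (mu A \<eta>) = \<phi> \<eta>"
    have GP: "\<phi> (mu G \<eta>) = \<phi> \<eta>" for \<eta>
    proof -
      have "G - L {} \<in> \<F>" unfolding \<F>_def by blast
      then show ?thesis using inv by (simp add: L_def)
    qed
    show "\<phi> \<psi> = 0"
    proof (rule no_continuous_part[OF \<phi> GP])
      fix \<nu> \<eta> assume \<nu>: "\<nu> \<in> \<Omega>"
      then have "G - L {\<nu>} \<in> \<F>" unfolding \<F>_def by blast
      then have "\<phi> (mu (G - L {\<nu>}) \<eta>) = \<phi> \<eta>" by (rule inv)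
      moreover have "mu (G - L {\<nu>}) \<eta> = mu G \<eta> - P \<nu> \<eta>"
        unfolding L_def using \<Omega>_outside[OF \<nu>] level_set_point by (intro mu_Diff) (auto simp: G_def)
      ultimately show "\<phi> (P \<nu> \<eta>) = 0" using GP[of \<eta>] by (simp add: dual_diff[OF \<phi>])
    qed
  qed
  then obtain F0 where F0: "finite F0" "F0 \<subseteq> \<Omega>"
    "\<And>B. B \<in> sets M \<Longrightarrow> B \<subseteq> G - L F0 \<Longrightarrow> p (mu B \<psi>) < \<epsilon>"
    by (auto simp: \<F>_def)
  have "dist (p ((\<Sum>\<nu>\<in>F. P \<nu> \<psi>) - mu G \<psi>)) 0 < \<epsilon>" if F: "finite F" "F0 \<subseteq> F" "F \<subseteq> \<Omega>" for F
  proof -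
    have "L F = (\<Union>\<nu>\<in>F. f -` {\<nu>} \<inter> space M)" by (auto simp: L_def)
    then have "mu (L F) \<psi> = (\<Sum>\<nu>\<in>F. P \<nu> \<psi>)"
      using F(1) level_set_point by (simp only:) (rule mu_UN, auto simp: disjoint_family_on_def)
    moreover have "L F \<subseteq> G" using F(3) \<Omega>_outside by (auto simp: L_def G_def)
    ultimately have "mu (G - L F) \<psi> = mu G \<psi> - (\<Sum>\<nu>\<in>F. P \<nu> \<psi>)"
      using mu_Diff[OF G_sets L[OF F(1)]] by simp
    moreover have "p (mu (G - L F) \<psi>) < \<epsilon>"
      using L[OF F(1)] F(2) by (intro F0(3)) (auto simp: L_def)
    ultimately show ?thesis
      using CS_commute[OF p, of "mu G \<psi>"] CS_nonneg[OF p] by simp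
  qed
  then show "\<forall>\<^sub>F F in finite_subsets_at_top \<Omega>. dist (p ((\<Sum>\<nu>\<in>F. P \<nu> \<psi>) - mu G \<psi>)) 0 < \<epsilon>"
    unfolding eventually_finite_subsets_at_top using F0(1,2) by blast
qed

end

section \<open>Averages\<close>

context spectral_operator
begin

lemma sot_tendsto_iff: "sot_tendsto smul T A B F \<longleftrightarrow> (\<forall>\<psi>. limitin T (\<lambda>i. A i \<psi>) (B \<psi>) F)"
  by (simp add: sot_tendsto_def limitin_iff)

lemma spint_funpow: "bounded_measurable g \<Longrightarrow> (spint g ^^ k) \<psi> = spint (\<lambda>x. g x ^ k) \<psi>"
  by (induction k) (simp_all add: spint_one spint_mult bounded_measurable_power)

text \<open>A mean ergodic theorem: powers of the integral are integrals of powers, and the Cesaro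
  means of \<open>g x ^ k\<close> are bounded by 1 and converge to the indicator of
  \<open>g = 1\<close>.\<close>

lemma averaging_limit:
  assumes g: "bounded_measurable g" and le: "\<And>x. x \<in> space M \<Longrightarrow> cmod (g x) \<le> 1"
  shows "limitin T (\<lambda>n. averaging smul n (spint g) \<psi>) (mu {x \<in> space M. g x = 1} \<psi>) sequentially"
proof -
  note [measurable] = bounded_measurable_borel[OF g]
  have X: "{x \<in> space M. g x = 1} \<in> sets M" by measurable
  have "averaging smul n (spint g) \<psi> = spint (\<lambda>x. inverse (of_nat n) * (\<Sum>k<n. g x ^ k)) \<psi>" for n
    using g by (simp add: averaging_def spint_funpow spint_cmult spint_sum bounded_measurable_sum
        bounded_measurable_power)
  moreover have "limitin T (\<lambda>n. spint (\<lambda>x. inverse (of_nat n) * (\<Sum>k<n. g x ^ k)) \<psi>)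
      (spint (indicator {x \<in> space M. g x = 1}) \<psi>) sequentially"
  proof (rule spint_bounded_convergence[where C = 1])
    show "bounded_measurable (\<lambda>x. inverse (of_nat n) * (\<Sum>k<n. g x ^ k))" for n
      by (intro bounded_measurable_cmult bounded_measurable_sum bounded_measurable_power g)
    show "bounded_measurable (indicator {x \<in> space M. g x = 1})"
      by (rule bounded_measurable_indicator[OF X])
    fix x assume x: "x \<in> space M"
    show "(\<lambda>n. inverse (of_nat n) * (\<Sum>k<n. g x ^ k)) \<longlonglongrightarrow> indicator {x \<in> space M. g x = 1} x"
      using cesaro_geometric[OF le[OF x]] x by (cases "g x = 1") (simp_all only: indicator_simps mem_Collect_eq simp_thms if_True if_False)
    fix n
    have "cmod (\<Sum>k<n. g x ^ k) \<le> (\<Sum>k<n. 1)"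
      using le[OF x] by (intro sum_norm_le) (simp add: norm_power power_le_one)
    then have "inverse (real n) * cmod (\<Sum>k<n. g x ^ k) \<le> inverse (real n) * real n"
      by (intro mult_left_mono) auto
    \<comment> \<open>At \<open>n = 0\<close> the inverse is 0, and so is the whole product.\<close>
    also have "\<dots> \<le> 1" by (cases "n = 0") auto
    finally show "cmod (inverse (of_nat n) * (\<Sum>k<n. g x ^ k)) \<le> 1"
      by (simp add: norm_mult norm_inverse)
  qed
  ultimately show ?thesis by (simp add: spint_indicator[OF X])
qed

lemma averaging_restricted_limit:
  assumes K: "K \<in> sets M" "\<And>x. x \<in> K \<Longrightarrow> cmod (f x) \<le> cmod \<nu>" and \<nu>: "\<nu> \<noteq> 0"
  shows "limitin T (\<lambda>n. averaging smul n (\<lambda>x. smul (inverse \<nu>) (U x)) (mu K \<psi>))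
    (mu (f -` {\<nu>} \<inter> K) \<psi>) sequentially"
proof -
  define h g where "h x = inverse \<nu> * f x" and "g x = h x * indicator K x" for x
  have h: "bounded_measurable h" unfolding h_def by (intro bounded_measurable_cmult f_bm)
  have g: "bounded_measurable g"
    unfolding g_def by (intro bounded_measurable_mult h bounded_measurable_indicator K)
  have "(\<lambda>x. smul (inverse \<nu>) (U x)) = spint h"
    unfolding h_def by (intro ext) (simp add: spint_cmult f_bm)
  \<comment> \<open>The operators \<open>spint h\<close> and \<open>spint g\<close> differ, but
    agree on vectors projected by \<open>mu K\<close>, which both preserve; for \<open>k = 0\<close>
    both sides are \<open>mu K \<psi>\<close>.\<close>
  moreover have "(spint h ^^ k) (mu K \<psi>) = (spint g ^^ k) (mu K \<psi>)" for k
  proof -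
    have "spint (\<lambda>x. h x ^ k * indicator K x) \<psi> = spint (\<lambda>x. g x ^ k * indicator K x) \<psi>"
      by (intro fun_cong[OF spint_cong]) (simp add: g_def indicator_def)
    then show ?thesis using h g K(1)
      by (simp add: spint_funpow spint_mult_mu(1) bounded_measurable_power)
  qed
  ultimately have "averaging smul n (\<lambda>x. smul (inverse \<nu>) (U x)) (mu K \<psi>) = averaging smul n (spint g) (mu K \<psi>)" for n
    by (simp add: averaging_def)
  moreover have "cmod (g x) \<le> 1" for x
    using K(2)[of x] \<nu> by (auto simp: g_def h_def indicator_def norm_mult norm_inverse norm_divide divide_simps)
  then have "limitin T (\<lambda>n. averaging smul n (spint g) (mu K \<psi>)) (mu {x \<in> space M. g x = 1} (mu K \<psi>)) sequentially"
    by (intro averaging_limit g)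
  moreover have "{x \<in> space M. g x = 1} = f -` {\<nu>} \<inter> K"
    using sets.sets_into_space[OF K(1)] \<nu> by (auto simp: g_def h_def indicator_def field_simps split: if_splits)
  moreover have "mu (f -` {\<nu>} \<inter> K) (mu K \<psi>) = mu (f -` {\<nu>} \<inter> K) \<psi>"
  proof -
    have "f -` {\<nu>} \<inter> K = (f -` {\<nu>} \<inter> space M) \<inter> K" using sets.sets_into_space[OF K(1)] by auto
    then have "f -` {\<nu>} \<inter> K \<in> sets M" using K(1) level_set_point[of \<nu>] by auto
    then show ?thesis using mu_Int[OF _ K(1), of "f -` {\<nu>} \<inter> K" \<psi>] by simp
  qed
  ultimately show ?thesis by simp
qed

end

section \<open>Averages after removal of outer eigenvalues\<close>

context circular_point_spectrum
begin

text \<open>Beyond the circle through \<open>\<nu>\<close> only resolvent points remain once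
  \<open>F\<close> is removed, so effectively \<open>f\<close> is bounded by |\<nu>|.
  \<open>F\<close> may also contain other eigenvalues on that circle, which allows ties in the
  recursion.\<close>

lemma averaging_after_removal:
  assumes F: "finite F" "\<And>z. z \<in> \<Omega> \<Longrightarrow> cmod \<nu> < cmod z \<Longrightarrow> z \<in> F"
    and \<nu>: "\<nu> \<noteq> 0" "r \<le> cmod \<nu>" "\<nu> \<notin> F"
  shows "limitin T (\<lambda>n. averaging smul n (\<lambda>x. smul (inverse \<nu>) (U x)) (mu (space M - f -` F \<inter> space M) \<psi>))
    (P \<nu> \<psi>) sequentially"
proof -
  define K where "K = {x \<in> space M. f x \<notin> F \<and> cmod (f x) \<le> cmod \<nu>}"
  define X where "X = {x \<in> space M. f x \<notin> F \<and> cmod \<nu> < cmod (f x)}"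
  have L: "f -` F \<inter> space M \<in> sets M"
    using F(1) by (intro level_sets borel_closed finite_imp_closed)
  have "K = (space M - f -` F \<inter> space M) \<inter> {x \<in> space M. cmod (f x) \<le> cmod \<nu>}"
    "X = (space M - f -` F \<inter> space M) \<inter> {x \<in> space M. cmod \<nu> < cmod (f x)}"
    by (auto simp: K_def X_def)
  then have KX: "K \<in> sets M" "X \<in> sets M" using L by (auto intro!: sets.Int)
  have "mu X \<psi> = 0"
    using KX(2) F(2) \<nu>(2) by (intro G_null) (auto simp: X_def G_def)
  moreover have "K \<union> X = space M - f -` F \<inter> space M" by (auto simp: K_def X_def)
  moreover have "mu (K \<union> X) \<psi> = mu K \<psi> + mu X \<psi>"
    using KX by (intro mu_Un) (auto simp: K_def X_def)
  ultimately have eq: "mu (space M - f -` F \<inter> space M) \<psi> = mu K \<psi>" by simp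
  have "f -` {\<nu>} \<inter> K = f -` {\<nu>} \<inter> space M" using \<nu>(3) by (auto simp: K_def)
  then show ?thesis
    unfolding eq using averaging_restricted_limit[OF KX(1) _ \<nu>(1), of \<psi>] by (simp add: K_def)
qed

lemma averages_sot:
  assumes lam: "\<zeta> \<noteq> 0" "cmod \<zeta> = r"
  shows "sot_tendsto smul T (\<lambda>n. averaging smul n (\<lambda>\<psi>. smul (inverse \<zeta>) (U (\<psi> - mu G \<psi>)))) (P \<zeta>) sequentially"
    and "sot_tendsto smul T (\<lambda>n \<psi>. smul (inverse (of_nat n))
      (\<Sum>k=1..<n. smul (inverse (\<zeta> ^ k)) ((U ^^ k) (\<psi> - mu G \<psi>)))) (P \<zeta>) sequentially"
proof -
  let ?H = "space M - G"
  have H: "?H \<in> sets M" by simp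
  have H_eq: "\<psi> - mu G \<psi> = mu ?H \<psi>" for \<psi> by (simp add: mu_Compl)
  define g where "g x = inverse \<zeta> * f x * indicator ?H x" for x
  have g: "bounded_measurable g"
    unfolding g_def by (intro bounded_measurable_mult bounded_measurable_cmult f_bm bounded_measurable_indicator H)
  have g1: "cmod (g x) \<le> 1" if "x \<in> space M" for x
    using that lam by (auto simp: g_def indicator_def G_def norm_mult norm_inverse norm_divide divide_simps)
  have level: "{x \<in> space M. g x = 1} = f -` {\<zeta>} \<inter> space M"
    using lam by (auto simp: g_def indicator_def G_def field_simps split: if_splits)
  have op: "(\<lambda>\<psi>. smul (inverse \<zeta>) (U (\<psi> - mu G \<psi>))) = spint g"
    unfolding g_def H_eq
    by (intro ext) (simp only: spint_mult_mu(1)[OF bounded_measurable_cmult[OF f_bm] H] spint_cmult[OF f_bm])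
  note lim = averaging_limit[OF g g1, unfolded level]
  show "sot_tendsto smul T (\<lambda>n. averaging smul n (\<lambda>\<psi>. smul (inverse \<zeta>) (U (\<psi> - mu G \<psi>)))) (P \<zeta>) sequentially"
    unfolding op sot_tendsto_iff using lim by blast
  \<comment> \<open>Only for positive exponents: the zeroth power is the identity, whereas the
    right-hand side would be \<open>\<psi> - mu G \<psi>\<close>.\<close>
  have power: "(spint g ^^ k) \<psi> = smul (inverse (\<zeta> ^ k)) ((U ^^ k) (\<psi> - mu G \<psi>))" if "0 < k" for k \<psi>
  proof -
    have "(spint g ^^ k) \<psi> = spint (\<lambda>x. g x ^ k) \<psi>" by (rule spint_funpow[OF g])
    also have "\<dots> = spint (\<lambda>x. inverse (\<zeta> ^ k) * (f x ^ k * indicator ?H x)) \<psi>"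
      using that by (intro fun_cong[OF spint_cong])
        (simp add: g_def indicator_def power_mult_distrib power_inverse)
    also have "\<dots> = smul (inverse (\<zeta> ^ k)) (spint (\<lambda>x. f x ^ k * indicator ?H x) \<psi>)"
      by (intro spint_cmult bounded_measurable_mult bounded_measurable_power f_bm bounded_measurable_indicator H)
    also have "spint (\<lambda>x. f x ^ k * indicator ?H x) \<psi> = (U ^^ k) (mu ?H \<psi>)"
      by (simp only: spint_mult_mu(1)[OF bounded_measurable_power[OF f_bm] H] spint_funpow[OF f_bm])
    finally show ?thesis by (simp only: H_eq)
  qed
  \<comment> \<open>The two averages differ by the term \<open>k = 0\<close>, that is
    \<open>\<psi>\<close> divided by \<open>n\<close>, which tends to 0. At \<open>n = 0\<close>
    both sides are 0.\<close>
  have shift: "smul (inverse (of_nat n)) (\<Sum>k=1..<n. smul (inverse (\<zeta> ^ k)) ((U ^^ k) (\<psi> - mu G \<psi>)))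
      = averaging smul n (spint g) \<psi> + smul (- inverse (of_nat n)) \<psi>" for n \<psi>
  proof (cases n)
    case (Suc m)
    have "(\<Sum>k<n. (spint g ^^ k) \<psi>) = \<psi> + (\<Sum>k=1..<n. (spint g ^^ k) \<psi>)"
      unfolding lessThan_atLeast0 Suc by (subst sum.atLeast_Suc_lessThan) auto
    then show ?thesis
      by (simp add: averaging_def scale_right_distrib power)
  qed (simp add: averaging_def)
  have "limitin T (\<lambda>n. smul (- inverse (of_nat n)) \<psi>) 0 sequentially" for \<psi>
    unfolding limitin_iff
  proof
    fix p assume p: "p \<in> CS"
    have "(\<lambda>n. inverse (real n) * p \<psi>) \<longlonglongrightarrow> 0 * p \<psi>"
      by (intro tendsto_mult_right lim_inverse_n)
    then show "(\<lambda>n. p (smul (- inverse (of_nat n)) \<psi> - 0)) \<longlonglongrightarrow> 0"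
      by (simp add: seminorm_scale[OF CS_seminorm[OF p]] seminorm_minus[OF CS_seminorm[OF p]] norm_inverse)
  qed
  from limitin_add[OF lim this]
  show "sot_tendsto smul T (\<lambda>n \<psi>. smul (inverse (of_nat n))
      (\<Sum>k=1..<n. smul (inverse (\<zeta> ^ k)) ((U ^^ k) (\<psi> - mu G \<psi>)))) (P \<zeta>) sequentially"
    unfolding sot_tendsto_iff shift by simp
qed

text \<open>The residuals have a closed form, \<open>mu\<close> of the complement of the first
  \<open>j\<close> eigenvalue levels applied to \<open>\<psi>\<close>; removing one more level
  subtracts one projection. Decreasing modulus ensures that all strictly larger eigenvalues are gone
  at each stage, while ties may come in any order.\<close>

lemma finite_recursion:
  assumes lam: "\<zeta> \<noteq> 0" "cmod \<zeta> = r"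
    and \<nu>s: "distinct \<nu>s" "set \<nu>s = \<Omega>" "sorted_wrt (\<lambda>a b. cmod a \<ge> cmod b) \<nu>s"
  shows "\<exists>u :: nat \<Rightarrow> 'a. u 0 = \<psi> \<and>
    (\<forall>j < length \<nu>s.
       limitin T (\<lambda>n. averaging smul n (\<lambda>x. smul (inverse (\<nu>s ! j)) (U x)) (u j)) (P (\<nu>s ! j) \<psi>) sequentially \<and>
       u (Suc j) = u j - P (\<nu>s ! j) \<psi>) \<and>
    limitin T (\<lambda>n. averaging smul n (\<lambda>x. smul (inverse \<zeta>) (U x)) (u (length \<nu>s))) (P \<zeta> \<psi>) sequentially"
proof -
  define u where "u j = mu (space M - f -` set (take j \<nu>s) \<inter> space M) \<psi>" for j
  show ?thesis
  proof (intro exI[of _ u] conjI allI impI)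
    show "u 0 = \<psi>" by (simp add: u_def mu_space)
    show "limitin T (\<lambda>n. averaging smul n (\<lambda>x. smul (inverse \<zeta>) (U x)) (u (length \<nu>s))) (P \<zeta> \<psi>) sequentially"
      unfolding u_def using lam \<nu>s(2) \<Omega>_outside[of \<zeta>]
      by (intro averaging_after_removal) (auto simp flip: \<nu>s(2))
    fix j assume j: "j < length \<nu>s"
    have mem: "\<nu>s ! j \<in> \<Omega>" using j \<nu>s(2) nth_mem by blast
    have notin: "\<nu>s ! j \<notin> set (take j \<nu>s)"
      using \<nu>s(1) j by (auto simp: in_set_conv_nth nth_eq_iff_index_eq)
    show "limitin T (\<lambda>n. averaging smul n (\<lambda>x. smul (inverse (\<nu>s ! j)) (U x)) (u j)) (P (\<nu>s ! j) \<psi>) sequentially"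
      unfolding u_def
    proof (rule averaging_after_removal)
      fix z assume "z \<in> \<Omega>" and z: "cmod (\<nu>s ! j) < cmod z"
      then obtain i where i: "i < length \<nu>s" "z = \<nu>s ! i" using \<nu>s(2) by (auto simp: in_set_conv_nth)
      have "i < j"
      proof (rule ccontr)
        assume "\<not> i < j"
        then have "cmod (\<nu>s ! i) \<le> cmod (\<nu>s ! j)"
          using sorted_wrt_nth_less[OF \<nu>s(3), of j i] i(1) by (cases "i = j") auto
        with z i(2) show False by simp
      qed
      then show "z \<in> set (take j \<nu>s)" using i by (auto simp: in_set_conv_nth)
    qed (use \<Omega>_outside[OF mem] r_nonneg notin in auto)
    have "space M - f -` set (take (Suc j) \<nu>s) \<inter> space M
        = (space M - f -` set (take j \<nu>s) \<inter> space M) - (f -` {\<nu>s ! j} \<inter> space M)"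
      using j by (auto simp: take_Suc_conv_app_nth)
    moreover have "f -` set (take j \<nu>s) \<inter> space M \<in> sets M"
      by (intro level_sets borel_closed finite_imp_closed) simp
    ultimately show "u (Suc j) = u j - P (\<nu>s ! j) \<psi>"
      unfolding u_def using notin level_set_point by (simp only:) (intro mu_Diff, auto)
  qed
qed

end

theorem theorem3p6:
  fixes smul :: "complex \<Rightarrow> 'a::ab_group_add \<Rightarrow> 'a"
    and T :: "'a topology"
    and M :: "'s measure"
    and mu :: "'s set \<Rightarrow> 'a \<Rightarrow> 'a"
    and f :: "'s \<Rightarrow> complex"
    and U :: "'a \<Rightarrow> 'a"
    and E :: "complex set \<Rightarrow> 'a \<Rightarrow> 'a"
    and P :: "complex \<Rightarrow> 'a \<Rightarrow> 'a"
    and R :: real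
    and lam :: complex
    and Omega :: "complex set"
  assumes "locally_convex_space smul T"
    and "separable_space T"
    and "sequentially_complete smul T"
    and "locally_sequentially_weakly_compact smul T"
    and "equicontinuous_spectral_measure smul T M mu"
    and "f \<in> borel_measurable M"
    and "bounded (f ` space M)"
    and "U = spectral_integral smul T M mu f"
    and "E = spectral_pushforward M mu f"
    and "P = (\<lambda>\<nu>. E {\<nu>})"
    and "dominating_point_spectrum_from smul T U R"
    and "concentrated_on_isolated_circles smul M f U"
    and "lam \<in> point_spectrum smul T U"
    and "lam \<noteq> 0"
    and "R \<le> cmod lam"
    and "Omega = {\<nu> \<in> point_spectrum smul T U. cmod \<nu> > cmod lam}"
  shows "(\<exists>Q \<in> continuous_operators smul T.
            sot_has_sum smul T P Omega Q \<and>
            sot_tendsto smul T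
              (\<lambda>n. averaging smul n (\<lambda>\<psi>. smul (inverse lam) (U (\<psi> - Q \<psi>))))
              (P lam) sequentially \<and>
            sot_tendsto smul T
              (\<lambda>n \<psi>. smul (inverse (of_nat n))
                        (\<Sum>k=1..<n. smul (inverse (lam ^ k)) ((U ^^ k) (\<psi> - Q \<psi>))))
              (P lam) sequentially) \<and>
         (finite Omega \<longrightarrow>
            (\<forall>\<psi> \<nu>s. distinct \<nu>s \<and> set \<nu>s = Omega \<and> sorted_wrt (\<lambda>a b. cmod a \<ge> cmod b) \<nu>s \<longrightarrow>
               (\<exists>u :: nat \<Rightarrow> 'a.
                  u 0 = \<psi> \<and>
                  (\<forall>j < length \<nu>s.
                     limitin T
                       (\<lambda>n. averaging smul n (\<lambda>x. smul (inverse (\<nu>s ! j)) (U x)) (u j))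
                       (P (\<nu>s ! j) \<psi>) sequentially \<and>
                     u (Suc j) = u j - P (\<nu>s ! j) \<psi>) \<and>
                  limitin T
                    (\<lambda>n. averaging smul n (\<lambda>x. smul (inverse lam) (U x)) (u (length \<nu>s)))
                    (P lam \<psi>) sequentially)))"
proof -
  have "vector_space smul" using assms(1) by (simp add: locally_convex_space_def)
  then interpret S: spectral_operator smul T M mu f
    using assms(1,3,5,6,7)
    by (intro spectral_operator.intro spectral_space.intro lcs.intro complex_vector_space.intro
        lcs_axioms.intro spectral_space_axioms.intro spectral_operator_axioms.intro)
  note U = assms(8)
  have P: "P \<nu> = mu (f -` {\<nu>} \<inter> space M)" for \<nu>
    by (simp add: assms(9,10) spectral_pushforward_def)
  have "z \<in> resolvent_set smul T U" if "cmod lam < cmod z" "z \<notin> Omega" for z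
  proof (rule ccontr)
    assume "z \<notin> resolvent_set smul T U"
    \<comment> \<open>\<open>z\<close> is not in the open ball of radius |z|, so the dominance
      condition can be used at the radius \<open>cmod z\<close> itself, which exceeds
      \<open>R\<close>.\<close>
    then have "z \<in> spectrum smul T U - ball 0 (cmod z)" by (simp add: spectrum_def)
    moreover have "R < cmod z" using assms(15) that(1) by simp
    ultimately have "z \<in> point_spectrum smul T U"
      using assms(11) unfolding dominating_point_spectrum_from_def by blast
    with that assms(16) show False by simp
  qed
  moreover have "countable (cmod ` Omega)"
  proof (rule countable_subset[OF _ countable_discrete_real])
    show "discrete {r. \<exists>s\<in>space M. cmod (f s) = r \<and> \<not> inj (pencil smul U (f s))}"
      using assms(12) by (simp add: concentrated_on_isolated_circles_def)
    show "cmod ` Omega \<subseteq> {r. \<exists>s\<in>space M. cmod (f s) = r \<and> \<not> inj (pencil smul U (f s))}"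
    proof
      fix t assume "t \<in> cmod ` Omega"
      then obtain \<nu> where \<nu>: "t = cmod \<nu>" "\<not> inj (pencil smul U \<nu>)"
        using assms(16) by (auto simp: point_spectrum_def)
      then obtain s where "s \<in> space M" "\<nu> = f s"
        using S.point_spectrum_value[of \<nu>] U by auto
      with \<nu> show "t \<in> {r. \<exists>s\<in>space M. cmod (f s) = r \<and> \<not> inj (pencil smul U (f s))}" by blast
    qed
  qed
  ultimately interpret C: circular_point_spectrum smul T M mu f "cmod lam" Omega
    using assms(2,4,16) U
    by (intro circular_point_spectrum.intro S.spectral_operator_axioms
        circular_point_spectrum_axioms.intro) (auto simp: point_spectrum_def)
  have Pfun: "P = (\<lambda>\<nu>. mu (f -` {\<nu>} \<inter> space M))" by (rule ext) (rule P)
  show ?thesis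
  proof (intro conjI impI allI)
    show "\<exists>Q \<in> continuous_operators smul T.
            sot_has_sum smul T P Omega Q \<and>
            sot_tendsto smul T
              (\<lambda>n. averaging smul n (\<lambda>\<psi>. smul (inverse lam) (U (\<psi> - Q \<psi>))))
              (P lam) sequentially \<and>
            sot_tendsto smul T
              (\<lambda>n \<psi>. smul (inverse (of_nat n))
                        (\<Sum>k=1..<n. smul (inverse (lam ^ k)) ((U ^^ k) (\<psi> - Q \<psi>))))
              (P lam) sequentially"
      \<comment> \<open>The witness for \<open>Q\<close> is \<open>mu G\<close>, the spectral
        projection of the region of modulus above |lam|.\<close>
      unfolding U Pfun
      using S.mu_operator[OF C.G_sets] C.eigenprojections_has_sum C.averages_sot[OF assms(14) refl]
      by blast
    fix \<psi> \<nu>s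
    assume "distinct \<nu>s \<and> set \<nu>s = Omega \<and> sorted_wrt (\<lambda>a b. cmod a \<ge> cmod b) \<nu>s"
    then show "\<exists>u :: nat \<Rightarrow> 'a.
                  u 0 = \<psi> \<and>
                  (\<forall>j < length \<nu>s.
                     limitin T
                       (\<lambda>n. averaging smul n (\<lambda>x. smul (inverse (\<nu>s ! j)) (U x)) (u j))
                       (P (\<nu>s ! j) \<psi>) sequentially \<and>
                     u (Suc j) = u j - P (\<nu>s ! j) \<psi>) \<and>
                  limitin T
                    (\<lambda>n. averaging smul n (\<lambda>x. smul (inverse lam) (U x)) (u (length \<nu>s)))
                    (P lam \<psi>) sequentially"
      unfolding U Pfun by (intro C.finite_recursion[OF assms(14) refl]) auto
  qed
qed

end
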